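(* There exists $\varepsilon_0>0$ such that the following holds. Let $\kappa:\mathbb{R}^2\setminus\{0\}\to\mathbb{R}$ be an even function, homogeneous of degree $0$, of class $C^3$ on $\mathbb{R}^2\setminus\{0\}$, satisfying $$|\nabla^j\kappa(z)|\le\varepsilon_0\quad\text{for } |z|=1 \text{ and } j\in\{0,1,2,3\}.$$ Then there exists a triple $(a,b,\varphi)$ with $a,b>0$ and $\varphi\in[0,2\pi)$ such that, with $E=E(a,b,\varphi)$, the probability measure $\chi_E/|E|$ (i.e. the measure with density $\chi_E/|E|$ with respect to Lebesgue measure) is the unique minimiser over $\mathcal{P}(\mathbb{R}^2)$ of the energy $$I^\kappa(\mu)=\int_{\mathbb{R}^2}\int_{\mathbb{R}^2}W^\kappa(z-w)\,d\mu(z)\,d\mu(w)+\int_{\mathbb{R}^2}|z|^2\,d\mu(z).$$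
   Context: $\mathbb{R}^2$ is identified with $\mathbb{C}$. $\mathcal{P}(\mathbb{R}^2)$ is the set of Borel probability measures on $\mathbb{R}^2$. The interaction potential is $W^\kappa(z)=-\log|z|+\kappa(z)$ for $z\ne0$, and $W^\kappa(0)=+\infty$. The energy is understood as the double integral $I^\kappa(\mu)=\iint\big(W^\kappa(z-w)+\tfrac12(|z|^2+|w|^2)\big)\,d\mu(z)\,d\mu(w)\in(-\infty,+\infty]$, whose integrand is bounded from below. "Even" means $\kappa(-z)=\kappa(z)$. For $a,b>0$ and $\varphi\in[0,2\pi)$, $$E(a,b,\varphi)=e^{i\varphi}\left\{(x,y)\in\mathbb{R}^2:\ \frac{x^2}{a^2}+\frac{y^2}{b^2}\le1\right\},$$ i.e. the compact set enclosed by the ellipse with semi-axes $a$, $b$, rotated by the angle $\varphi$. $\chi_E$ is the characteristic function of $E$ and $|E|$ its Lebesgue measure. *)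

theory Defs
  imports "HOL-Probability.Probability"
begin

text \<open>
  The type \<^typ>\<open>complex\<close> plays the role of the Euclidean plane, with \<^term>\<open>lborel\<close> as its
  Lebesgue measure. A function on the punctured plane is a total function on \<^typ>\<open>complex\<close>
  whose value at \<open>0\<close> is never used.
\<close>

text \<open>
  The derivative as a bounded linear map. Iterating it gives the derivative of order \<open>j\<close> as an
  element of a \<open>j\<close>-fold nested space of bounded linear maps, whose norm is the operator norm of
  the corresponding \<open>j\<close>-linear form. The value is meaningful only where the function is
  differentiable.
\<close>

definition nabla ::
  "('a::real_normed_vector \<Rightarrow> 'b::real_normed_vector) \<Rightarrow> 'a \<Rightarrow> 'a \<Rightarrow>\<^sub>L 'b"
  where "nabla f z = Blinfun (frechet_derivative f (at z))"

text \<open>Intended for open \<open>S\<close>: the derivatives are taken with respect to full neighbourhoods.\<close>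

definition C3_on ::
  "'a::real_normed_vector set \<Rightarrow> ('a \<Rightarrow> 'b::real_normed_vector) \<Rightarrow> bool"
  where "C3_on S f \<longleftrightarrow>
    (\<forall>z\<in>S. f differentiable (at z)) \<and>
    (\<forall>z\<in>S. nabla f differentiable (at z)) \<and>
    (\<forall>z\<in>S. nabla (nabla f) differentiable (at z)) \<and>
    continuous_on S (nabla (nabla (nabla f)))"

definition even_off_0 :: "(complex \<Rightarrow> real) \<Rightarrow> bool"
  where "even_off_0 \<kappa> \<longleftrightarrow> (\<forall>z. z \<noteq> 0 \<longrightarrow> \<kappa> (- z) = \<kappa> z)"

definition homogeneous_0 :: "(complex \<Rightarrow> real) \<Rightarrow> bool"
  where "homogeneous_0 \<kappa> \<longleftrightarrow> (\<forall>z t. z \<noteq> 0 \<longrightarrow> 0 < t \<longrightarrow> \<kappa> (t *\<^sub>R z) = \<kappa> z)"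

definition W :: "(complex \<Rightarrow> real) \<Rightarrow> complex \<Rightarrow> ereal"
  where "W \<kappa> z = (if z = 0 then \<infinity> else ereal (- ln (norm z) + \<kappa> z))"

text \<open>
  The integral of an extended real function as positive part minus negative part. It is the usual
  integral when one of the two parts is finite, in particular for a measurable function that is
  bounded from below and a finite measure. Note that \<^const>\<open>e2ennreal\<close> sends negative values
  to \<open>0\<close>.
\<close>

definition ereal_integral :: "'a measure \<Rightarrow> ('a \<Rightarrow> ereal) \<Rightarrow> ereal"
  where "ereal_integral M f =
    enn2ereal (\<integral>\<^sup>+ x. e2ennreal (f x) \<partial>M) - enn2ereal (\<integral>\<^sup>+ x. e2ennreal (- f x) \<partial>M)"

text \<open>
  The confinement is put inside the double integral, so that the integrand is bounded from below;
  integrated separately, the interaction term alone can be \<open>\<infinity> - \<infinity>\<close>.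
\<close>

definition energy :: "(complex \<Rightarrow> real) \<Rightarrow> complex measure \<Rightarrow> ereal"
  where "energy \<kappa> \<mu> = ereal_integral (\<mu> \<Otimes>\<^sub>M \<mu>)
    (\<lambda>(z, w). W \<kappa> (z - w) + ereal (((norm z)\<^sup>2 + (norm w)\<^sup>2) / 2))"

definition borel_prob_measures :: "complex measure set"
  where "borel_prob_measures = {\<mu>. sets \<mu> = sets borel \<and> prob_space \<mu>}"

definition ellipse :: "real \<Rightarrow> real \<Rightarrow> real \<Rightarrow> complex set"
  where "ellipse a b \<phi> =
    (\<lambda>z. exp (\<i> * complex_of_real \<phi>) * z) ` {z. (Re z)\<^sup>2 / a\<^sup>2 + (Im z)\<^sup>2 / b\<^sup>2 \<le> 1}"

definition unique_minimiser :: "('a \<Rightarrow> 'b::ord) \<Rightarrow> 'a set \<Rightarrow> 'a \<Rightarrow> bool"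
  where "unique_minimiser F P x \<longleftrightarrow>
    is_arg_min F (\<lambda>y. y \<in> P) x \<and> (\<forall>y. is_arg_min F (\<lambda>y. y \<in> P) y \<longrightarrow> y = x)"

end

theory Submission imports Defs begin

text \<open>
  The plane is studied through its projections to lines. A point \<open>z\<close> has the coordinate
  \<open>Im (z * cis (- t))\<close> perpendicular to the direction \<open>t\<close>, and \<open>- ln \<bar>Im (z * cis (- t))\<bar>\<close> is a
  one-dimensional logarithmic potential. Averaging it over all directions with a constant density
  gives \<open>- ln \<bar>z\<bar>\<close> up to an additive constant, and averaging it with a suitable density \<open>g\<close> gives
  \<open>- ln \<bar>z\<bar> + \<kappa> z\<close> up to an additive constant. On the circle this is a convolution equation for \<open>g\<close>,
  solved in \<open>log_sin_deconvolution\<close>: the kernel \<open>- ln \<bar>sin\<bar>\<close> convolved twice with a function of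
  mean zero inverts, up to a factor, the second derivative. The solution is close to the constant
  \<open>1 / pi\<close> when the first two derivatives of \<open>\<kappa>\<close> are small, so \<open>g\<close> is positive (\<open>angular_density\<close>).
  Everything else follows from the positivity of \<open>g\<close> and from facts about one-dimensional logarithmic
  potentials.
  
  The interaction is positive definite. For a fixed direction, consider all strips parallel to it of
  width \<open>r \<le> R\<close>. The kernel \<open>- ln \<bar>d\<bar>\<close> is, up to a constant and an error of size at most
  \<open>\<bar>d\<bar> / R\<close>, the measure of the strips that contain two points whose projections have the distance \<open>d\<close>,
  when strips of width \<open>r\<close> have the weight \<open>1 / r\<^sup>2\<close>. For two probability measures the constants cancel
  in the energy of their difference, and this energy is therefore at least the integral of
  \<open>(\<mu> S - \<nu> S)\<^sup>2\<close> over the strips \<open>S\<close> of width at most \<open>1\<close> (\<open>interaction_positive_definite\<close>). If the integral vanishes,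
  then almost all projections of the two measures agree, and the measures are equal
  (\<open>discrepancy_zero\<close>).
  
  The ellipse solves the Euler-Lagrange conditions. Every projection of the normalised Lebesgue measure
  on an ellipse is a semicircle law (\<open>ellipse_projection\<close>), whose radius is the half-width \<open>R t\<close> of the
  ellipse. The logarithmic potential of a semicircle law is a constant minus the square of
  the rescaled coordinate on the support, and at least that everywhere (\<open>semicircle_potential\<close>).
  Averaging over the directions, the potential of the ellipse plus \<open>\<bar>z\<bar>\<^sup>2 / 2\<close> is a constant on the
  ellipse and at least this constant everywhere, provided that the average of
  \<open>(Im (z * cis (- t)) / R t)\<^sup>2\<close> with the density \<open>g\<close> is \<open>\<bar>z\<bar>\<^sup>2 / 2\<close>. With \<open>(R t)\<^sup>2 = 1 + Re (cnj w * cis (2 * t))\<close> this becomes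
  the vanishing of a vector field in the variable \<open>w\<close>, which points inwards on a circle when \<open>g\<close> is
  nearly constant; Brouwer's theorem provides a zero (\<open>ellipse_parameter\<close>).
  
  Expanding the quadratic energy around the ellipse, the linear term is nonnegative by the
  Euler-Lagrange conditions and the quadratic term is nonnegative by positive definiteness, with
  equality only for the ellipse itself (\<open>minimal_energy\<close>).
\<close>

section \<open>Integration over directions\<close>

text \<open>
  A line through the origin is an angle modulo \<open>pi\<close>, so averages over all directions are integrals
  over one period.
\<close>

definition angles :: "real measure" where "angles = density lborel (indicator {0..pi})"

lemma sets_angles [simp, measurable_cong]: "sets angles = sets borel" by (simp add: angles_def)
lemma space_angles [simp]: "space angles = UNIV" by (simp add: angles_def)

lemma nn_integral_angles:
  assumes [measurable]: "f \<in> borel_measurable borel"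
  shows "(\<integral>\<^sup>+x. f x \<partial>angles) = (\<integral>\<^sup>+x. f x * indicator {0..pi} x \<partial>lborel)"
  unfolding angles_def by (subst nn_integral_density) (auto simp: mult.commute)

lemma emeasure_angles_UNIV: "emeasure angles UNIV = ennreal pi"
  unfolding angles_def by (subst emeasure_density) auto

lemma finite_measure_angles: "finite_measure angles"
  by (rule finite_measureI) (simp add: emeasure_angles_UNIV)

interpretation angles: finite_measure angles by (rule finite_measure_angles)

lemma measure_angles_UNIV: "measure angles UNIV = pi"
  by (simp add: measure_def emeasure_angles_UNIV)

lemma AE_angles_not_countable:
  assumes "countable C" shows "AE x in angles. x \<notin> C"
proof -
  have "C \<in> null_sets lborel" using assms by (rule countable_imp_null_set_lborel)
  then have "AE x in lborel. x \<notin> C" by (rule AE_not_in)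
  then show ?thesis unfolding angles_def by (subst AE_density) auto
qed

lemma has_integral_angles_nn:
  fixes f :: "real \<Rightarrow> real"
  assumes [measurable]: "f \<in> borel_measurable borel" and "\<And>x. x \<in> {0..pi} \<Longrightarrow> 0 \<le> f x" and "(f has_integral I) {0..pi}"
  shows "(\<integral>\<^sup>+x. ennreal (f x) \<partial>angles) = ennreal I"
  using nn_integral_has_integral_lebesgue'[OF assms(2,3)] by (simp add: nn_integral_angles)

lemma integrable_angles_iff:
  fixes f :: "real \<Rightarrow> real"
  assumes [measurable]: "f \<in> borel_measurable borel"
  shows "integrable angles f \<longleftrightarrow> set_integrable lborel {0..pi} f"
proof -
  have "angles = density lborel (\<lambda>x. ennreal (indicator {0..pi} x))"
    unfolding angles_def by (simp add: ennreal_indicator)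
  then have "integrable angles f = integrable (density lborel (\<lambda>x. ennreal (indicator {0..pi} x))) f" by (simp only:)
  also have "\<dots> = integrable lborel (\<lambda>x. indicator {0..pi} x *\<^sub>R f x)"
    by (rule integrable_density) auto
  finally show ?thesis unfolding set_integrable_def .
qed

lemma integral_angles:
  fixes f :: "real \<Rightarrow> real"
  assumes [measurable]: "f \<in> borel_measurable borel" and "integrable angles f"
  shows "(f has_integral (\<integral>x. f x \<partial>angles)) {0..pi}"
proof -
  have a: "angles = density lborel (\<lambda>x. ennreal (indicator {0..pi} x))"
    unfolding angles_def by (simp add: ennreal_indicator)
  have "(\<integral>x. f x \<partial>angles) = (LINT x:{0..pi}|lborel. f x)"
    unfolding set_lebesgue_integral_def a by (subst integral_density) auto
  then show ?thesis
    using assms integrable_angles_iff[of f] set_borel_integral_eq_integral[of "{0..pi}" f]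
    by (metis has_integral_integral)
qed

lemma integrable_angles_continuous:
  fixes f :: "real \<Rightarrow> real"
  assumes "continuous_on UNIV f"
  shows "integrable angles f"
proof -
  have [measurable]: "f \<in> borel_measurable borel"
    using assms by (rule borel_measurable_continuous_onI)
  have "set_integrable lborel {0..pi} f"
    by (intro borel_integrable_compact[unfolded set_integrable_def[symmetric]] continuous_on_subset[OF assms]) auto
  then show ?thesis by (simp add: integrable_angles_iff)
qed

lemma periodic_int:
  fixes q :: "real \<Rightarrow> 'a" assumes "\<And>x. q (x + pi) = q x" shows "q (x + of_int n * pi) = q x"
proof (induction n rule: int_induct[where k=0])
  case (step1 i) then show ?case using assms[of "x + of_int i * pi"] by (simp add: algebra_simps)
next
  case (step2 i) then show ?case using assms[of "x + of_int (i - 1) * pi"] by (simp add: algebra_simps)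
qed simp

text \<open>
  Any period serves as domain of integration: after reducing the shift modulo \<open>pi\<close>, the part of
  the shifted period that sticks out is moved back by one period.
\<close>

lemma nn_integral_angles_periodic_shift:
  fixes f :: "real \<Rightarrow> ennreal"
  assumes [measurable]: "f \<in> borel_measurable borel" and per: "\<And>x. f (x + pi) = f x"
  shows "(\<integral>\<^sup>+x. f (x + c) \<partial>angles) = (\<integral>\<^sup>+x. f x \<partial>angles)"
proof -
  have per_int: "f (x + of_int n * pi) = f x" for x n by (rule periodic_int) (rule per)
  define n where "n = \<lfloor>c / pi\<rfloor>"
  define d where "d = c - of_int n * pi"
  have "of_int n \<le> c / pi" "c / pi < of_int n + 1" unfolding n_def by linarith+
  then have d: "0 \<le> d" "d < pi" unfolding d_def by (simp_all add: field_simps)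
  have half: "(\<integral>\<^sup>+x. g x \<partial>angles) = (\<integral>\<^sup>+x. g x * indicator {0..<pi} x \<partial>lborel)"
    if [measurable]: "g \<in> borel_measurable borel" for g :: "real \<Rightarrow> ennreal"
  proof -
    have "AE x in lborel. x \<noteq> pi" by (rule AE_lborel_singleton)
    then have "AE x in lborel. g x * indicator {0..pi} x = g x * indicator {0..<pi} x"
      by eventually_elim (auto simp: indicator_def)
    then show ?thesis by (subst nn_integral_angles) (auto intro!: nn_integral_cong_AE)
  qed
  have "(\<integral>\<^sup>+x. f (x + c) \<partial>angles) = (\<integral>\<^sup>+x. f (x + d) \<partial>angles)"
    using per_int[of "_ + d" n] by (intro nn_integral_cong) (simp add: d_def algebra_simps)
  also have "\<dots> = (\<integral>\<^sup>+x. f (d + x) * indicator {d..<d+pi} (d + x) \<partial>lborel)"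
    by (subst half) (auto intro!: nn_integral_cong simp: indicator_def add.commute)
  also have "\<dots> = (\<integral>\<^sup>+x. f x * indicator {d..<d+pi} x \<partial>lborel)"
    by (subst (2) nn_integral_real_affine[where c=1 and t=d]) auto
  also have "\<dots> = (\<integral>\<^sup>+x. f x * indicator {d..<pi} x + f x * indicator {pi..<pi+d} x \<partial>lborel)"
    using d by (intro nn_integral_cong) (auto simp: indicator_def)
  also have "\<dots> = (\<integral>\<^sup>+x. f x * indicator {d..<pi} x \<partial>lborel) + (\<integral>\<^sup>+x. f x * indicator {pi..<pi+d} x \<partial>lborel)"
    by (rule nn_integral_add) auto
  also have "(\<integral>\<^sup>+x. f x * indicator {pi..<pi+d} x \<partial>lborel) = (\<integral>\<^sup>+x. f x * indicator {0..<d} x \<partial>lborel)"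
    by (subst nn_integral_real_affine[where c=1 and t=pi])
       (auto intro!: nn_integral_cong simp: indicator_def add.commute[of pi] per)
  also have "(\<integral>\<^sup>+x. f x * indicator {d..<pi} x \<partial>lborel) + \<dots> = (\<integral>\<^sup>+x. f x * indicator {d..<pi} x + f x * indicator {0..<d} x \<partial>lborel)"
    by (rule nn_integral_add[symmetric]) auto
  also have "\<dots> = (\<integral>\<^sup>+x. f x * indicator {0..<pi} x \<partial>lborel)"
    using d by (intro nn_integral_cong) (auto simp: indicator_def)
  finally show ?thesis by (simp add: half)
qed

lemma nn_integral_angles_periodic_reflect:
  fixes f :: "real \<Rightarrow> ennreal"
  assumes [measurable]: "f \<in> borel_measurable borel" and per: "\<And>x. f (x + pi) = f x"
  shows "(\<integral>\<^sup>+x. f (c - x) \<partial>angles) = (\<integral>\<^sup>+x. f x \<partial>angles)"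
proof -
  have "(\<integral>\<^sup>+x. f (c - x) \<partial>angles) = (\<integral>\<^sup>+x. f (c - pi + x) * indicator {0..pi} x \<partial>lborel)"
    by (subst nn_integral_angles, simp, subst nn_integral_real_affine[where c="-1" and t=pi])
       (auto intro!: nn_integral_cong simp: indicator_def)
  also have "\<dots> = (\<integral>\<^sup>+x. f (x + (c - pi)) \<partial>angles)"
    by (subst nn_integral_angles) (auto simp: add.commute)
  finally show ?thesis using nn_integral_angles_periodic_shift[OF assms, of "c - pi"] by simp
qed

lemma integral_angles_periodic_reflect:
  fixes f :: "real \<Rightarrow> real"
  assumes m[measurable]: "f \<in> borel_measurable borel" and per: "\<And>x. f (x + pi) = f x"
  shows "integrable angles (\<lambda>x. f (c - x)) \<longleftrightarrow> integrable angles f"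
    and "(\<integral>x. f (c - x) \<partial>angles) = (\<integral>x. f x \<partial>angles)"
proof -
  have 1: "(\<integral>\<^sup>+x. ennreal (f (c - x)) \<partial>angles) = (\<integral>\<^sup>+x. ennreal (f x) \<partial>angles)"
    by (rule nn_integral_angles_periodic_reflect) (auto simp: per)
  have 2: "(\<integral>\<^sup>+x. ennreal (- f (c - x)) \<partial>angles) = (\<integral>\<^sup>+x. ennreal (- f x) \<partial>angles)"
    by (rule nn_integral_angles_periodic_reflect[of "\<lambda>x. ennreal (- f x)"]) (auto simp: per)
  show 3: "integrable angles (\<lambda>x. f (c - x)) \<longleftrightarrow> integrable angles f"
    unfolding real_integrable_def using 1 2 by auto
  show "(\<integral>x. f (c - x) \<partial>angles) = (\<integral>x. f x \<partial>angles)"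
    using 1 2 3 by (cases "integrable angles f") (simp_all add: real_lebesgue_integral_def not_integrable_integral_eq)
qed

section \<open>Fourier coefficients of the logarithm of the sine\<close>

definition log_kernel :: "real \<Rightarrow> real" where "log_kernel x = - ln \<bar>sin x\<bar>"

lemma log_kernel_measurable [measurable]: "log_kernel \<in> borel_measurable borel"
  unfolding log_kernel_def by measurable

lemma log_kernel_nonneg: "0 \<le> log_kernel x"
proof (cases "sin x = 0")
  case False then have "ln \<bar>sin x\<bar> \<le> 0" by (subst ln_le_zero_iff) (auto simp: abs_sin_le_one)
  then show ?thesis by (simp add: log_kernel_def)
qed (simp add: log_kernel_def)

lemma log_kernel_periodic: "log_kernel (x + pi) = log_kernel x" by (simp add: log_kernel_def)
lemma log_kernel_even: "log_kernel (- x) = log_kernel x" by (simp add: log_kernel_def)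

text \<open>
  The quotient \<open>Q\<close> of \<open>sin (2 * j * x)\<close> by \<open>sin x\<close> is a trigonometric polynomial, and
  \<open>cos x * Q x\<close> is \<open>1 + 2 * cos (2 * x) + \<dots> + 2 * cos (2 * (j - 1) * x) + cos (2 * j * x)\<close>, whose integral over
  a period is \<open>pi\<close>. The functions \<open>Q\<close> and \<open>P\<close> make a primitive of \<open>ln (sin x) * cos (2 * j * x)\<close> explicit.
\<close>

lemma dirichlet_sin:
  assumes "1 \<le> (j::nat)"
  shows "\<exists>Q P. (\<forall>x. sin (2 * real j * x) = sin x * Q x) \<and> continuous_on UNIV Q \<and>
     (\<forall>x. (P has_real_derivative cos x * Q x) (at x)) \<and> P pi - P 0 = pi"
  using assms
proof (induction j rule: dec_induct)
  case base
  show ?case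
  proof (rule exI[of _ "\<lambda>x. 2 * cos x"], rule exI[of _ "\<lambda>x. x + sin (2*x) / 2"], intro conjI allI)
    show "((\<lambda>x. x + sin (2*x) / 2) has_real_derivative cos x * (2 * cos x)) (at x)" for x
    proof -
      have "cos (x * 2) = 2 * (cos x * cos x) - 1" using cos_double_cos[of x] by (simp add: power2_eq_square mult.commute)
      then show ?thesis by (auto intro!: derivative_eq_intros simp: field_simps)
    qed
  qed (auto simp: sin_double intro!: continuous_intros)
next
  case (step j)
  then obtain Q P where QP: "\<forall>x. sin (2 * real j * x) = sin x * Q x" "continuous_on UNIV Q"
     "\<forall>x. (P has_real_derivative cos x * Q x) (at x)" "P pi - P 0 = pi" by blast
  have j: "real j > 0" using step by simp
  show ?case
  proof (rule exI[of _ "\<lambda>x. Q x + 2 * cos ((2 * real j + 1) * x)"],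
      rule exI[of _ "\<lambda>x. P x + sin (2 * real j * x) / (2 * real j) + sin (2 * (real j + 1) * x) / (2 * (real j + 1))"], intro conjI allI)
    fix x
    have "sin (2 * real j * x + 2 * x) - sin (2 * real j * x) = 2 * sin x * cos (2 * real j * x + x)"
    proof -
      have *: "(2 * real j * x + 2 * x + 2 * real j * x) / 2 = 2 * real j * x + x"
        "(2 * real j * x + 2 * x - 2 * real j * x) / 2 = x" by simp_all
      show ?thesis unfolding sin_diff_sin * ..
    qed
    then show "sin (2 * real (Suc j) * x) = sin x * (Q x + 2 * cos ((2 * real j + 1) * x))"
      using QP(1) by (simp add: algebra_simps)
    have "cos (2 * real j * x) + cos (2 * (real j + 1) * x) = 2 * cos x * cos ((2 * real j + 1) * x)"
    proof -
      have "(2 * real j * x + 2 * (real j + 1) * x) / 2 = (2 * real j + 1) * x"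
           "(2 * real j * x - 2 * (real j + 1) * x) / 2 = - x" by (simp_all add: algebra_simps)
      then show ?thesis by (subst cos_plus_cos) simp
    qed
    then show "((\<lambda>x. P x + sin (2 * real j * x) / (2 * real j) + sin (2 * (real j + 1) * x) / (2 * (real j + 1)))
       has_real_derivative cos x * (Q x + 2 * cos ((2 * real j + 1) * x))) (at x)"
    proof -
      assume *: "cos (2 * real j * x) + cos (2 * (real j + 1) * x) = 2 * cos x * cos ((2 * real j + 1) * x)"
      have d: "((\<lambda>x. sin (b * x) / b) has_real_derivative cos (b * x)) (at x)" if "b \<noteq> 0" for b
        using that by (auto intro!: derivative_eq_intros)
      have "cos x * Q x + cos (2 * real j * x) + cos (2 * (real j + 1) * x) = cos x * (Q x + 2 * cos ((2 * real j + 1) * x))"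
        using * by (simp add: distrib_left)
      moreover have "((\<lambda>x. P x + sin (2 * real j * x) / (2 * real j) + sin (2 * (real j + 1) * x) / (2 * (real j + 1)))
         has_real_derivative cos x * Q x + cos (2 * real j * x) + cos (2 * (real j + 1) * x)) (at x)"
        using j QP(3) by (intro DERIV_add d) auto
      ultimately show ?thesis by (simp only:)
    qed
  next
    show "continuous_on UNIV (\<lambda>x. Q x + 2 * cos ((2 * real j + 1) * x))"
      using QP(2) by (auto intro!: continuous_intros)
    have "sin (2 * real n * pi) = 0" for n using sin_npi[of "2*n"] by (simp add: mult.assoc)
    from this[of j] this[of "Suc j"] QP(4)
    show "P pi + sin (2 * real j * pi) / (2 * real j) + sin (2 * (real j + 1) * pi) / (2 * (real j + 1)) -
      (P 0 + sin (2 * real j * 0) / (2 * real j) + sin (2 * (real j + 1) * 0) / (2 * (real j + 1))) = pi"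
      by (simp add: add.commute)
  qed
qed

lemma continuous_on_x_ln_x: "continuous_on {0..} (\<lambda>x::real. x * ln x)"
  unfolding continuous_on_eq_continuous_within
proof
  fix x :: real assume x: "x \<in> {0..}"
  show "continuous (at x within {0..}) (\<lambda>x. x * ln x)"
  proof (cases "x = 0")
    case True
    have "((\<lambda>x::real. x * ln x) \<longlongrightarrow> 0) (at_right 0)" by real_asymp
    then show ?thesis using True by (simp add: continuous_within at_within_Ici_at_right)
  next
    case False
    then have "isCont (\<lambda>x. x * ln x) x" using x by (auto intro!: continuous_intros)
    then show ?thesis by (rule continuous_at_imp_continuous_at_within)
  qed
qed

text \<open>
  Integration by parts. Writing the boundary term as \<open>(sin x * ln (sin x)) * Q x\<close> shows that the
  primitive extends continuously to the two singularities of the kernel at \<open>0\<close> and \<open>pi\<close>.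
\<close>

lemma has_integral_log_kernel_cos:
  assumes j: "1 \<le> (j::nat)"
  shows "((\<lambda>x. log_kernel x * cos (2 * real j * x)) has_integral pi / (2 * real j)) {0..pi}"
proof -
  obtain Q P where QP: "\<And>x. sin (2 * real j * x) = sin x * Q x" "continuous_on UNIV Q"
     "\<And>x. (P has_real_derivative cos x * Q x) (at x)" "P pi - P 0 = pi"
    using dirichlet_sin[OF j] by blast
  define F where "F x = P x / (2 * real j) - (sin x * ln (sin x)) * Q x / (2 * real j)" for x
  have contP: "continuous_on S P" for S
    using QP(3) by (meson DERIV_isCont continuous_at_imp_continuous_on)
  have "((\<lambda>x. log_kernel x * cos (2 * real j * x)) has_integral (F pi - F 0)) {0..pi}"
  proof (rule fundamental_theorem_of_calculus_interior)
    have "continuous_on {0..pi} ((\<lambda>x. x * ln x) \<circ> sin)"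
      by (rule continuous_on_compose[OF _ continuous_on_subset[OF continuous_on_x_ln_x]])
         (auto intro!: continuous_intros sin_ge_zero)
    then show "continuous_on {0..pi} F"
      unfolding F_def o_def using j by (auto intro!: continuous_intros contP continuous_on_subset[OF QP(2)])
    fix x :: real assume x: "x \<in> {0<..<pi}"
    then have s: "sin x > 0" by (simp add: sin_gt_zero)
    have "((\<lambda>x. P x / (2 * real j) - ln (sin x) * sin (2 * real j * x) / (2 * real j)) has_real_derivative
       (cos x * Q x) / (2 * real j) - ((1 / sin x) * cos x * sin (2 * real j * x) + ln (sin x) * (cos (2 * real j * x) * (2 * real j))) / (2 * real j)) (at x)"
      using s j by (auto intro!: derivative_eq_intros QP(3) simp: field_simps)
    also have "(cos x * Q x) / (2 * real j) - ((1 / sin x) * cos x * sin (2 * real j * x) + ln (sin x) * (cos (2 * real j * x) * (2 * real j))) / (2 * real j)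
       = log_kernel x * cos (2 * real j * x)"
      unfolding QP(1) log_kernel_def using s j by (simp add: field_simps)
    also have "(\<lambda>x. P x / (2 * real j) - ln (sin x) * sin (2 * real j * x) / (2 * real j)) = F"
      unfolding F_def QP(1) by (simp add: fun_eq_iff mult_ac)
    finally show "(F has_vector_derivative log_kernel x * cos (2 * real j * x)) (at x)"
      by (simp add: has_real_derivative_iff_has_vector_derivative)
  qed simp
  moreover have "F pi - F 0 = pi / (2 * real j)"
    using QP(4) by (simp add: F_def diff_divide_distrib[symmetric])
  ultimately show ?thesis by simp
qed

text \<open>
  The kernel itself has no elementary primitive, but \<open>1 = cos (2 * x) + 2 * (sin x)\<^sup>2\<close> splits it into a part
  with a known integral and a part that is continuous.
\<close>

lemma integrable_log_kernel: "integrable angles log_kernel"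
proof -
  have "continuous_on {0..pi} ((\<lambda>x. x * ln x) \<circ> sin)"
    by (rule continuous_on_compose[OF _ continuous_on_subset[OF continuous_on_x_ln_x]])
       (auto intro!: continuous_intros sin_ge_zero)
  then have "continuous_on {0..pi} (\<lambda>x. -2 * sin x * (sin x * ln (sin x)))"
    unfolding o_def by (intro continuous_on_mult[OF _ \<open>continuous_on _ _\<close>[unfolded o_def]] continuous_intros)
  then have "(\<lambda>x. -2 * sin x * (sin x * ln (sin x))) integrable_on {0..pi}"
    by (rule integrable_continuous_real)
  moreover have "(\<lambda>x. log_kernel x * cos (2 * real 1 * x)) integrable_on {0..pi}"
    using has_integral_log_kernel_cos[of 1] by blast
  ultimately have "(\<lambda>x. -2 * sin x * (sin x * ln (sin x)) + log_kernel x * cos (2 * real 1 * x)) integrable_on {0..pi}"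
    by (rule integrable_add)
  moreover have "-2 * sin x * (sin x * ln (sin x)) + log_kernel x * cos (2 * real 1 * x) = log_kernel x" if "x \<in> {0..pi}" for x
  proof -
    have "log_kernel x = - ln (sin x)" using that by (simp add: log_kernel_def sin_ge_zero)
    moreover have "cos (2 * real 1 * x) = 1 - 2 * (sin x * sin x)"
      using cos_double_sin[of x] by (simp add: power2_eq_square)
    ultimately show ?thesis by (simp only:) (simp add: algebra_simps)
  qed
  ultimately have "log_kernel integrable_on {0..pi}"
    by (rule integrable_eq)
  then obtain I where "(log_kernel has_integral I) {0..pi}" by blast
  then have "(\<integral>\<^sup>+x. ennreal (log_kernel x) \<partial>angles) = ennreal I"
    by (intro has_integral_angles_nn) (auto simp: log_kernel_nonneg)
  then show ?thesis by (intro integrableI_nonneg) (auto simp: log_kernel_nonneg)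
qed

lemma integrable_log_kernel_mult:
  assumes [measurable]: "q \<in> borel_measurable borel" and "\<And>x. \<bar>q x\<bar> \<le> K"
  shows "integrable angles (\<lambda>x. log_kernel x * q x)"
proof (rule Bochner_Integration.integrable_bound)
  show "integrable angles (\<lambda>x. log_kernel x * K)" using integrable_log_kernel by simp
  show "AE x in angles. norm (log_kernel x * q x) \<le> norm (log_kernel x * K)"
    using assms(2) by (auto simp: abs_mult log_kernel_nonneg intro!: mult_left_mono order_trans[OF assms(2)])
qed simp

lemma integral_log_kernel_cos:
  assumes "1 \<le> (j::nat)" shows "(\<integral>x. log_kernel x * cos (2 * real j * x) \<partial>angles) = pi / (2 * real j)"
proof -
  have "integrable angles (\<lambda>x. log_kernel x * cos (2 * real j * x))"
    by (rule integrable_log_kernel_mult[where K=1]) auto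
  from integral_angles[OF _ this] show ?thesis
    by (rule has_integral_unique[OF _ has_integral_log_kernel_cos[OF assms]]) simp
qed

lemma integral_log_kernel_sin: "(\<integral>x. log_kernel x * sin (2 * real j * x) \<partial>angles) = 0"
proof -
  have "sin (2 * real j * (x + pi)) = sin (2 * real j * x)" for x
    using sin.plus_of_nat[of "2 * real j * x" j] by (simp add: algebra_simps)
  then have "(\<integral>x. log_kernel (0 - x) * sin (2 * real j * (0 - x)) \<partial>angles) = (\<integral>x. log_kernel x * sin (2 * real j * x) \<partial>angles)"
    by (intro integral_angles_periodic_reflect(2)[of "\<lambda>x. log_kernel x * sin (2 * real j * x)"]) (auto simp: log_kernel_periodic)
  then show ?thesis by (simp add: log_kernel_even)
qed

section \<open>Trigonometric approximation\<close>

text \<open>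
  The same algebra serves two approximation arguments: restricted to the unit circle its members are
  the trigonometric polynomials, and on the plane their integrals are the moments of a measure. It
  is described by an explicit spanning set, so that linear statements need only be checked on
  \<open>Re (c * z ^ n * cnj z ^ m)\<close>.
\<close>

inductive zpoly :: "(complex \<Rightarrow> real) \<Rightarrow> bool" where
  base: "zpoly (\<lambda>z. Re (c * z ^ n * cnj z ^ m))"
| add: "zpoly f \<Longrightarrow> zpoly g \<Longrightarrow> zpoly (\<lambda>z. f z + g z)"

text \<open>
  The spanning set is closed under products up to sums because
  \<open>Re X * Re Y = Re (X * Y) / 2 + Re (X * cnj Y) / 2\<close>.
\<close>

lemma zpoly_mult_base: "zpoly f \<Longrightarrow> zpoly (\<lambda>z. Re (c * z ^ n * cnj z ^ m) * f z)"
proof (induction rule: zpoly.induct)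
  case (base d p q)
  have "Re (c * z ^ n * cnj z ^ m) * Re (d * z ^ p * cnj z ^ q) =
      Re ((c * d / 2) * z ^ (n + p) * cnj z ^ (m + q)) + Re ((c * cnj d / 2) * z ^ (n + q) * cnj z ^ (m + p))" for z
  proof -
    have *: "Re X * Re Y = Re (X * Y / 2) + Re (X * cnj Y / 2)" for X Y by (simp add: field_simps)
    show ?thesis by (subst *) (simp add: power_add mult_ac)
  qed
  then show ?case by (simp only:) (intro zpoly.intros)
next
  case (add f g)
  then show ?case by (simp only: distrib_left) (rule zpoly.add)
qed

lemma zpoly_mult: "zpoly f \<Longrightarrow> zpoly g \<Longrightarrow> zpoly (\<lambda>z. f z * g z)"
proof (induction rule: zpoly.induct)
  case (base c n m) then show ?case by (rule zpoly_mult_base)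
next
  case (add f1 f2) then show ?case by (simp only: distrib_right) (rule zpoly.add, blast+)
qed

lemma real_polynomial_function_zpoly:
  assumes "real_polynomial_function (f :: complex \<Rightarrow> real)" shows "zpoly f"
  using assms
proof (induction rule: real_polynomial_function.induct)
  case (linear f)
  then interpret bounded_linear f .
  have "f z = Re (Complex (f 1) (- f \<i>) * z ^ 1 * cnj z ^ 0)" for z
  proof -
    have "f (Re z *\<^sub>R 1 + Im z *\<^sub>R \<i>) = Re z * f 1 + Im z * f \<i>" by (simp only: add scaleR) simp
    moreover have "Re z *\<^sub>R 1 + Im z *\<^sub>R \<i> = z" by (simp add: complex_eq_iff)
    ultimately show ?thesis by simp
  qed
  then have "f = (\<lambda>z. Re (Complex (f 1) (- f \<i>) * z ^ 1 * cnj z ^ 0))" by blast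
  then show ?case by (metis zpoly.base)
next
  case (const c)
  have "zpoly (\<lambda>z. Re (of_real c * z ^ 0 * cnj z ^ 0))" by (rule zpoly.base)
  then show ?case by simp
next
  case (add f g) then show ?case by (intro zpoly.add)
next
  case (mult f g) then show ?case by (intro zpoly_mult)
qed

lemma continuous_zpoly: "zpoly f \<Longrightarrow> continuous_on S f"
  by (induction rule: zpoly.induct) (auto intro!: continuous_intros)

definition pi_periodic :: "(real \<Rightarrow> real) \<Rightarrow> bool" where
  "pi_periodic q \<longleftrightarrow> continuous_on UNIV q \<and> (\<forall>x. q (x + pi) = q x)"

lemma periodic_cis:
  fixes q :: "real \<Rightarrow> 'a" assumes per: "\<And>x. q (x + pi) = q x" and eq: "cis (2 * s) = cis (2 * t)"
  shows "q s = q t"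
proof -
  have "cos (2 * s) = cos (2 * t)" "sin (2 * s) = sin (2 * t)"
    using eq by (auto simp: complex_eq_iff)
  then have "sin (2 * s) = sin (2 * t) \<and> cos (2 * s) = cos (2 * t)" by simp
  then obtain n :: int where "2 * s = 2 * t + 2 * pi * of_int n"
    by (auto simp: sin_cos_eq_iff)
  then have "s = t + of_int n * pi" by (simp add: algebra_simps)
  then show ?thesis using periodic_int[of q t n] per by simp
qed

text \<open>
  The function is \<open>f z = q (Arg z / 2)\<close>. The jump of the argument across the negative axis is a
  multiple of the period, so near that axis \<open>f\<close> has the continuous expression
  \<open>q ((Arg (- z) + pi) / 2)\<close>.
\<close>

lemma pi_periodic_factor:
  assumes "pi_periodic q"
  obtains f :: "complex \<Rightarrow> real" where "continuous_on (sphere 0 1) f" "\<And>t. f (cis (2 * t)) = q t"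
proof
  define f where "f z = q (Arg z / 2)" for z
  have per: "\<And>x. q (x + pi) = q x" and cont: "continuous_on UNIV q" using assms by (auto simp: pi_periodic_def)
  have fcis: "f z = q t" if "z = r *\<^sub>R cis (2 * t)" "r > 0" for z r t
    unfolding f_def
  proof (rule periodic_cis[where q=q])
    show "q (x + pi) = q x" for x by (rule per)
    have "z \<noteq> 0" using that by simp
    then have "cis (2 * (Arg z / 2)) = sgn z" by (simp add: cis_Arg)
    also have "\<dots> = cis (2 * t)" using that by (simp add: sgn_scaleR sgn_div_norm)
    finally show "cis (2 * (Arg z / 2)) = cis (2 * t)" .
  qed
  show "f (cis (2 * t)) = q t" for t by (rule fcis[of _ 1]) auto
  have isc: "isCont q x" for x using cont by (simp add: continuous_on_eq_continuous_at)
  have "isCont f z" if "z \<noteq> 0" for z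
  proof (cases "z \<in> \<real>\<^sub>\<le>\<^sub>0")
    case False
    have "isCont (\<lambda>z. q (Arg z / 2)) z"
      by (rule isCont_o2[where g=q]) (use False in \<open>auto intro!: continuous_intros isc continuous_at_Arg\<close>)
    then show ?thesis by (simp add: f_def[abs_def])
  next
    case True
    then have "Re z < 0" using that by (auto simp: complex_nonpos_Reals_iff complex_eq_iff)
    then have n: "- z \<notin> \<real>\<^sub>\<le>\<^sub>0" by (auto simp: complex_nonpos_Reals_iff)
    have "isCont (\<lambda>z. Arg (- z)) z"
      by (rule isCont_o2[where g=Arg]) (use n in \<open>auto intro!: continuous_intros continuous_at_Arg\<close>)
    then have "isCont (\<lambda>z. (Arg (- z) + pi) / 2) z" by (intro continuous_intros) auto
    then have "isCont (\<lambda>z. q ((Arg (- z) + pi) / 2)) z"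
      by (rule isCont_o2[where g=q]) (rule isc)
    moreover have "eventually (\<lambda>z. f z = q ((Arg (- z) + pi) / 2)) (nhds z)"
    proof -
      have "eventually (\<lambda>z. z \<noteq> 0) (nhds z)" using that by (rule t1_space_nhds)
      then show ?thesis
      proof eventually_elim
        case (elim w)
        have "w = norm w *\<^sub>R cis (2 * ((Arg (- w) + pi) / 2))"
        proof -
          have "cis (Arg (- w) + pi) = cis (Arg (- w)) * cis pi" by (rule cis_mult[symmetric])
          also have "\<dots> = - sgn (- w)" using elim by (simp add: cis_Arg)
          also have "\<dots> = sgn w" by (simp add: sgn_minus)
          finally have "norm w *\<^sub>R cis (Arg (- w) + pi) = w" using elim by (simp add: sgn_div_norm)
          moreover have "2 * ((Arg (- w) + pi) / 2) = Arg (- w) + pi" by simp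
          ultimately show ?thesis by (simp only:)
        qed
        then show ?case using fcis[of w "norm w" "(Arg (- w) + pi) / 2"] elim by simp
      qed
    qed
    ultimately show ?thesis by (simp add: isCont_cong)
  qed
  then show "continuous_on (sphere 0 1) f"
    by (intro continuous_at_imp_continuous_on ballI) (metis dist_0_norm mem_sphere norm_zero zero_neq_one)
qed

text \<open>
  Stone-Weierstrass in the form in which identities between convolution operators are proved: it is
  enough to compare them on single frequencies.
\<close>

lemma pi_periodic_functional_zero:
  fixes \<Phi> :: "(real \<Rightarrow> real) \<Rightarrow> real"
  assumes add: "\<And>p q. pi_periodic p \<Longrightarrow> pi_periodic q \<Longrightarrow> \<Phi> (\<lambda>t. p t + q t) = \<Phi> p + \<Phi> q"
    and bound: "\<And>q K. pi_periodic q \<Longrightarrow> (\<And>t. \<bar>q t\<bar> \<le> K) \<Longrightarrow> \<bar>\<Phi> q\<bar> \<le> M * K"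
    and zero: "\<And>c (j::nat). \<Phi> (\<lambda>t. Re (c * cis (2 * real j * t))) = 0"
    and q: "pi_periodic q"
  shows "\<Phi> q = 0"
proof -
  have cps: "pi_periodic (\<lambda>t. f (cis (2 * t)))" if "zpoly f" for f
  proof -
    have "continuous_on UNIV (\<lambda>t. f (cis (2 * t)))"
      by (rule continuous_on_compose2[OF continuous_zpoly[OF that, of UNIV]]) (auto intro!: continuous_intros)
    moreover have "cis (2 * (t + pi)) = cis (2 * t)" for t
      by (simp add: complex_eq_iff distrib_left)
    ultimately show ?thesis by (simp add: pi_periodic_def)
  qed
  have z: "\<Phi> (\<lambda>t. f (cis (2 * t))) = 0" if "zpoly f" for f
    using that
  proof (induction rule: zpoly.induct)
    case (base c n m)
    show ?case
    proof (cases "m \<le> n")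
      case True
      have "Re (c * cis (2 * t) ^ n * cnj (cis (2 * t)) ^ m) = Re (c * cis (2 * real (n - m) * t))" for t
        using True by (simp add: Complex.DeMoivre cis_cnj cis_mult mult.assoc of_nat_diff algebra_simps)
      then show ?thesis using zero[of c "n - m"] by simp
    next
      case False
      have "Re (c * cis (2 * t) ^ n * cnj (cis (2 * t)) ^ m) = Re (cnj c * cis (2 * real (m - n) * t))" for t
      proof -
        have "c * cis (2 * t) ^ n * cnj (cis (2 * t)) ^ m = cnj (cnj c * cis (2 * real (m - n) * t))"
          using False by (simp add: Complex.DeMoivre cis_cnj cis_mult mult.assoc of_nat_diff algebra_simps)
        then show ?thesis by (metis cnj.sel(1)) 
      qed
      then show ?thesis using zero[of "cnj c" "m - n"] by simp
    qed
  next
    case (add f g) then show ?case using assms(1)[OF cps cps] by simp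
  qed
  obtain f where f: "continuous_on (sphere 0 1) f" "\<And>t. f (cis (2 * t)) = q t"
    using pi_periodic_factor[OF q] by blast
  have M: "0 \<le> M"
    using bound[of "\<lambda>_. 1" 1] by (simp add: pi_periodic_def)
  have "\<bar>\<Phi> q\<bar> \<le> M * e" if "e > 0" for e
  proof -
    obtain p where p: "real_polynomial_function p" "\<And>x. x \<in> sphere 0 1 \<Longrightarrow> \<bar>f x - p x\<bar> < e"
      using Stone_Weierstrass_real_polynomial_function[OF compact_sphere f(1) \<open>e > 0\<close>] by metis
    have zp: "zpoly p" using p(1) by (rule real_polynomial_function_zpoly)
    define r where "r t = q t - p (cis (2 * t))" for t
    have r: "pi_periodic r" using q cps[OF zp] unfolding r_def pi_periodic_def by (auto intro!: continuous_intros)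
    have "q = (\<lambda>t. r t + p (cis (2 * t)))" by (simp add: r_def)
    then have "\<Phi> q = \<Phi> r" using add[OF r cps[OF zp]] z[OF zp] by simp
    moreover have "\<bar>r t\<bar> \<le> e" for t using p(2)[of "cis (2 * t)"] f(2)[of t] by (simp add: r_def less_imp_le)
    ultimately show ?thesis using bound[OF r, of e] by simp
  qed
  note small = this
  show ?thesis
  proof (rule ccontr)
    assume "\<Phi> q \<noteq> 0"
    \<comment> \<open>The bound holds for every error; this error is small enough for a contradiction.\<close>
    then have p: "\<bar>\<Phi> q\<bar> / (M + 1) > 0" using M by simp
    from small[OF this] have "\<bar>\<Phi> q\<bar> * (M + 1) \<le> M * \<bar>\<Phi> q\<bar>" using M by (simp add: field_simps)
    then show False using \<open>\<Phi> q \<noteq> 0\<close> by (simp add: algebra_simps)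
  qed
qed

section \<open>Deconvolution on the circle\<close>

lemma pi_periodicD: assumes "pi_periodic q" shows "q \<in> borel_measurable borel" "q (x + pi) = q x" "continuous_on S q"
  using assms by (auto simp: pi_periodic_def intro: borel_measurable_continuous_onI continuous_on_subset)

lemma pi_periodic_reflect: "pi_periodic q \<Longrightarrow> pi_periodic (\<lambda>t. q (s - t))"
  unfolding pi_periodic_def
proof (intro conjI allI)
  assume q: "continuous_on UNIV q \<and> (\<forall>x. q (x + pi) = q x)"
  show "continuous_on UNIV (\<lambda>t. q (s - t))"
    by (rule continuous_on_compose2[OF conjunct1[OF q]]) (auto intro!: continuous_intros)
  show "q (s - (x + pi)) = q (s - x)" for x using q[THEN conjunct2, rule_format, of "s - (x + pi)"] by simp
qed

lemma pi_periodic_bounded: assumes "pi_periodic q" shows "\<exists>K. \<forall>x. \<bar>q x\<bar> \<le> K"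
proof -
  obtain f where f: "continuous_on (sphere 0 1) (f :: complex \<Rightarrow> real)" "\<And>t. f (cis (2 * t)) = q t"
    using pi_periodic_factor[OF assms] by blast
  have "bounded (f ` sphere 0 1)" by (intro compact_imp_bounded compact_continuous_image f compact_sphere)
  then obtain K where K: "\<forall>y\<in>f ` sphere 0 1. norm y \<le> K" unfolding bounded_iff by blast
  have "\<bar>q x\<bar> \<le> K" for x 
  proof -
    have "f (cis (2 * x)) \<in> f ` sphere 0 1" by (rule imageI) simp
    then show ?thesis using K f(2) by auto
  qed
  then show ?thesis by blast
qed

lemma integrable_mult_bounded:
  fixes w q :: "real \<Rightarrow> real"
  assumes "integrable angles w" and [measurable]: "q \<in> borel_measurable borel" and "\<And>x. \<bar>q x\<bar> \<le> K"
  shows "integrable angles (\<lambda>x. w x * q x)"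
proof (rule Bochner_Integration.integrable_bound)
  show "integrable angles (\<lambda>x. w x * K)" using assms by simp
  have [measurable]: "w \<in> borel_measurable angles" using assms(1) by simp
  show "(\<lambda>x. w x * q x) \<in> borel_measurable angles" by measurable
  have "\<bar>q x\<bar> \<le> \<bar>K\<bar>" for x using assms(3)[of x] by linarith
  then show "AE x in angles. norm (w x * q x) \<le> norm (w x * K)"
    by (auto simp: abs_mult intro!: mult_left_mono)
qed

lemma integral_mult_bounded:
  fixes w q :: "real \<Rightarrow> real"
  assumes "integrable angles w" and "q \<in> borel_measurable borel" and q: "\<And>x. \<bar>q x\<bar> \<le> K"
  shows "\<bar>\<integral>x. w x * q x \<partial>angles\<bar> \<le> (\<integral>x. \<bar>w x\<bar> \<partial>angles) * K"
proof -
  have "\<bar>\<integral>x. w x * q x \<partial>angles\<bar> \<le> (\<integral>x. \<bar>w x\<bar> * K \<partial>angles)"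
    by (rule integral_abs_bound_integral)
       (use assms in \<open>auto simp: abs_mult intro!: mult_left_mono integrable_mult_bounded\<close>)
  then show ?thesis by simp
qed

definition conv :: "(real \<Rightarrow> real) \<Rightarrow> (real \<Rightarrow> real) \<Rightarrow> real \<Rightarrow> real" where
  "conv w q s = (\<integral>t. w t * q (s - t) \<partial>angles)"

lemma conv_measurable [measurable]:
  assumes [measurable]: "w \<in> borel_measurable borel" "q \<in> borel_measurable borel"
  shows "conv w q \<in> borel_measurable borel"
  unfolding conv_def[abs_def] by measurable

lemma conv_bound:
  assumes "integrable angles w" "q \<in> borel_measurable borel" "\<And>x. \<bar>q x\<bar> \<le> K"
  shows "\<bar>conv w q s\<bar> \<le> (\<integral>x. \<bar>w x\<bar> \<partial>angles) * K"
proof -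
  have [measurable]: "q \<in> borel_measurable borel" by fact
  show ?thesis unfolding conv_def by (rule integral_mult_bounded) (use assms in auto)
qed

lemma conv_add:
  assumes w: "integrable angles w" and p: "p \<in> borel_measurable borel" "\<And>x. \<bar>p x\<bar> \<le> K"
    and q: "q \<in> borel_measurable borel" "\<And>x. \<bar>q x\<bar> \<le> K'"
  shows "conv w (\<lambda>t. p t + q t) s = conv w p s + conv w q s"
proof -
  have [measurable]: "p \<in> borel_measurable borel" "q \<in> borel_measurable borel" by fact+
  show ?thesis unfolding conv_def distrib_left
    by (rule Bochner_Integration.integral_add) (rule integrable_mult_bounded[OF w]; use p q in auto)+
qed

text \<open>
  Convolution with a kernel whose sine coefficients vanish multiplies each frequency by the cosine
  coefficient.
\<close>

lemma conv_trig:
  assumes w: "integrable angles w"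
    and c: "(\<integral>x. w x * cos (2 * real j * x) \<partial>angles) = l" and s: "(\<integral>x. w x * sin (2 * real j * x) \<partial>angles) = 0"
  shows "conv w (\<lambda>t. Re (c * cis (2 * real j * t))) = (\<lambda>t. Re (of_real l * c * cis (2 * real j * t)))"
proof
  fix t
  define d where "d = c * cis (2 * real j * t)"
  have "Re (c * cis (2 * real j * (t - x))) = Re d * cos (2 * real j * x) + Im d * sin (2 * real j * x)" for x
  proof -
    have "c * cis (2 * real j * (t - x)) = d * cis (- (2 * real j * x))"
      unfolding d_def mult.assoc cis_mult by (simp add: algebra_simps)
    then show ?thesis by simp
  qed
  then have "conv w (\<lambda>t. Re (c * cis (2 * real j * t))) t =
     (\<integral>x. Re d * (w x * cos (2 * real j * x)) + Im d * (w x * sin (2 * real j * x)) \<partial>angles)"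
    unfolding conv_def by (simp add: algebra_simps)
  also have "\<dots> = Re d * (\<integral>x. w x * cos (2 * real j * x) \<partial>angles) + Im d * (\<integral>x. w x * sin (2 * real j * x) \<partial>angles)"
  proof -
    have "integrable angles (\<lambda>x. w x * cos (2 * real j * x))" "integrable angles (\<lambda>x. w x * sin (2 * real j * x))"
      by (rule integrable_mult_bounded[OF w, where K=1]; simp)+
    then show ?thesis by simp
  qed
  also have "\<dots> = Re (of_real l * c * cis (2 * real j * t))"
    using c s by (simp add: d_def algebra_simps)
  finally show "conv w (\<lambda>t. Re (c * cis (2 * real j * t))) t = \<dots>" .
qed

text \<open>
  The second Bernoulli polynomial rescaled to the period \<open>pi\<close>, up to a factor and an additive constant. At
  nonzero frequencies its Fourier coefficients are the squares of those of \<open>log_kernel\<close>, and its second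
  derivative is the constant \<open>pi\<close>.
\<close>

definition parabola :: "real \<Rightarrow> real" where "parabola t = pi / 2 * (t\<^sup>2 - pi * t)"

lemma integrable_parabola: "integrable angles parabola"
  unfolding parabola_def[abs_def] by (rule integrable_angles_continuous) (intro continuous_intros)

lemma angles_FTC:
  fixes f F :: "real \<Rightarrow> real"
  assumes "continuous_on UNIV f" and F: "\<And>x. (F has_real_derivative f x) (at x)"
  shows "(\<integral>x. f x \<partial>angles) = F pi - F 0"
proof -
  have "(f has_integral (F pi - F 0)) {0..pi}"
    by (rule fundamental_theorem_of_calculus)
       (auto intro: F[THEN DERIV_subset] simp: has_real_derivative_iff_has_vector_derivative[symmetric] has_field_derivative_at_within F)
  moreover have "(f has_integral (\<integral>x. f x \<partial>angles)) {0..pi}"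
    by (rule integral_angles) (auto intro: integrable_angles_continuous borel_measurable_continuous_onI assms)
  ultimately show ?thesis by (rule has_integral_unique[rotated])
qed

lemma sin_2npi: "sin (2 * real j * pi) = 0" "cos (2 * real j * pi) = 1"
  using sin_npi[of "2*j"] cos_npi[of "2*j"] by (simp_all add: mult.assoc)

lemma integral_parabola_cos:
  assumes "1 \<le> (j::nat)" shows "(\<integral>x. parabola x * cos (2 * real j * x) \<partial>angles) = (pi / (2 * real j))\<^sup>2"
proof -
  define b where "b = 2 * real j"
  have b: "b \<noteq> 0" using assms by (simp add: b_def)
  define u where "u = 1 / b"
  have bu: "b * u = 1" using b by (simp add: u_def)
  define F where "F t = pi / 2 * ((t\<^sup>2 - pi * t) * sin (b * t) * u + (2 * t - pi) * cos (b * t) * u\<^sup>2 - 2 * sin (b * t) * u ^ 3)" for t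
  have "(\<integral>x. parabola x * cos (b * x) \<partial>angles) = F pi - F 0"
  proof (rule angles_FTC)
    fix x
    have "(F has_real_derivative pi / 2 * (((2 * x - pi) * sin (b * x) + (x\<^sup>2 - pi * x) * (cos (b * x) * b)) * u
      + (2 * cos (b * x) + (2 * x - pi) * (- sin (b * x) * b)) * u\<^sup>2 - 2 * (cos (b * x) * b) * u ^ 3)) (at x)"
      unfolding F_def by (auto intro!: derivative_eq_intros simp: field_simps)
    moreover have "(Y * S + X * (C * b)) * u + (2 * C + Y * (- S * b)) * u\<^sup>2 - 2 * (C * b) * u ^ 3 = X * C" for X Y S C
      using bu by algebra
    ultimately show "(F has_real_derivative parabola x * cos (b * x)) (at x)" by (simp add: parabola_def mult.assoc)
  qed (auto simp: parabola_def intro!: continuous_intros)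
  also have "\<dots> = (pi / b)\<^sup>2"
    
  proof -
    have "sin (b * pi) = 0" "cos (b * pi) = 1" unfolding b_def by (rule sin_2npi)+
    then show ?thesis using b by (simp add: F_def u_def field_simps power2_eq_square)
  qed
  finally show ?thesis by (simp add: b_def)
qed

lemma integral_parabola_sin: "(\<integral>x. parabola x * sin (2 * real j * x) \<partial>angles) = 0"
proof (cases "j = 0")
  case False
  define b where "b = 2 * real j"
  have b: "b \<noteq> 0" using False by (simp add: b_def)
  define u where "u = 1 / b"
  have bu: "b * u = 1" using b by (simp add: u_def)
  define F where "F t = pi / 2 * (- ((t\<^sup>2 - pi * t) * cos (b * t) * u) + (2 * t - pi) * sin (b * t) * u\<^sup>2 + 2 * cos (b * t) * u ^ 3)" for t
  have "(\<integral>x. parabola x * sin (b * x) \<partial>angles) = F pi - F 0"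
  proof (rule angles_FTC)
    fix x
    have "(F has_real_derivative pi / 2 * (- (((2 * x - pi) * cos (b * x) + (x\<^sup>2 - pi * x) * (- sin (b * x) * b)) * u)
      + (2 * sin (b * x) + (2 * x - pi) * (cos (b * x) * b)) * u\<^sup>2 + 2 * (- sin (b * x) * b) * u ^ 3)) (at x)"
      unfolding F_def by (auto intro!: derivative_eq_intros simp: field_simps)
    moreover have "- ((Y * C + X * (- S * b)) * u) + (2 * S + Y * (C * b)) * u\<^sup>2 + 2 * (- S * b) * u ^ 3 = X * S" for X Y S C
      using bu by algebra
    ultimately show "(F has_real_derivative parabola x * sin (b * x)) (at x)" by (simp add: parabola_def mult.assoc)
  qed (auto simp: parabola_def intro!: continuous_intros)
  also have "\<dots> = 0"
    by (simp add: F_def b_def sin_2npi power2_eq_square)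
  finally show ?thesis by (simp add: b_def)
qed simp

lemma integral_trig:
  assumes "1 \<le> (j::nat)" shows "(\<integral>x. Re (c * cis (2 * real j * x)) \<partial>angles) = 0"
proof -
  have b: "2 * real j \<noteq> 0" using assms by simp
  define F where "F t = Re c * sin (2 * real j * t) / (2 * real j) + Im c * cos (2 * real j * t) / (2 * real j)" for t
  have "(\<integral>x. Re (c * cis (2 * real j * x)) \<partial>angles) = F pi - F 0"
  proof (rule angles_FTC)
    fix x
    show "(F has_real_derivative Re (c * cis (2 * real j * x))) (at x)"
      unfolding F_def using b by (auto intro!: derivative_eq_intros)
  qed (auto intro!: continuous_intros)
  then show ?thesis using sin_2npi by (simp add: F_def)
qed

text \<open>
  On the frequency \<open>2 * j\<close> both sides multiply by \<open>(pi / (2 * j))\<^sup>2\<close>; the constant \<open>c\<close> corrects the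
  frequency \<open>0\<close>.
\<close>

lemma conv_log_kernel_twice:
  obtains c where "\<And>q s. pi_periodic q \<Longrightarrow> conv log_kernel (conv log_kernel q) s = conv parabola q s + c * (\<integral>t. q t \<partial>angles)"
proof
  define c where "c = ((\<integral>x. log_kernel x \<partial>angles)\<^sup>2 - (\<integral>x. parabola x \<partial>angles)) / pi"
  fix q s assume q: "pi_periodic q"
  define \<Phi> where "\<Phi> q = conv log_kernel (conv log_kernel q) s - conv parabola q s - c * (\<integral>t. q t \<partial>angles)" for q
  let ?l = "\<integral>x. \<bar>log_kernel x\<bar> \<partial>angles" and ?b = "\<integral>x. \<bar>parabola x\<bar> \<partial>angles"
  have [measurable]: "parabola \<in> borel_measurable borel" unfolding parabola_def[abs_def] by measurable
  have intq: "integrable angles q" if "pi_periodic q" for q by (rule integrable_angles_continuous[OF pi_periodicD(3)[OF that]])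
  have "\<Phi> q = 0"
  proof (rule pi_periodic_functional_zero[where \<Phi>=\<Phi> and q=q and M="?l * ?l + ?b + \<bar>c\<bar> * pi"])
    fix p q assume p: "pi_periodic p" and q: "pi_periodic q"
    note [measurable] = pi_periodicD(1)[OF p] pi_periodicD(1)[OF q]
    obtain K where K: "\<And>x. \<bar>p x\<bar> \<le> K" using pi_periodic_bounded[OF p] by auto
    obtain K' where K': "\<And>x. \<bar>q x\<bar> \<le> K'" using pi_periodic_bounded[OF q] by auto
    have 1: "conv log_kernel (\<lambda>t. p t + q t) = (\<lambda>t. conv log_kernel p t + conv log_kernel q t)"
      using K K' by (intro ext conv_add integrable_log_kernel) auto
    have 2: "conv parabola (\<lambda>t. p t + q t) s = conv parabola p s + conv parabola q s"
      using K K' by (intro conv_add integrable_parabola) auto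
    have 3: "conv log_kernel (\<lambda>t. conv log_kernel p t + conv log_kernel q t) s = conv log_kernel (conv log_kernel p) s + conv log_kernel (conv log_kernel q) s"
      by (rule conv_add[OF integrable_log_kernel]; (rule conv_bound[OF integrable_log_kernel])?) (use K K' in auto)
    show "\<Phi> (\<lambda>t. p t + q t) = \<Phi> p + \<Phi> q"
      unfolding \<Phi>_def 1 2 3 using intq[OF p] intq[OF q] by (simp add: algebra_simps)
  next
    fix q K assume q: "pi_periodic q" and K: "\<And>t. \<bar>q t\<bar> \<le> K"
    note [measurable] = pi_periodicD(1)[OF q]
    have 1: "\<bar>conv log_kernel (conv log_kernel q) s\<bar> \<le> ?l * (?l * K)"
      by (rule conv_bound[OF integrable_log_kernel]; (rule conv_bound[OF integrable_log_kernel])?) (use K in auto)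
    have 2: "\<bar>conv parabola q s\<bar> \<le> ?b * K"
      by (rule conv_bound[OF integrable_parabola]) (use K in auto)
    have "\<bar>\<integral>t. q t \<partial>angles\<bar> \<le> (\<integral>t. K \<partial>angles)"
      by (rule integral_abs_bound_integral) (use intq[OF q] K in auto)
    then have "\<bar>\<integral>t. q t \<partial>angles\<bar> \<le> pi * K" by (simp add: measure_angles_UNIV)
    then have 3: "\<bar>c * (\<integral>t. q t \<partial>angles)\<bar> \<le> \<bar>c\<bar> * pi * K"
      unfolding abs_mult by (metis abs_ge_zero mult.assoc mult_left_mono)
    show "\<bar>\<Phi> q\<bar> \<le> (?l * ?l + ?b + \<bar>c\<bar> * pi) * K"
      unfolding \<Phi>_def using 1 2 3 by (simp add: algebra_simps)
  next
    fix d and j :: nat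
    show "\<Phi> (\<lambda>t. Re (d * cis (2 * real j * t))) = 0"
    proof (cases "j = 0")
      case True
      have 0: "conv w (\<lambda>t. a) t = a * (\<integral>x. w x \<partial>angles)" for a w t by (simp add: conv_def)
      have 00: "conv w (\<lambda>t. a) = (\<lambda>t. a * (\<integral>x. w x \<partial>angles))" for a w by (rule ext) (rule 0)
      show ?thesis using True unfolding \<Phi>_def
        by (simp add: 00 c_def measure_angles_UNIV field_simps power2_eq_square)
    next
      case False
      then have j: "1 \<le> j" by simp
      show ?thesis unfolding \<Phi>_def
        by (simp only: conv_trig[OF integrable_log_kernel integral_log_kernel_cos[OF j] integral_log_kernel_sin]
            conv_trig[OF integrable_parabola integral_parabola_cos[OF j] integral_parabola_sin] integral_trig[OF j])
           (simp add: power2_eq_square mult.assoc)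
    qed
  qed fact
  then show "conv log_kernel (conv log_kernel q) s = conv parabola q s + c * (\<integral>t. q t \<partial>angles)" by (simp add: \<Phi>_def)
qed

lemma conv_reflect:
  assumes [measurable]: "w \<in> borel_measurable borel" "q \<in> borel_measurable borel"
    and "\<And>x. w (x + pi) = w x" "\<And>x. q (x + pi) = q x"
  shows "(\<integral>t. w (s - t) * q t \<partial>angles) = conv w q s"
proof -
  have "q (s - (x + pi)) = q (s - x)" for x using assms(4)[of "s - (x + pi)"] by simp
  then show ?thesis
    unfolding conv_def using integral_angles_periodic_reflect(2)[of "\<lambda>t. w t * q (s - t)" s] assms by simp
qed

lemma periodic_derivative:
  fixes k :: "real \<Rightarrow> real"
  assumes d: "\<And>x. (k has_real_derivative k' x) (at x)" and per: "\<And>x. k (x + pi) = k x"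
  shows "k' (x + pi) = k' x"
proof -
  have "((\<lambda>x. k (x + pi)) has_real_derivative k' (x + pi)) (at x)"
    using d[of "x + pi"] DERIV_shift[of k "k' (x + pi)" x pi] by simp
  then show ?thesis using d[of x] by (simp add: per DERIV_unique)
qed

text \<open>
  The kernel has the Fourier multiplier \<open>pi / (2 * j)\<close>, so that the multiplier of its square times that of
  the second derivative is the constant \<open>- pi\<^sup>2\<close>. In terms of functions, the square of the kernel
  is the parabola, and integrating by parts twice against the parabola recovers \<open>k\<close>
  from \<open>k''\<close> because the first derivative of the parabola jumps by \<open>- pi\<^sup>2\<close> between periods.
\<close>

theorem log_sin_deconvolution:
  fixes k k' k'' :: "real \<Rightarrow> real"
  assumes d1: "\<And>x. (k has_real_derivative k' x) (at x)"
    and d2: "\<And>x. (k' has_real_derivative k'' x) (at x)"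
    and c2: "continuous_on UNIV k''" and per: "\<And>x. k (x + pi) = k x"
  defines "h \<equiv> \<lambda>s. - conv log_kernel k'' s / pi\<^sup>2"
  shows "(\<integral>t. log_kernel (s - t) * h t \<partial>angles) = k s - (\<integral>t. k t \<partial>angles) / pi"
proof -
  have per': "k' (x + pi) = k' x" for x by (rule periodic_derivative[OF d1 per])
  have per'': "k'' (x + pi) = k'' x" for x by (rule periodic_derivative[OF d2 per'])
  have pi_periodic: "pi_periodic k''" using c2 per'' by (simp add: pi_periodic_def)
  note [measurable] = pi_periodicD(1)[OF pi_periodic]
  have contk: "continuous_on UNIV k" using d1 by (meson DERIV_isCont continuous_at_imp_continuous_on)
  have cpk: "pi_periodic k" using contk per by (simp add: pi_periodic_def)
  note [measurable] = pi_periodicD(1)[OF cpk]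
  have [measurable]: "parabola \<in> borel_measurable borel" unfolding parabola_def[abs_def] by measurable
  obtain c where c: "\<And>q s. pi_periodic q \<Longrightarrow> conv log_kernel (conv log_kernel q) s = conv parabola q s + c * (\<integral>t. q t \<partial>angles)"
    using conv_log_kernel_twice by blast
  have "(\<integral>t. k'' t \<partial>angles) = k' pi - k' 0" by (rule angles_FTC[OF c2 d2])
  also have "\<dots> = 0" using per'[of 0] by simp
  finally have z: "(\<integral>t. k'' t \<partial>angles) = 0" .
  have contr: "continuous_on UNIV (\<lambda>t. k'' (s - t))" "continuous_on UNIV (\<lambda>t. k (s - t))"
    using pi_periodicD(3)[OF pi_periodic_reflect[OF pi_periodic]] pi_periodicD(3)[OF pi_periodic_reflect[OF cpk]] by auto
  define F where "F t = - parabola t * k' (s - t) - pi / 2 * (2 * t - pi) * k (s - t)" for t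
  have "(\<integral>t. parabola t * k'' (s - t) - pi * k (s - t) \<partial>angles) = F pi - F 0"
  proof (rule angles_FTC)
    show "continuous_on UNIV (\<lambda>t. parabola t * k'' (s - t) - pi * k (s - t))"
      unfolding parabola_def by (intro continuous_intros contr)
    fix x
    have ds: "((\<lambda>t. s - t) has_real_derivative -1) (at x)" by (auto intro!: derivative_eq_intros)
    have dk: "((\<lambda>t. k (s - t)) has_real_derivative - k' (s - x)) (at x)"
      using DERIV_chain2[where f=k and g="\<lambda>t. s - t" and x=x and Db="-1" and s=UNIV, OF d1 ds] by simp
    have dk': "((\<lambda>t. k' (s - t)) has_real_derivative - k'' (s - x)) (at x)"
      using DERIV_chain2[where f=k' and g="\<lambda>t. s - t" and x=x and Db="-1" and s=UNIV, OF d2 ds] by simp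
    have dB: "((\<lambda>t. - parabola t) has_real_derivative - (pi / 2 * (2 * x - pi))) (at x)"
      unfolding parabola_def by (auto intro!: derivative_eq_intros)
    have dB': "((\<lambda>t. pi / 2 * (2 * t - pi)) has_real_derivative pi) (at x)"
      by (auto intro!: derivative_eq_intros)
    have "(F has_real_derivative (- (pi / 2 * (2 * x - pi)) * k' (s - x) + - k'' (s - x) * - parabola x)
       - (pi * k (s - x) + - k' (s - x) * (pi / 2 * (2 * x - pi)))) (at x)"
      unfolding F_def by (intro DERIV_diff DERIV_mult dk dk' dB dB')
    then show "(F has_real_derivative parabola x * k'' (s - x) - pi * k (s - x)) (at x)"
      by (simp add: algebra_simps)
  qed
  also have "F pi - F 0 = - pi\<^sup>2 * k s"
    using per[of "s - pi"] by (simp add: F_def parabola_def power2_eq_square field_simps)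
  also have "(\<integral>t. parabola t * k'' (s - t) - pi * k (s - t) \<partial>angles) = conv parabola k'' s - pi * (\<integral>t. k (s - t) \<partial>angles)"
  proof -
    have "integrable angles (\<lambda>t. parabola t * k'' (s - t))" "integrable angles (\<lambda>t. k (s - t))"
      by (rule integrable_angles_continuous; auto simp: parabola_def intro!: continuous_intros contr)+
    then show ?thesis by (simp add: conv_def)
  qed
  also have "(\<integral>t. k (s - t) \<partial>angles) = (\<integral>t. k t \<partial>angles)"
    by (rule integral_angles_periodic_reflect(2)) (auto simp: per)
  finally have conv_parabola: "conv parabola k'' s = pi * (\<integral>t. k t \<partial>angles) - pi\<^sup>2 * k s" by simp
  have "conv log_kernel (conv log_kernel k'') s = conv parabola k'' s" using c[OF pi_periodic] z by simp
  moreover have "(\<integral>t. log_kernel (s - t) * h t \<partial>angles) = conv log_kernel h s"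
  proof (rule conv_reflect)
    fix x
    have "k'' (x + pi - t) = k'' (x - t)" for t using per''[of "x - t"] by (simp add: diff_add_eq)
    then show "h (x + pi) = h x" by (simp add: h_def conv_def)
  qed (auto simp: h_def log_kernel_periodic)
  moreover have "conv log_kernel h s = - conv log_kernel (conv log_kernel k'') s / pi\<^sup>2"
    unfolding h_def by (subst (1 2) conv_def) simp
  ultimately have "(\<integral>t. log_kernel (s - t) * h t \<partial>angles) = - (pi * (\<integral>t. k t \<partial>angles) - pi\<^sup>2 * k s) / pi\<^sup>2"
    using conv_parabola by simp
  also have "\<dots> = k s - (\<integral>t. k t \<partial>angles) / pi" by (simp add: field_simps power2_eq_square)
  finally show ?thesis .
qed

section \<open>The kernel as an average over directions\<close>

lemma has_derivative_nabla:
  assumes "f differentiable (at z)"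
  shows "(f has_derivative blinfun_apply (nabla f z)) (at z)"
proof -
  have d: "(f has_derivative frechet_derivative f (at z)) (at z)"
    using assms by (simp add: frechet_derivative_works)
  then have "bounded_linear (frechet_derivative f (at z))" by (rule has_derivative_bounded_linear)
  with d show ?thesis by (simp add: nabla_def bounded_linear_Blinfun_apply)
qed

lemma has_vector_derivative_along:
  assumes f: "f differentiable (at (\<gamma> t))" and g: "(\<gamma> has_vector_derivative v) (at t)"
  shows "((\<lambda>t. f (\<gamma> t)) has_vector_derivative blinfun_apply (nabla f (\<gamma> t)) v) (at t)"
proof -
  have "((\<lambda>t. f (\<gamma> t)) has_derivative (\<lambda>h. blinfun_apply (nabla f (\<gamma> t)) (h *\<^sub>R v))) (at t)"
    using has_derivative_compose[OF g[unfolded has_vector_derivative_def] has_derivative_nabla[OF f]] .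
  then show ?thesis by (simp add: has_vector_derivative_def blinfun.scaleR_right)
qed

lemma has_vector_derivative_cis: "(cis has_vector_derivative \<i> * cis t) (at t)"
  unfolding has_vector_derivative_complex_iff by (auto intro!: derivative_eq_intros simp: has_real_derivative_iff_has_vector_derivative[symmetric])

text \<open>
  The chain rule along the unit circle, where the velocity is \<open>\<i> * cis t\<close> and the acceleration is
  \<open>- cis t\<close>.
\<close>

lemma angular_derivatives:
  fixes \<kappa> :: "complex \<Rightarrow> real"
  assumes C3: "C3_on (- {0}) \<kappa>"
    and bd: "\<And>z. norm z = 1 \<Longrightarrow> norm (nabla \<kappa> z) \<le> e \<and> norm (nabla (nabla \<kappa>) z) \<le> e"
  obtains k' k'' where "\<And>t. ((\<lambda>t. \<kappa> (cis t)) has_real_derivative k' t) (at t)"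
    "\<And>t. (k' has_real_derivative k'' t) (at t)" "continuous_on UNIV k''" "\<And>t. \<bar>k'' t\<bar> \<le> 2 * e"
proof
  define N where "N t = nabla \<kappa> (cis t)" for t
  define M where "M t = nabla (nabla \<kappa>) (cis t)" for t
  define k' where "k' t = blinfun_apply (N t) (\<i> * cis t)" for t
  define k'' where "k'' t = blinfun_apply (N t) (- cis t) + blinfun_apply (blinfun_apply (M t) (\<i> * cis t)) (\<i> * cis t)" for t
  have d: "\<kappa> differentiable (at (cis t))" "nabla \<kappa> differentiable (at (cis t))" "nabla (nabla \<kappa>) differentiable (at (cis t))" for t
    using C3 by (auto simp: C3_on_def)
  show "((\<lambda>t. \<kappa> (cis t)) has_real_derivative k' t) (at t)" for t
    using has_vector_derivative_along[OF d(1) has_vector_derivative_cis]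
    by (simp add: has_real_derivative_iff_has_vector_derivative k'_def N_def)
  show "(k' has_real_derivative k'' t) (at t)" for t
  proof -
    have 1: "(N has_vector_derivative blinfun_apply (M t) (\<i> * cis t)) (at t)"
      using has_vector_derivative_along[OF d(2) has_vector_derivative_cis] by (simp add: N_def[abs_def] M_def)
    have 2: "((\<lambda>t. \<i> * cis t) has_vector_derivative - cis t) (at t)"
      using has_vector_derivative_mult_right[OF has_vector_derivative_cis, of \<i> t] by (simp add: mult.assoc[symmetric])
    from bounded_bilinear.has_vector_derivative[OF bounded_bilinear_blinfun_apply 1 2]
    show ?thesis by (simp add: has_real_derivative_iff_has_vector_derivative k'_def[abs_def] k''_def)
  qed
  have isCont_cis: "isCont cis t" for t using has_vector_derivative_cis by (rule has_vector_derivative_continuous)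
  have contN: "continuous_on UNIV N" and contM: "continuous_on UNIV M"
    unfolding N_def[abs_def] M_def[abs_def]
    by (rule continuous_at_imp_continuous_on ballI isCont_o2[OF isCont_cis] differentiable_imp_continuous_within d)+
  show "continuous_on UNIV k''"
    unfolding k''_def[abs_def] by (intro continuous_intros contN contM)
  fix t
  have "\<bar>blinfun_apply (N t) (- cis t)\<bar> \<le> norm (N t) * norm (- cis t)"
    using norm_blinfun[of "N t" "- cis t"] by simp
  also have "\<dots> \<le> e" using bd[of "cis t"] by (simp add: N_def)
  finally have 1: "\<bar>blinfun_apply (N t) (- cis t)\<bar> \<le> e" .
  have "\<bar>blinfun_apply (blinfun_apply (M t) (\<i> * cis t)) (\<i> * cis t)\<bar> \<le> norm (blinfun_apply (M t) (\<i> * cis t)) * norm (\<i> * cis t)"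
    using norm_blinfun[of "blinfun_apply (M t) (\<i> * cis t)" "\<i> * cis t"] by simp
  also have "\<dots> \<le> norm (M t)"
    using norm_blinfun[of "M t" "\<i> * cis t"] by (simp add: norm_mult)
  also have "\<dots> \<le> e" using bd[of "cis t"] by (simp add: M_def)
  finally show "\<bar>k'' t\<bar> \<le> 2 * e" using 1 unfolding k''_def by linarith
qed

text \<open>
  Used with a mean-zero function: then the correction of the density also has mean zero, and the
  density integrates to \<open>1\<close>.
\<close>

lemma integral_conv:
  assumes w: "integrable angles w" and q: "pi_periodic q"
  shows "(\<integral>s. conv w q s \<partial>angles) = (\<integral>t. w t \<partial>angles) * (\<integral>s. q s \<partial>angles)"
proof -
  interpret P: pair_sigma_finite angles angles by unfold_locales
  note [measurable] = pi_periodicD(1)[OF q]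
  have [measurable]: "w \<in> borel_measurable angles" using w by simp
  obtain K where K: "\<And>x. \<bar>q x\<bar> \<le> K" using pi_periodic_bounded[OF q] by auto
  have int: "integrable (angles \<Otimes>\<^sub>M angles) (\<lambda>(s, t). w t * q (s - t))"
  proof (rule Bochner_Integration.integrable_bound)
    show "integrable (angles \<Otimes>\<^sub>M angles) (\<lambda>(s, t). w t * K)"
    proof (rule P.Fubini_integrable)
      show "integrable angles (\<lambda>x. LINT y|angles. norm (case (x, y) of (s, t) \<Rightarrow> w t * K))" by simp
      show "AE x in angles. integrable angles (\<lambda>y. case (x, y) of (s, t) \<Rightarrow> w t * K)" using w by simp
    qed measurable
    have "\<bar>q x\<bar> \<le> \<bar>K\<bar>" for x using K[of x] by linarith
    then show "AE x in angles \<Otimes>\<^sub>M angles. norm (case x of (s, t) \<Rightarrow> w t * q (s - t)) \<le> norm (case x of (s, t) \<Rightarrow> w t * K)"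
      by (intro AE_I2) (auto simp: abs_mult split: prod.split intro!: mult_left_mono)
  qed measurable
  have "(\<integral>s. conv w q s \<partial>angles) = (\<integral>t. (\<integral>s. w t * q (s - t) \<partial>angles) \<partial>angles)"
    unfolding conv_def using P.Fubini_integral[OF int] by simp
  also have "\<dots> = (\<integral>t. w t * (\<integral>s. q s \<partial>angles) \<partial>angles)"
  proof (rule Bochner_Integration.integral_cong[OF refl])
    fix t
    have "(\<integral>s. q (s - t) \<partial>angles) = (\<integral>s. q (0 - s) \<partial>angles)"
    proof -
      have "q (0 - (x + pi) - t) = q (0 - x - t)" for x using pi_periodicD(2)[OF q, of "0 - (x + pi) - t"] by simp
      then have "(\<integral>s. q (0 - (0 - s) - t) \<partial>angles) = (\<integral>s. q (0 - s - t) \<partial>angles)"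
        by (intro integral_angles_periodic_reflect(2)[of "\<lambda>s. q (0 - s - t)"]) auto
      also have "\<dots> = (\<integral>s. q s \<partial>angles)"
        using integral_angles_periodic_reflect(2)[of q "- t"] pi_periodicD(2)[OF q] by (simp add: minus_diff_commute)
      also have "\<dots> = (\<integral>s. q (0 - s) \<partial>angles)"
        using integral_angles_periodic_reflect(2)[of q 0] pi_periodicD(2)[OF q] by simp
      finally show ?thesis by simp
    qed
    also have "\<dots> = (\<integral>s. q s \<partial>angles)"
      using integral_angles_periodic_reflect(2)[of q 0] pi_periodicD(2)[OF q] by simp
    finally show "(\<integral>s. w t * q (s - t) \<partial>angles) = w t * (\<integral>s. q s \<partial>angles)" by simp
  qed
  finally show ?thesis by simp
qed

lemma AE_sin_shift_nonzero: "AE x in angles. sin (\<theta> - x) \<noteq> 0"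
proof -
  have "AE x in angles. x \<notin> (\<lambda>i::int. \<theta> - of_int i * pi) ` UNIV"
    by (rule AE_angles_not_countable) simp
  then show ?thesis
  proof eventually_elim
    case (elim x)
    show ?case
    proof
      assume "sin (\<theta> - x) = 0"
      then obtain i :: int where "\<theta> - x = of_int i * pi" by (auto simp: sin_zero_iff_int2)
      then have "x = \<theta> - of_int i * pi" by simp
      then show False using elim by blast
    qed
  qed
qed

lemma Im_polar: "Im (of_real r * cis \<theta> * cis (- \<phi>)) = r * sin (\<theta> - \<phi>)"
  by (simp add: cis_mult mult.assoc)

text \<open>
  For \<open>z = r * cis \<theta>\<close> one has \<open>ln \<bar>Im (z * cis (- t))\<bar> = ln r - log_kernel (\<theta> - t)\<close>. The constant part
  \<open>1 / pi\<close> of the density contributes \<open>ln r\<close> and a constant, and the correction \<open>h\<close> from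
  \<open>log_sin_deconvolution\<close>, which solves the convolution equation for the angular part of \<open>\<kappa>\<close>,
  contributes \<open>- \<kappa> z\<close> and a constant. The correction is bounded by a multiple of the second angular
  derivative.
\<close>

theorem angular_density:
  assumes d: "d > 0"
  shows "\<exists>e>0. \<forall>\<kappa> :: complex \<Rightarrow> real.
    even_off_0 \<kappa> \<longrightarrow> homogeneous_0 \<kappa> \<longrightarrow> C3_on (- {0}) \<kappa> \<longrightarrow>
    (\<forall>z. norm z = 1 \<longrightarrow> norm (nabla \<kappa> z) \<le> e \<and> norm (nabla (nabla \<kappa>) z) \<le> e) \<longrightarrow>
    (\<exists>g c. g \<in> borel_measurable borel \<and> (\<forall>t. \<bar>pi * g t - 1\<bar> \<le> d) \<and> (\<integral>t. g t \<partial>angles) = 1 \<and>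
       (\<forall>z. z \<noteq> 0 \<longrightarrow> integrable angles (\<lambda>t. g t * ln \<bar>Im (z * cis (- t))\<bar>) \<and>
         (\<integral>t. g t * ln \<bar>Im (z * cis (- t))\<bar> \<partial>angles) = ln (norm z) - \<kappa> z + c))"
proof -
  let ?l = "\<integral>x. \<bar>log_kernel x\<bar> \<partial>angles"
  define e where "e = d * pi / (2 * ?l + 1)"
  have l0: "?l \<ge> 0" by simp
  have e: "e > 0" using d l0 by (simp add: e_def add_nonneg_pos)
  show ?thesis
  proof (intro exI[of _ e] conjI e allI impI)
    fix \<kappa> :: "complex \<Rightarrow> real"
    assume ev: "even_off_0 \<kappa>" and hom: "homogeneous_0 \<kappa>" and C3: "C3_on (- {0}) \<kappa>"
      and bd: "\<forall>z. norm z = 1 \<longrightarrow> norm (nabla \<kappa> z) \<le> e \<and> norm (nabla (nabla \<kappa>) z) \<le> e"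
    obtain k' k'' where k: "\<And>t. ((\<lambda>t. \<kappa> (cis t)) has_real_derivative k' t) (at t)"
      "\<And>t. (k' has_real_derivative k'' t) (at t)" "continuous_on UNIV k''" "\<And>t. \<bar>k'' t\<bar> \<le> 2 * e"
      using angular_derivatives[OF C3] bd by metis
    have per: "\<kappa> (cis (x + pi)) = \<kappa> (cis x)" for x
    proof -
      have "cis (x + pi) = - cis x" by (simp add: complex_eq_iff)
      then show ?thesis using ev by (simp add: even_off_0_def)
    qed
    define h where "h s = - conv log_kernel k'' s / pi\<^sup>2" for s
    note dec = log_sin_deconvolution[OF k(1-3) per, folded h_def]
    have [measurable]: "k'' \<in> borel_measurable borel" using k(3) by (rule borel_measurable_continuous_onI)
    have [measurable]: "h \<in> borel_measurable borel" unfolding h_def[abs_def] by measurable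
    have per': "k' (x + pi) = k' x" for x by (rule periodic_derivative[OF k(1) per])
    have per'': "k'' (x + pi) = k'' x" for x by (rule periodic_derivative[OF k(2) per'])
    have pi_periodic: "pi_periodic k''" using k(3) per'' by (simp add: pi_periodic_def)
    have "(\<integral>t. k'' t \<partial>angles) = k' pi - k' 0" by (rule angles_FTC[OF k(3) k(2)])
    then have z: "(\<integral>t. k'' t \<partial>angles) = 0" using per'[of 0] by simp
    have hb: "\<bar>pi * h s\<bar> \<le> d" for s
    proof -
      have "\<bar>conv log_kernel k'' s\<bar> \<le> ?l * (2 * e)"
        by (rule conv_bound[OF integrable_log_kernel]) (use k(4) in auto)
      also have "\<dots> = d * pi * (2 * ?l / (2 * ?l + 1))" by (simp add: e_def)
      also have "\<dots> \<le> d * pi * 1"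
      proof (rule mult_left_mono)
        have "2 * l / (2 * l + 1) \<le> 1" if "0 \<le> l" for l :: real using that by simp
        then show "2 * ?l / (2 * ?l + 1) \<le> 1" using l0 by blast
      qed (use d in simp)
      finally have "\<bar>conv log_kernel k'' s\<bar> / pi \<le> d" by (simp add: divide_le_eq)
      moreover have "\<bar>pi * h s\<bar> = \<bar>conv log_kernel k'' s\<bar> / pi"
        by (simp add: h_def abs_mult power2_eq_square)
      ultimately show ?thesis by simp
    qed
    have hb': "\<bar>h s\<bar> \<le> d / pi" for s using hb[of s] by (simp add: abs_mult field_simps)
    have inth: "integrable angles h"
      using integrable_mult_bounded[of "\<lambda>_. 1" h "d / pi"] hb' by simp
    have "(\<integral>s. conv log_kernel k'' s \<partial>angles) = 0"
      using integral_conv[OF integrable_log_kernel pi_periodic] z by simp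
    then have h0: "(\<integral>s. h s \<partial>angles) = 0" by (simp add: h_def)
    define g where "g t = 1 / pi + h t" for t
    define c where "c = (\<integral>t. \<kappa> (cis t) \<partial>angles) / pi - (\<integral>x. log_kernel x \<partial>angles) / pi"
    show "\<exists>g c. g \<in> borel_measurable borel \<and> (\<forall>t. \<bar>pi * g t - 1\<bar> \<le> d) \<and> (\<integral>t. g t \<partial>angles) = 1 \<and>
       (\<forall>z. z \<noteq> 0 \<longrightarrow> integrable angles (\<lambda>t. g t * ln \<bar>Im (z * cis (- t))\<bar>) \<and>
         (\<integral>t. g t * ln \<bar>Im (z * cis (- t))\<bar> \<partial>angles) = ln (norm z) - \<kappa> z + c)"
    proof (rule exI[of _ g], rule exI[of _ c], intro conjI allI impI)
      show [measurable]: "g \<in> borel_measurable borel" unfolding g_def[abs_def] by measurable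
      show "\<bar>pi * g t - 1\<bar> \<le> d" for t using hb[of t] by (simp add: g_def distrib_left)
      show intg: "(\<integral>t. g t \<partial>angles) = 1"
        unfolding g_def using inth h0 by (simp add: measure_angles_UNIV)
      fix z :: complex assume "z \<noteq> 0"
      define r where "r = norm z"
      define \<theta> where "\<theta> = Arg z"
      have r: "r > 0" using \<open>z \<noteq> 0\<close> by (simp add: r_def)
      have zr: "z = of_real r * cis \<theta>"
        unfolding r_def \<theta>_def using \<open>z \<noteq> 0\<close> by (simp add: cis_Arg sgn_eq)
      have kz: "\<kappa> z = \<kappa> (cis \<theta>)"
        using hom r unfolding homogeneous_0_def zr by (metis cis_neq_zero scaleR_conv_of_real)
      have ae: "AE t in angles. g t * ln \<bar>Im (z * cis (- t))\<bar> = ln r * g t - (log_kernel (\<theta> - t) / pi + log_kernel (\<theta> - t) * h t)"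
        using AE_sin_shift_nonzero[of \<theta>]
      proof eventually_elim
        case (elim t)
        have ln: "ln \<bar>Im (z * cis (- t))\<bar> = ln r - log_kernel (\<theta> - t)"
          unfolding zr Im_polar using elim r by (simp add: abs_mult ln_mult log_kernel_def)
        show ?case unfolding ln g_def by (simp add: algebra_simps diff_divide_distrib)
      qed
      have iL: "integrable angles (\<lambda>t. log_kernel (\<theta> - t))" "(\<integral>t. log_kernel (\<theta> - t) \<partial>angles) = (\<integral>t. log_kernel t \<partial>angles)"
        using integral_angles_periodic_reflect[of log_kernel \<theta>] integrable_log_kernel log_kernel_periodic by auto
      have iLh: "integrable angles (\<lambda>t. log_kernel (\<theta> - t) * h t)"
        by (rule integrable_mult_bounded[OF iL(1)]) (use hb' in auto)
      have ig: "integrable angles g" unfolding g_def[abs_def] using inth by simp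
      have i1: "integrable angles (\<lambda>t. ln r * g t - (log_kernel (\<theta> - t) / pi + log_kernel (\<theta> - t) * h t))"
        using iL iLh ig by simp
      show "integrable angles (\<lambda>t. g t * ln \<bar>Im (z * cis (- t))\<bar>)"
        by (subst integrable_cong_AE[OF _ _ ae]) (use i1 in auto)
      have "(\<integral>t. g t * ln \<bar>Im (z * cis (- t))\<bar> \<partial>angles) = (\<integral>t. ln r * g t - (log_kernel (\<theta> - t) / pi + log_kernel (\<theta> - t) * h t) \<partial>angles)"
        by (rule integral_cong_AE[OF _ _ ae]) auto
      also have "\<dots> = ln r - ((\<integral>x. log_kernel x \<partial>angles) / pi + (\<integral>t. log_kernel (\<theta> - t) * h t \<partial>angles))"
        using iL iLh ig intg by simp
      also have "\<dots> = ln (norm z) - \<kappa> z + c"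
        unfolding dec kz c_def r_def by simp
      finally show "(\<integral>t. g t * ln \<bar>Im (z * cis (- t))\<bar> \<partial>angles) = ln (norm z) - \<kappa> z + c" .
    qed
  qed
qed

section \<open>Choosing the ellipse\<close>

lemma half_plane_denominator:
  assumes "norm w \<le> 1 / 2" shows "1 / 2 \<le> 1 + Re (cnj w * cis s)" "1 + Re (cnj w * cis s) \<le> 3 / 2"
proof -
  have "\<bar>Re (cnj w * cis s)\<bar> \<le> norm (cnj w * cis s)" by (rule abs_Re_le_cmod)
  then have "\<bar>Re (cnj w * cis s)\<bar> \<le> 1 / 2" using assms by (simp add: norm_mult)
  then show "1 / 2 \<le> 1 + Re (cnj w * cis s)" "1 + Re (cnj w * cis s) \<le> 3 / 2" by linarith+
qed

text \<open>
  The parameter \<open>w\<close> encodes the ellipse whose squared half-width in the direction \<open>t\<close> is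
  \<open>1 + Re (cnj w * cis (2 * t))\<close>. Since
  \<open>(Im (z * cis (- t)))\<^sup>2 = \<bar>z\<bar>\<^sup>2 / 2 - Re (cnj (z\<^sup>2) * cis (2 * t)) / 2\<close>, the required identity says that \<open>g\<close> divided by the squared
  half-width has total mass \<open>1\<close> and a vanishing second Fourier coefficient \<open>V w\<close>. The first condition
  follows from the second, since \<open>g\<close> has mass \<open>1\<close>. For the second, \<open>V\<close> points inwards on the circle
  of radius \<open>1 / 2\<close>: with \<open>\<tau> t = Re (cnj w * cis (2 * t))\<close> the radial component is the integral of
  \<open>g * \<tau> / (1 + \<tau>)\<close>, which for constant \<open>g\<close> is at most the integral of \<open>g * (\<tau> - 2 / 3 * \<tau>\<^sup>2)\<close> and
  hence negative.
\<close>

lemma ellipse_parameter: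
  fixes g :: "real \<Rightarrow> real"
  assumes [measurable]: "g \<in> borel_measurable borel" and gb: "\<And>t. \<bar>pi * g t - 1\<bar> \<le> 1 / 16"
    and g1: "(\<integral>t. g t \<partial>angles) = 1"
  shows "\<exists>w. norm w \<le> 1 / 2 \<and>
    (\<forall>z. (\<integral>t. g t * ((Im (z * cis (- t)))\<^sup>2 / (1 + Re (cnj w * cis (2 * t)))) \<partial>angles) = (norm z)\<^sup>2 / 2)"
proof -
  define q where "q w t = 1 + Re (cnj w * cis (2 * t))" for w t
  define V where "V w = (\<integral>t. of_real (g t / q w t) * cis (2 * t) \<partial>angles)" for w
  have gle: "\<bar>g t\<bar> \<le> 1" for t
  proof -
    have "\<bar>pi * g t\<bar> \<le> 2" using gb[of t] unfolding abs_le_iff by linarith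
    then have "pi * \<bar>g t\<bar> \<le> 2" by (simp add: abs_mult)
    then have "\<bar>g t\<bar> \<le> 2 / pi" by (simp add: field_simps)
    also have "\<dots> \<le> 1" using pi_gt3 by simp
    finally show ?thesis .
  qed
  have q: "1 / 2 \<le> q w t" "q w t \<le> 3 / 2" if "norm w \<le> 1 / 2" for w t
    using half_plane_denominator[OF that] by (simp_all add: q_def)
  have [measurable]: "q w \<in> borel_measurable borel" for w
    unfolding q_def[abs_def] by (intro borel_measurable_continuous_onI continuous_intros)
  have [measurable]: "cis \<in> borel_measurable borel"
    by (intro borel_measurable_continuous_onI continuous_intros)
  have bnd: "\<bar>g t / q w t\<bar> \<le> 2" if "norm w \<le> 1 / 2" for w t
  proof -
    have "\<bar>g t / q w t\<bar> = \<bar>g t\<bar> / q w t" using q[OF that, of t] by (simp add: abs_div)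
    also have "\<dots> \<le> 1 / (1 / 2)" using q[OF that, of t] gle[of t] by (intro frac_le) auto
    finally show ?thesis by simp
  qed
  have iV: "integrable angles (\<lambda>t. of_real (g t / q w t) * cis (2 * t))" if "norm w \<le> 1 / 2" for w
    by (rule angles.integrable_const_bound[where B=2])
       (use bnd[OF that] in \<open>auto simp: norm_mult simp del: of_real_divide\<close>)
  have contV: "continuous_on (cball 0 (1/2)) V"
  proof (rule continuous_on_sequentiallyI)
    fix u :: "nat \<Rightarrow> complex" and a assume u: "\<forall>n. u n \<in> cball 0 (1/2)" and a: "a \<in> cball 0 (1/2)" and lim: "u \<longlonglongrightarrow> a"
    show "(\<lambda>n. V (u n)) \<longlonglongrightarrow> V a"
      unfolding V_def
    proof (rule integral_dominated_convergence[where w="\<lambda>_. 2"])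
      show "AE t in angles. (\<lambda>n. of_real (g t / q (u n) t) * cis (2 * t)) \<longlonglongrightarrow> of_real (g t / q a t) * cis (2 * t)"
      proof (rule AE_I2)
        fix t
        have "q a t \<noteq> 0" using q[of a t] a by auto
        then show "(\<lambda>n. of_real (g t / q (u n) t) * cis (2 * t)) \<longlonglongrightarrow> of_real (g t / q a t) * cis (2 * t)"
          unfolding q_def by (intro tendsto_intros lim) auto
      qed
      show "AE t in angles. norm (of_real (g t / q (u n) t) * cis (2 * t)) \<le> 2" for n
        using bnd[of "u n"] u by (auto simp: norm_mult simp del: of_real_divide)
    qed (auto simp: angles.integrable_const)
  qed
  have ReV: "Re (d * V w) = (\<integral>t. g t / q w t * Re (d * cis (2 * t)) \<partial>angles)" if w: "norm w \<le> 1 / 2" for d w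
  proof -
    have "Re (d * V w) = Re (\<integral>t. d * (of_real (g t / q w t) * cis (2 * t)) \<partial>angles)"
      unfolding V_def by (simp only: integral_mult_right_zero)
    also have "\<dots> = (\<integral>t. Re (d * (of_real (g t / q w t) * cis (2 * t))) \<partial>angles)"
      by (rule integral_Re[symmetric]) (rule integrable_mult_right[OF iV[OF w]])
    also have "\<dots> = (\<integral>t. g t / q w t * Re (d * cis (2 * t)) \<partial>angles)"
    proof (intro Bochner_Integration.integral_cong refl)
      have "Re (of_real r * u) = r * Re u" for r u by simp
      then show "Re (d * (of_real (g t / q w t) * cis (2 * t))) = g t / q w t * Re (d * cis (2 * t))" for t
        by (simp only: mult.left_commute[of d])
    qed
    finally show ?thesis .
  qed
  \<comment> \<open>The final bound is \<open>- 1 / 12 + 1 / 16 < 0\<close>, where \<open>1 / 16\<close> is the allowed deviation of \<open>pi * g\<close> from \<open>1\<close>.\<close>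
  have neg: "Re (cnj w * V w) < 0" if w: "norm w = 1 / 2" for w
  proof -
    define \<tau> where "\<tau> t = Re (cnj w * cis (2 * t))" for t
    have q': "q w t = 1 + \<tau> t" for t by (simp add: q_def \<tau>_def)
    have \<tau>b: "-1/2 \<le> \<tau> t" "\<tau> t \<le> 1/2" for t using q[of w t] w q'[of t] by auto
    have [measurable]: "\<tau> \<in> borel_measurable borel"
      unfolding \<tau>_def[abs_def] by (intro borel_measurable_continuous_onI continuous_intros)
    have i\<tau>: "integrable angles \<tau>" "integrable angles (\<lambda>t. (\<tau> t)\<^sup>2)"
      unfolding \<tau>_def by (rule integrable_angles_continuous, intro continuous_intros)+
    have i1: "(\<integral>t. \<tau> t \<partial>angles) = 0"
      using integral_trig[of 1 "cnj w"] by (simp add: \<tau>_def)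
    have sq: "(\<tau> t)\<^sup>2 = 1 / 8 + Re ((cnj w)\<^sup>2 / 2 * cis (2 * real 2 * t))" for t
    proof -
      have *: "(Re u)\<^sup>2 = (norm u)\<^sup>2 / 2 + Re (u\<^sup>2) / 2" for u
        by (simp add: cmod_power2 Re_power2 field_simps)
      have "(cnj w * cis (2 * t))\<^sup>2 = (cnj w)\<^sup>2 * cis (2 * real 2 * t)"
        by (simp add: power_mult_distrib power2_eq_square[of "cis _"] cis_mult)
      moreover have "norm (cnj w * cis (2 * t)) = 1 / 2" using w by (simp add: norm_mult)
      ultimately have "(\<tau> t)\<^sup>2 = (1 / 2)\<^sup>2 / 2 + Re ((cnj w)\<^sup>2 * cis (2 * real 2 * t)) / 2"
        using *[of "cnj w * cis (2 * t)"] unfolding \<tau>_def by (simp only:)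
      then show ?thesis by (simp add: power2_eq_square del: cis.simps Re_power2)
    qed
    have i2: "(\<integral>t. (\<tau> t)\<^sup>2 \<partial>angles) = pi / 8"
    proof -
      have "integrable angles (\<lambda>t. Re ((cnj w)\<^sup>2 / 2 * cis (2 * real 2 * t)))"
        by (rule integrable_angles_continuous) (intro continuous_intros)
      then have "(\<integral>t. (\<tau> t)\<^sup>2 \<partial>angles) = (\<integral>t. 1 / 8 \<partial>angles) + (\<integral>t. Re ((cnj w)\<^sup>2 / 2 * cis (2 * real 2 * t)) \<partial>angles)"
        unfolding sq by (intro Bochner_Integration.integral_add) auto
      then show ?thesis using integral_trig[of 2 "(cnj w)\<^sup>2 / 2"] by (simp add: measure_angles_UNIV)
    qed
    have le: "g t / q w t * \<tau> t \<le> 1 / pi * (\<tau> t - 2 / 3 * (\<tau> t)\<^sup>2) + 1 / (16 * pi)" for t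
    proof -
      have p: "1 + \<tau> t > 0" using \<tau>b[of t] by linarith
      define r where "r = \<tau> t / (1 + \<tau> t)"
      have "\<tau> t = r * (1 + \<tau> t)" using p by (simp add: r_def)
      have "r - (\<tau> t - 2 / 3 * (\<tau> t)\<^sup>2) = (\<tau> t)\<^sup>2 * (2 / 3 - 1 / (1 + \<tau> t))"
        using p by (simp add: r_def field_simps power2_eq_square)
      also have "\<dots> \<le> 0"
        using p \<tau>b[of t] by (intro mult_nonneg_nonpos) (auto simp: field_simps)
      finally have r1: "r \<le> \<tau> t - 2 / 3 * (\<tau> t)\<^sup>2" by simp
      have r2: "\<bar>r\<bar> \<le> 1" using p \<tau>b[of t] by (auto simp: r_def abs_le_iff field_simps)
      have "pi * g t * r = r + (pi * g t - 1) * r" by (simp add: algebra_simps)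
      also have "(pi * g t - 1) * r \<le> \<bar>pi * g t - 1\<bar> * \<bar>r\<bar>" by (simp add: abs_mult[symmetric])
      also have "\<dots> \<le> 1 / 16 * 1" using gb[of t] r2 by (intro mult_mono) auto
      finally have "pi * (g t * r) \<le> (\<tau> t - 2 / 3 * (\<tau> t)\<^sup>2) + 1 / 16" using r1 by simp
      then have "g t * r \<le> ((\<tau> t - 2 / 3 * (\<tau> t)\<^sup>2) + 1 / 16) / pi" by (simp add: le_divide_eq mult.commute)
      then show ?thesis by (simp add: r_def q' field_simps)
    qed
    have iR: "integrable angles (\<lambda>t. 1 / pi * (\<tau> t - 2 / 3 * (\<tau> t)\<^sup>2) + 1 / (16 * pi))"
      using i\<tau> by (auto simp: angles.integrable_const)
    have "Re (cnj w * V w) = (\<integral>t. g t / q w t * \<tau> t \<partial>angles)"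
      using ReV[of w "cnj w"] w by (simp add: \<tau>_def)
    also have "\<dots> \<le> (\<integral>t. 1 / pi * (\<tau> t - 2 / 3 * (\<tau> t)\<^sup>2) + 1 / (16 * pi) \<partial>angles)"
    proof (rule integral_mono[OF _ iR])
      show "integrable angles (\<lambda>t. g t / q w t * \<tau> t)"
        using integrable_mult_bounded[OF i\<tau>(1), of "\<lambda>t. g t / q w t" 2] bnd[of w] w by (simp add: mult.commute)
    qed (rule le)
    also have "\<dots> = 1 / pi * (0 - 2 / 3 * (pi / 8)) + 1 / (16 * pi) * pi"
      using i\<tau> by (simp add: i1 i2 angles.integrable_const measure_angles_UNIV)
    also have "\<dots> < 0" by simp
    finally show ?thesis .
  qed
  have "\<exists>w. norm w \<le> 1 / 2 \<and> V w = 0"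
  proof (rule ccontr)
    assume *: "\<not> ?thesis"
    have nz: "V w \<noteq> 0" if "norm w \<le> 1 / 2" for w using * that by blast
    \<comment> \<open>If \<open>V\<close> had no zero, its direction scaled to length \<open>1 / 2\<close> would have a fixed point, where \<open>V\<close> points outwards.\<close>
    obtain w where w: "w \<in> cball 0 (1/2)" "(\<lambda>w. sgn (V w) /\<^sub>R 2) w = w"
    proof (rule brouwer)
      show "continuous_on (cball 0 (1/2)) (\<lambda>w. sgn (V w) /\<^sub>R 2)"
        using nz by (intro continuous_intros contV) auto
      show "(\<lambda>w. sgn (V w) /\<^sub>R 2) \<in> cball 0 (1/2) \<rightarrow> cball 0 (1/2)"
        using nz by (auto simp: norm_sgn)
    qed (auto simp: that)
    have V: "V w \<noteq> 0" using nz w(1) by simp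
    have nw: "norm w = 1 / 2" by (subst w(2)[symmetric]) (simp add: norm_sgn V)
    have w2: "sgn (V w) /\<^sub>R 2 = w" using w(2) .
    have "of_real (2 * norm (V w)) * (sgn (V w) /\<^sub>R 2) = V w" using V by (simp add: sgn_eq scaleR_conv_of_real)
    then have eV: "V w = of_real (2 * norm (V w)) * w" unfolding w2 by (rule sym)
    have "cnj w * V w = cnj w * (of_real (2 * norm (V w)) * w)" by (rule arg_cong[OF eV])
    also have "\<dots> = of_real (2 * norm (V w)) * (w * cnj w)" by (simp only: mult_ac)
    finally have "cnj w * V w = of_real (2 * norm (V w)) * (w * cnj w)" .
    then have "Re (cnj w * V w) = 2 * norm (V w) * (norm w)\<^sup>2"
      by (simp only: complex_norm_square[symmetric] of_real_mult[symmetric] Re_complex_of_real of_real_power[symmetric])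
    then have "Re (cnj w * V w) \<ge> 0" by simp
    then show False using neg[OF nw] by simp
  qed
  then obtain w where w: "norm w \<le> 1 / 2" "V w = 0" by blast
  have ig: "integrable angles (\<lambda>t. g t / q w t * c t)" if [measurable]: "c \<in> borel_measurable borel" and "\<And>t. \<bar>c t\<bar> \<le> K" for c :: "real \<Rightarrow> real" and K
  proof -
    have "integrable angles (\<lambda>t. g t / q w t)"
      by (rule angles.integrable_const_bound[where B=2]) (use bnd[OF w(1)] in auto)
    then show ?thesis by (rule integrable_mult_bounded) (use that in auto)
  qed
  have tb: "\<bar>Re (d * cis (2 * t))\<bar> \<le> norm d" for d t
    using abs_Re_le_cmod[of "d * cis (2 * t)"] by (simp add: norm_mult)
  have m: "(\<lambda>t. Re (d * cis (2 * t))) \<in> borel_measurable borel" for d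
    by (intro borel_measurable_continuous_onI continuous_intros)
  have z: "(\<integral>t. g t / q w t * Re (d * cis (2 * t)) \<partial>angles) = 0" for d
    using ReV[OF w(1), of d] w(2) by simp
  have "1 = (\<integral>t. g t / q w t * 1 + g t / q w t * Re (cnj w * cis (2 * t)) \<partial>angles)"
  proof -
    have "g t / q w t * 1 + g t / q w t * Re (cnj w * cis (2 * t)) = g t" for t
    proof -
      have "g t / q w t * 1 + g t / q w t * Re (cnj w * cis (2 * t)) = g t / q w t * q w t"
        unfolding q_def by (simp only: distrib_left)
      then show ?thesis using q[OF w(1), of t] by simp
    qed
    then show ?thesis using g1 by (simp only:)
  qed
  also have "\<dots> = (\<integral>t. g t / q w t * 1 \<partial>angles) + (\<integral>t. g t / q w t * Re (cnj w * cis (2 * t)) \<partial>angles)"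
    by (intro Bochner_Integration.integral_add ig[where K=1] ig[where K="norm (cnj w)"] m tb) auto
  finally have "1 = (\<integral>t. g t / q w t * 1 \<partial>angles) + 0" unfolding z .
  then have one: "(\<integral>t. g t / q w t * 1 \<partial>angles) = 1" by simp
  show ?thesis
  proof (intro exI[of _ w] conjI allI w(1))
    fix z
    have sq: "(Im (z * cis (- t)))\<^sup>2 = (norm z)\<^sup>2 / 2 - Re (cnj (z\<^sup>2) / 2 * cis (2 * t))" for t
    proof -
      have *: "(Im u)\<^sup>2 = (norm u)\<^sup>2 / 2 - Re (cnj (u\<^sup>2)) / 2" for u
        by (simp add: cmod_power2 Re_power2 field_simps)
      have "cnj ((z * cis (- t))\<^sup>2) = cnj (z\<^sup>2) * cis (2 * t)"
        by (simp add: power_mult_distrib power2_eq_square[of "cis _"] cis_mult cis_cnj)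
      then show ?thesis by (subst *) (simp add: norm_mult)
    qed
    have "(\<integral>t. g t * ((Im (z * cis (- t)))\<^sup>2 / (1 + Re (cnj w * cis (2 * t)))) \<partial>angles) =
       (\<integral>t. (norm z)\<^sup>2 / 2 * (g t / q w t * 1) - g t / q w t * Re (cnj (z\<^sup>2) / 2 * cis (2 * t)) \<partial>angles)"
    proof -
      have alg: "x * ((n - y) / d) = n * (x / d * 1) - x / d * y" for x n y d :: real
        by (simp add: right_diff_distrib diff_divide_distrib)
      show ?thesis by (simp only: sq q_def[symmetric] alg)
    qed
    also have "\<dots> = (norm z)\<^sup>2 / 2 * (\<integral>t. g t / q w t * 1 \<partial>angles) - (\<integral>t. g t / q w t * Re (cnj (z\<^sup>2) / 2 * cis (2 * t)) \<partial>angles)"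
    proof -
      have "integrable angles (\<lambda>t. g t / q w t * 1)" by (rule ig[where K=1]) auto
      then have i1: "integrable angles (\<lambda>t. (norm z)\<^sup>2 / 2 * (g t / q w t * 1))" by (rule integrable_mult_right)
      have i2: "integrable angles (\<lambda>t. g t / q w t * Re (cnj (z\<^sup>2) / 2 * cis (2 * t)))"
        by (rule ig[OF m tb])
      show ?thesis by (simp only: Bochner_Integration.integral_diff[OF i1 i2] integral_mult_right_zero)
    qed
    also have "\<dots> = (norm z)\<^sup>2 / 2" unfolding z one by simp
    finally show "(\<integral>t. g t * ((Im (z * cis (- t)))\<^sup>2 / (1 + Re (cnj w * cis (2 * t)))) \<partial>angles) = (norm z)\<^sup>2 / 2" .
  qed
qed

section \<open>The logarithmic potential of the semicircle law\<close>

text \<open>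
  The semicircle law on \<open>{-1..1}\<close> is the image of this density under \<open>\<lambda>x. cos (2 * x)\<close>. The
  parametrisation covers the interval twice and makes every integrand periodic.
\<close>

definition semicircle_weight :: "real \<Rightarrow> real" where "semicircle_weight x = 2 / pi * (sin (2 * x))\<^sup>2"

definition semicircle_pot :: "real \<Rightarrow> real" where "semicircle_pot y = (\<integral>x. - ln \<bar>y - cos (2 * x)\<bar> * semicircle_weight x \<partial>angles)"

definition semicircle_const :: real where "semicircle_const = 2 * (\<integral>x. log_kernel x \<partial>angles) / pi - ln 2 + 1 / 2"

lemma semicircle_weight_measurable [measurable]: "semicircle_weight \<in> borel_measurable borel"
  unfolding semicircle_weight_def[abs_def] by measurable

lemma semicircle_weight_nonneg: "0 \<le> semicircle_weight x" by (simp add: semicircle_weight_def)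

lemma semicircle_weight_eq: "semicircle_weight x = (1 - cos (4 * x)) / pi"
  using cos_double_sin[of "2 * x"] by (simp add: semicircle_weight_def)

lemma semicircle_weight_le: "semicircle_weight x \<le> 1"
proof -
  have "(sin (2 * x))\<^sup>2 \<le> 1" by (simp add: abs_square_le_1)
  then have "semicircle_weight x \<le> 2 / pi * 1" unfolding semicircle_weight_def by (intro mult_left_mono) auto
  also have "\<dots> \<le> 1" using pi_gt3 by simp
  finally show ?thesis .
qed

lemma semicircle_weight_periodic: "semicircle_weight (x + pi) = semicircle_weight x"
proof -
  have "sin (2 * (x + pi)) = sin (2 * x)" by (simp add: distrib_left)
  then show ?thesis by (simp add: semicircle_weight_def)
qed

lemma integral_semicircle_weight: "(\<integral>x. semicircle_weight x \<partial>angles) = 1" and integrable_semicircle_weight: "integrable angles semicircle_weight"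
proof -
  show "integrable angles semicircle_weight" unfolding semicircle_weight_def by (rule integrable_angles_continuous) (intro continuous_intros)
  have "(\<integral>x. semicircle_weight x \<partial>angles) = (pi / pi - sin (4 * pi) / (4 * pi)) - (0 / pi - sin (4 * 0) / (4 * pi))"
  proof (rule angles_FTC)
    show "continuous_on UNIV semicircle_weight" unfolding semicircle_weight_def by (intro continuous_intros)
    show "((\<lambda>x. x / pi - sin (4 * x) / (4 * pi)) has_real_derivative semicircle_weight x) (at x)" for x
      unfolding semicircle_weight_eq by (auto intro!: derivative_eq_intros simp: field_simps)
  qed
  then show "(\<integral>x. semicircle_weight x \<partial>angles) = 1" using sin_2npi[of 2] by simp
qed

text \<open>
  Only the frequencies \<open>0\<close> and \<open>4\<close> of the kernel enter, because \<open>semicircle_weight x = (1 - cos (4 * x)) / pi\<close>.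
\<close>

lemma shifted_log_kernel_semicircle:
  "integrable angles (\<lambda>x. log_kernel (x + a) * semicircle_weight x)" 
  "(\<integral>x. log_kernel (x + a) * semicircle_weight x \<partial>angles) = (\<integral>x. log_kernel x \<partial>angles) / pi - cos (4 * a) / 4"
proof -
  define F where "F x = log_kernel x * semicircle_weight (- a - x)" for x
  have [measurable]: "F \<in> borel_measurable borel" unfolding F_def[abs_def] by measurable
  have per: "F (x + pi) = F x" for x
    using semicircle_weight_periodic[of "- a - (x + pi)"] by (simp add: F_def log_kernel_periodic)
  have FF: "F (- a - x) = log_kernel (x + a) * semicircle_weight x" for x
  proof -
    have "- a - x = - (x + a)" by simp
    then have "log_kernel (- a - x) = log_kernel (x + a)" by (simp only: log_kernel_even)
    then show ?thesis by (simp add: F_def)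
  qed
  have iF: "integrable angles F" unfolding F_def
    by (rule integrable_mult_bounded[OF integrable_log_kernel, where K=1]) (use semicircle_weight_nonneg semicircle_weight_le in \<open>auto simp: abs_of_nonneg\<close>)
  show "integrable angles (\<lambda>x. log_kernel (x + a) * semicircle_weight x)"
    using integral_angles_periodic_reflect(1)[of F "- a"] per iF by (simp add: FF)
  have "(\<integral>x. log_kernel (x + a) * semicircle_weight x \<partial>angles) = (\<integral>x. F x \<partial>angles)"
    using integral_angles_periodic_reflect(2)[of F "- a"] per by (simp add: FF)
  also have "\<dots> = conv log_kernel semicircle_weight (- a)" by (simp add: conv_def F_def)
  also have "conv log_kernel semicircle_weight (- a) = conv log_kernel (\<lambda>x. 1 / pi) (- a) + conv log_kernel (\<lambda>x. Re (of_real (- 1 / pi) * cis (2 * real 2 * x))) (- a)"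
  proof -
    have *: "semicircle_weight = (\<lambda>x. 1 / pi + Re (of_real (- 1 / pi) * cis (2 * real 2 * x)))"
      by (rule ext) (simp add: semicircle_weight_eq diff_divide_distrib)
    show ?thesis
      by (subst *) (rule conv_add[OF integrable_log_kernel, where K="1/pi" and K'="1/pi"];
        auto intro!: borel_measurable_continuous_onI continuous_intros simp: abs_mult divide_right_mono)
  qed
  also have "conv log_kernel (\<lambda>x. Re (of_real (- 1 / pi) * cis (2 * real 2 * x))) (- a) = - cos (4 * a) / 4"
    by (subst conv_trig[OF integrable_log_kernel integral_log_kernel_cos integral_log_kernel_sin]) auto
  also have "conv log_kernel (\<lambda>x. 1 / pi) (- a) = (\<integral>x. log_kernel x \<partial>angles) / pi" by (simp add: conv_def)
  finally show "(\<integral>x. log_kernel (x + a) * semicircle_weight x \<partial>angles) = (\<integral>x. log_kernel x \<partial>angles) / pi - cos (4 * a) / 4" by simp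
qed

lemma cos_double_diff: "cos (2 * a) - cos (2 * x) = 2 * sin (x + a) * sin (x - a)" for a x :: real
proof -
  have "(2 * a + 2 * x) / 2 = x + a" "(2 * x - 2 * a) / 2 = x - a" by simp_all
  then show ?thesis by (simp only: cos_diff_cos)
qed

lemma AE_sin_add_diff_nonzero: "AE x in angles. sin (x + a) \<noteq> 0 \<and> sin (x - a) \<noteq> 0"
  using AE_sin_shift_nonzero[of a] AE_sin_shift_nonzero[of "- a"]
proof eventually_elim
  case (elim x)
  then show ?case
    using sin_minus[of "x + a"] sin_minus[of "x - a"] by (simp add: minus_diff_commute add.commute)
qed

text \<open>
  The factorisation of \<open>cos (2 * a) - cos (2 * x)\<close> into two sines turns the potential at a point of the support
  into two shifted copies of \<open>log_kernel\<close>.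
\<close>

lemma semicircle_pot_cos:
  "integrable angles (\<lambda>x. - ln \<bar>cos (2 * a) - cos (2 * x)\<bar> * semicircle_weight x)" "semicircle_pot (cos (2 * a)) = semicircle_const - (cos (2 * a))\<^sup>2"
proof -
  have ae: "AE x in angles. - ln \<bar>cos (2 * a) - cos (2 * x)\<bar> * semicircle_weight x = log_kernel (x + a) * semicircle_weight x + log_kernel (x + - a) * semicircle_weight x - ln 2 * semicircle_weight x"
    using AE_sin_add_diff_nonzero[of a]
  proof eventually_elim
    case (elim x)
    then have "ln \<bar>cos (2 * a) - cos (2 * x)\<bar> = ln 2 - log_kernel (x + a) - log_kernel (x + - a)"
      unfolding cos_double_diff by (simp add: abs_mult ln_mult log_kernel_def)
    then show ?case by (simp only:) (simp add: algebra_simps)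
  qed
  have i: "integrable angles (\<lambda>x. log_kernel (x + a) * semicircle_weight x + log_kernel (x + - a) * semicircle_weight x - ln 2 * semicircle_weight x)"
    by (intro Bochner_Integration.integrable_diff Bochner_Integration.integrable_add shifted_log_kernel_semicircle(1)
        integrable_mult_right integrable_semicircle_weight)
  show "integrable angles (\<lambda>x. - ln \<bar>cos (2 * a) - cos (2 * x)\<bar> * semicircle_weight x)"
    by (subst integrable_cong_AE[OF _ _ ae]) (use i in auto)
  have "semicircle_pot (cos (2 * a)) = (\<integral>x. log_kernel (x + a) * semicircle_weight x + log_kernel (x + - a) * semicircle_weight x - ln 2 * semicircle_weight x \<partial>angles)"
    unfolding semicircle_pot_def by (rule integral_cong_AE[OF _ _ ae]) auto
  also have "\<dots> = (\<integral>x. log_kernel (x + a) * semicircle_weight x \<partial>angles) + (\<integral>x. log_kernel (x + - a) * semicircle_weight x \<partial>angles) - ln 2"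
    by (subst Bochner_Integration.integral_diff Bochner_Integration.integral_add;
        (intro Bochner_Integration.integrable_add shifted_log_kernel_semicircle(1) integrable_mult_right integrable_semicircle_weight)?)+
       (simp add: integral_semicircle_weight)
  also have "\<dots> = 2 * (\<integral>x. log_kernel x \<partial>angles) / pi - cos (4 * a) / 2 - ln 2"
    unfolding shifted_log_kernel_semicircle(2) by simp
  also have "cos (4 * a) = 2 * (cos (2 * a))\<^sup>2 - 1" using cos_double_cos[of "2 * a"] by simp
  finally show "semicircle_pot (cos (2 * a)) = semicircle_const - (cos (2 * a))\<^sup>2" by (simp add: semicircle_const_def diff_divide_distrib)
qed

lemma semicircle_pot_inside:
  assumes "\<bar>y\<bar> \<le> 1" shows "integrable angles (\<lambda>x. - ln \<bar>y - cos (2 * x)\<bar> * semicircle_weight x)" "semicircle_pot y = semicircle_const - y\<^sup>2"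
proof -
  have "y = cos (2 * (arccos y / 2))" using assms by (simp add: cos_arccos abs_le_iff)
  then show "integrable angles (\<lambda>x. - ln \<bar>y - cos (2 * x)\<bar> * semicircle_weight x)" "semicircle_pot y = semicircle_const - y\<^sup>2"
    using semicircle_pot_cos[of "arccos y / 2"] by simp_all
qed

lemma semicircle_pot_minus: "integrable angles (\<lambda>x. - ln \<bar>- y - cos (2 * x)\<bar> * semicircle_weight x) \<longleftrightarrow> integrable angles (\<lambda>x. - ln \<bar>y - cos (2 * x)\<bar> * semicircle_weight x)"
    "semicircle_pot (- y) = semicircle_pot y"
proof -
  define F where "F x = - ln \<bar>y - cos (2 * x)\<bar> * semicircle_weight x" for x
  have [measurable]: "F \<in> borel_measurable borel" unfolding F_def[abs_def] by measurable
  have Fe: "F = (\<lambda>x. - ln \<bar>y - cos (2 * x)\<bar> * semicircle_weight x)" by (rule ext) (rule F_def)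
  have per: "F (x + pi) = F x" for x
  proof -
    have "cos (2 * (x + pi)) = cos (2 * x)" by (simp add: distrib_left)
    then show ?thesis by (simp add: F_def semicircle_weight_periodic)
  qed
  have FF: "F (pi / 2 - x) = - ln \<bar>- y - cos (2 * x)\<bar> * semicircle_weight x" for x
  proof -
    have "2 * (pi / 2 - x) = pi - 2 * x" by simp
    then have "cos (2 * (pi / 2 - x)) = - cos (2 * x)" "sin (2 * (pi / 2 - x)) = sin (2 * x)" by (simp_all only: cos_pi_minus sin_pi_minus)
    moreover have "\<bar>- y - cos (2 * x)\<bar> = \<bar>y - - cos (2 * x)\<bar>" by linarith
    ultimately show ?thesis unfolding F_def semicircle_weight_def by (simp only:)
  qed
  show "integrable angles (\<lambda>x. - ln \<bar>- y - cos (2 * x)\<bar> * semicircle_weight x) \<longleftrightarrow> integrable angles (\<lambda>x. - ln \<bar>y - cos (2 * x)\<bar> * semicircle_weight x)"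
    using integral_angles_periodic_reflect(1)[of F "pi / 2"] per unfolding FF unfolding Fe by simp
  show "semicircle_pot (- y) = semicircle_pot y"
    using integral_angles_periodic_reflect(2)[of F "pi / 2"] per unfolding FF unfolding Fe semicircle_pot_def by simp
qed

text \<open>
  By concavity of the logarithm the potential lies above its tangent at the edge \<open>1\<close> of the
  support, whose slope is \<open>- 2\<close>; the parabola \<open>semicircle_const - y\<^sup>2\<close> has the same tangent there and
  lies below it.
\<close>

lemma semicircle_pot_outside_pos:
  assumes y: "1 < y"
  shows "integrable angles (\<lambda>x. - ln \<bar>y - cos (2 * x)\<bar> * semicircle_weight x)" "semicircle_const - y\<^sup>2 \<le> semicircle_pot y" "semicircle_pot y \<le> semicircle_const"
proof -
  have pos: "y - cos (2 * x) > 0" for x using y cos_le_one[of "2 * x"] by linarith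
  show i: "integrable angles (\<lambda>x. - ln \<bar>y - cos (2 * x)\<bar> * semicircle_weight x)"
    unfolding semicircle_weight_def using pos by (intro integrable_angles_continuous continuous_intros) (auto simp: less_imp_neq[symmetric])
  have i1: "integrable angles (\<lambda>x. - ln \<bar>1 - cos (2 * x)\<bar> * semicircle_weight x)" "semicircle_pot 1 = semicircle_const - 1"
    using semicircle_pot_inside[of 1] by simp_all
  have ae: "AE x in angles. cos (2 * x) < 1"
    using AE_sin_shift_nonzero[of 0]
  proof eventually_elim
    case (elim x)
    have "cos (2 * x) = 1 - 2 * (sin x)\<^sup>2" by (rule cos_double_sin)
    then show ?case using elim by (simp add: zero_less_power2)
  qed
  have "semicircle_pot y \<le> semicircle_pot 1"
    unfolding semicircle_pot_def
  proof (rule integral_mono_AE[OF i i1(1)])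
    show "AE x in angles. - ln \<bar>y - cos (2 * x)\<bar> * semicircle_weight x \<le> - ln \<bar>1 - cos (2 * x)\<bar> * semicircle_weight x"
      using ae by eventually_elim (use y in \<open>auto intro!: mult_right_mono semicircle_weight_nonneg\<close>)
  qed
  then show "semicircle_pot y \<le> semicircle_const" using i1(2) by simp
  define v where "v x = 2 / pi * (1 + cos (2 * x))" for x
  have iv: "integrable angles v" unfolding v_def by (intro integrable_angles_continuous continuous_intros)
  have v2: "(\<integral>x. v x \<partial>angles) = 2"
  proof -
    have "(\<integral>x. v x \<partial>angles) = (2 / pi * (pi + sin (2 * pi) / 2)) - (2 / pi * (0 + sin (2 * 0) / 2))"
    proof (rule angles_FTC)
      show "continuous_on UNIV v" unfolding v_def by (intro continuous_intros)
      show "((\<lambda>x. 2 / pi * (x + sin (2 * x) / 2)) has_real_derivative v x) (at x)" for x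
        unfolding v_def by (auto intro!: derivative_eq_intros)
    qed
    then show ?thesis by simp
  qed
  have "(\<integral>x. - ln \<bar>1 - cos (2 * x)\<bar> * semicircle_weight x - (y - 1) * v x \<partial>angles) \<le> semicircle_pot y"
    unfolding semicircle_pot_def
  proof (rule integral_mono_AE[OF _ i])
    show "integrable angles (\<lambda>x. - ln \<bar>1 - cos (2 * x)\<bar> * semicircle_weight x - (y - 1) * v x)"
      using i1(1) iv by simp
    show "AE x in angles. - ln \<bar>1 - cos (2 * x)\<bar> * semicircle_weight x - (y - 1) * v x \<le> - ln \<bar>y - cos (2 * x)\<bar> * semicircle_weight x"
      using ae
    proof eventually_elim
      case (elim x)
      define s where "s = 1 - cos (2 * x)"
      have s: "s > 0" using elim by (simp add: s_def)
      have yx: "y - cos (2 * x) = s * (1 + (y - 1) / s)" using s by (simp add: s_def field_simps)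
      have "ln (y - cos (2 * x)) = ln s + ln (1 + (y - 1) / s)"
        unfolding yx using s y by (intro ln_mult_pos) (auto simp: add_pos_nonneg)
      moreover have "ln (1 + (y - 1) / s) \<le> (y - 1) / s"
        using s y by (intro ln_add_one_self_le_self) auto
      ultimately have "ln (y - cos (2 * x)) \<le> ln s + (y - 1) / s" by linarith
      then have le: "ln (y - cos (2 * x)) * semicircle_weight x \<le> (ln s + (y - 1) / s) * semicircle_weight x"
        by (rule mult_right_mono[OF _ semicircle_weight_nonneg])
      have "(y - 1) / s * semicircle_weight x = (y - 1) * v x"
      proof -
        have "(sin (2 * x))\<^sup>2 = s * (1 + cos (2 * x))"
          using sin_squared_eq[of "2 * x"] by (simp add: s_def algebra_simps power2_eq_square)
        then show ?thesis using s by (simp add: semicircle_weight_def v_def)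
      qed
      then have "(ln s + (y - 1) / s) * semicircle_weight x = ln s * semicircle_weight x + (y - 1) * v x" by (simp add: distrib_right)
      with le have "ln (y - cos (2 * x)) * semicircle_weight x \<le> ln s * semicircle_weight x + (y - 1) * v x" by simp
      then show ?case using pos[of x] s by (simp add: s_def)
    qed
  qed
  moreover have "(\<integral>x. - ln \<bar>1 - cos (2 * x)\<bar> * semicircle_weight x - (y - 1) * v x \<partial>angles) = semicircle_pot 1 - (y - 1) * 2"
    unfolding semicircle_pot_def using i1(1) iv v2 by (subst Bochner_Integration.integral_diff) auto
  ultimately have "semicircle_const - 1 - (y - 1) * 2 \<le> semicircle_pot y" using i1(2) by simp
  moreover have "0 \<le> (y - 1)\<^sup>2" by simp
  ultimately show "semicircle_const - y\<^sup>2 \<le> semicircle_pot y" by (simp add: power2_eq_square algebra_simps)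
qed

theorem semicircle_potential:
  "integrable angles (\<lambda>x. - ln \<bar>y - cos (2 * x)\<bar> * semicircle_weight x)"
  "\<bar>y\<bar> \<le> 1 \<Longrightarrow> semicircle_pot y = semicircle_const - y\<^sup>2" "semicircle_const - y\<^sup>2 \<le> semicircle_pot y" "semicircle_pot y \<le> semicircle_const"
proof -
  consider "\<bar>y\<bar> \<le> 1" | "1 < y" | "1 < - y" by linarith
  then have "integrable angles (\<lambda>x. - ln \<bar>y - cos (2 * x)\<bar> * semicircle_weight x) \<and> semicircle_const - y\<^sup>2 \<le> semicircle_pot y \<and> semicircle_pot y \<le> semicircle_const"
  proof cases
    case 1 then show ?thesis using semicircle_pot_inside[of y] by simp
  next
    case 2 then show ?thesis using semicircle_pot_outside_pos[of y] by simp
  next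
    case 3 then show ?thesis using semicircle_pot_outside_pos[of "- y"] semicircle_pot_minus[of y] by simp
  qed
  then show "integrable angles (\<lambda>x. - ln \<bar>y - cos (2 * x)\<bar> * semicircle_weight x)" "semicircle_const - y\<^sup>2 \<le> semicircle_pot y" "semicircle_pot y \<le> semicircle_const" by auto
qed (rule semicircle_pot_inside)

section \<open>Projections of the uniform measure on an ellipse\<close>

lemma lborel_complex: "(lborel :: complex measure) = distr (lborel \<Otimes>\<^sub>M lborel) borel (\<lambda>(x, y). Complex x y)"
proof (rule lborel_eqI)
  fix l u :: complex assume le: "\<And>b. b \<in> Basis \<Longrightarrow> l \<bullet> b \<le> u \<bullet> b"
  have le': "Re l \<le> Re u" "Im l \<le> Im u" using le[of 1] le[of \<i>] by (simp_all add: Basis_complex_def)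
  have [measurable]: "(\<lambda>(x, y). Complex x y) \<in> (lborel \<Otimes>\<^sub>M lborel) \<rightarrow>\<^sub>M borel"
    by (simp add: lborel_prod) (intro borel_measurable_continuous_onI continuous_intros, auto simp: case_prod_unfold Complex_eq intro!: continuous_intros)
  have "(\<lambda>(x, y). Complex x y) -` box l u \<inter> space (lborel \<Otimes>\<^sub>M lborel) = {Re l<..<Re u} \<times> {Im l<..<Im u}"
    by (auto simp: box_def Basis_complex_def space_pair_measure)
  then show "emeasure (distr (lborel \<Otimes>\<^sub>M lborel) borel (\<lambda>(x, y). Complex x y)) (box l u) = (\<Prod>b\<in>Basis. (u - l) \<bullet> b)"
    using le' by (subst emeasure_distr) (auto simp: lborel.emeasure_pair_measure_Times Basis_complex_def ennreal_mult)
qed simp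

lemma Complex_measurable [measurable]: "(\<lambda>(x, y). Complex x y) \<in> (borel \<Otimes>\<^sub>M borel) \<rightarrow>\<^sub>M borel"
  by (simp add: borel_prod) (intro borel_measurable_continuous_onI, auto simp: case_prod_unfold Complex_eq intro!: continuous_intros)

lemma nn_integral_lborel_complex:
  assumes [measurable]: "f \<in> borel_measurable borel"
  shows "(\<integral>\<^sup>+z. f z \<partial>lborel) = (\<integral>\<^sup>+x. \<integral>\<^sup>+y. f (Complex x y) \<partial>lborel \<partial>lborel)"
proof -
  have [measurable]: "(\<lambda>(x, y). Complex x y) \<in> (lborel \<Otimes>\<^sub>M lborel) \<rightarrow>\<^sub>M borel"
    using Complex_measurable by simp
  have "(\<integral>\<^sup>+z. f z \<partial>lborel) = (\<integral>\<^sup>+p. f (case p of (x, y) \<Rightarrow> Complex x y) \<partial>(lborel \<Otimes>\<^sub>M lborel))"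
    by (subst lborel_complex, subst nn_integral_distr) simp_all
  also have "\<dots> = (\<integral>\<^sup>+x. \<integral>\<^sup>+y. f (Complex x y) \<partial>lborel \<partial>lborel)"
    by (subst lborel.nn_integral_fst[symmetric]) auto
  finally show ?thesis .
qed

text \<open>
  Two one-dimensional affine substitutions, the first in \<open>x\<close> for fixed \<open>y\<close> and the second in \<open>y\<close>.
\<close>

lemma nn_integral_linear_aux:
  fixes f :: "real \<Rightarrow> real \<Rightarrow> ennreal"
  assumes [measurable]: "(\<lambda>(x, y). f x y) \<in> borel_measurable (borel \<Otimes>\<^sub>M borel)"
    and D: "a * d - b * c \<noteq> 0" and a: "a \<noteq> 0"
  shows "(\<integral>\<^sup>+x. \<integral>\<^sup>+y. f x y \<partial>lborel \<partial>lborel) =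
    ennreal \<bar>a * d - b * c\<bar> * (\<integral>\<^sup>+x. \<integral>\<^sup>+y. f (a * x + b * y) (c * x + d * y) \<partial>lborel \<partial>lborel)"
proof -
  let ?D = "a * d - b * c"
  have "(\<integral>\<^sup>+x. \<integral>\<^sup>+y. f x y \<partial>lborel \<partial>lborel) = (\<integral>\<^sup>+s. ennreal \<bar>?D / a\<bar> * (\<integral>\<^sup>+y. f s (c * s / a + ?D / a * y) \<partial>lborel) \<partial>lborel)"
    using D a by (intro nn_integral_cong, subst nn_integral_real_affine[where c="?D / a"]) auto
  also have "\<dots> = ennreal \<bar>?D / a\<bar> * (\<integral>\<^sup>+s. (\<integral>\<^sup>+y. f s (c * s / a + ?D / a * y) \<partial>lborel) \<partial>lborel)"
    by (rule nn_integral_cmult) measurable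
  also have "(\<integral>\<^sup>+s. (\<integral>\<^sup>+y. f s (c * s / a + ?D / a * y) \<partial>lborel) \<partial>lborel) = (\<integral>\<^sup>+y. (\<integral>\<^sup>+s. f s (c * s / a + ?D / a * y) \<partial>lborel) \<partial>lborel)"
    by (rule lborel_pair.Fubini'[symmetric]) measurable
  also have "\<dots> = (\<integral>\<^sup>+y. ennreal \<bar>a\<bar> * (\<integral>\<^sup>+x. f (a * x + b * y) (c * x + d * y) \<partial>lborel) \<partial>lborel)"
  proof (rule nn_integral_cong)
    fix y
    have "(\<integral>\<^sup>+s. f s (c * s / a + ?D / a * y) \<partial>lborel) =
       ennreal \<bar>a\<bar> * (\<integral>\<^sup>+x. f (b * y + a * x) (c * (b * y + a * x) / a + ?D / a * y) \<partial>lborel)"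
      using a by (subst nn_integral_real_affine[where c=a and t="b * y"]) auto
    moreover have "c * (b * y + a * x) / a + ?D / a * y = c * x + d * y" for x
      using a by (simp add: field_simps)
    ultimately show "(\<integral>\<^sup>+s. f s (c * s / a + ?D / a * y) \<partial>lborel) = ennreal \<bar>a\<bar> * (\<integral>\<^sup>+x. f (a * x + b * y) (c * x + d * y) \<partial>lborel)"
      by (simp add: add.commute)
  qed
  also have "\<dots> = ennreal \<bar>a\<bar> * (\<integral>\<^sup>+y. (\<integral>\<^sup>+x. f (a * x + b * y) (c * x + d * y) \<partial>lborel) \<partial>lborel)"
    by (rule nn_integral_cmult) measurable
  also have "(\<integral>\<^sup>+y. (\<integral>\<^sup>+x. f (a * x + b * y) (c * x + d * y) \<partial>lborel) \<partial>lborel) = (\<integral>\<^sup>+x. (\<integral>\<^sup>+y. f (a * x + b * y) (c * x + d * y) \<partial>lborel) \<partial>lborel)"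
    by (rule lborel_pair.Fubini') measurable
  also have "ennreal \<bar>?D / a\<bar> * (ennreal \<bar>a\<bar> * X) = ennreal \<bar>?D\<bar> * X" for X
  proof -
    have "\<bar>?D / a\<bar> * \<bar>a\<bar> = \<bar>?D\<bar>" using a by (simp add: abs_divide)
    then have "ennreal \<bar>?D / a\<bar> * ennreal \<bar>a\<bar> = ennreal \<bar>?D\<bar>" by (simp only: ennreal_mult[symmetric] abs_ge_zero)
    then show ?thesis by (simp only: mult.assoc[symmetric])
  qed
  finally show ?thesis .
qed

lemma nn_integral_linear:
  fixes f :: "real \<Rightarrow> real \<Rightarrow> ennreal"
  assumes m[measurable]: "(\<lambda>(x, y). f x y) \<in> borel_measurable (borel \<Otimes>\<^sub>M borel)"
    and D: "a * d - b * c \<noteq> 0"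
  shows "(\<integral>\<^sup>+x. \<integral>\<^sup>+y. f x y \<partial>lborel \<partial>lborel) =
    ennreal \<bar>a * d - b * c\<bar> * (\<integral>\<^sup>+x. \<integral>\<^sup>+y. f (a * x + b * y) (c * x + d * y) \<partial>lborel \<partial>lborel)"
proof (cases "a = 0")
  case False then show ?thesis using nn_integral_linear_aux[OF m D] by blast
next
  case True
  \<comment> \<open>Exchanging the variables reduces to the case of a nonzero first coefficient.\<close>
  then have b: "b \<noteq> 0" and D': "b * c - a * d \<noteq> 0" using D by auto
  have "(\<integral>\<^sup>+x. \<integral>\<^sup>+y. f x y \<partial>lborel \<partial>lborel) =
    ennreal \<bar>b * c - a * d\<bar> * (\<integral>\<^sup>+x. \<integral>\<^sup>+y. f (b * x + a * y) (d * x + c * y) \<partial>lborel \<partial>lborel)"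
    by (rule nn_integral_linear_aux[OF m D' b])
  also have "(\<integral>\<^sup>+x. \<integral>\<^sup>+y. f (b * x + a * y) (d * x + c * y) \<partial>lborel \<partial>lborel) = (\<integral>\<^sup>+y. \<integral>\<^sup>+x. f (b * x + a * y) (d * x + c * y) \<partial>lborel \<partial>lborel)"
    by (rule lborel_pair.Fubini'[symmetric]) measurable
  finally show ?thesis by (simp add: add.commute abs_minus_commute)
qed

text \<open>
  The slice of the unit disc over \<open>x\<close> has length \<open>2 * sqrt (1 - x\<^sup>2)\<close>; substituting \<open>x = - cos (2 * s)\<close> gives
  the density \<open>semicircle_weight\<close> on half a period.
\<close>

lemma nn_integral_disc:
  fixes f :: "real \<Rightarrow> ennreal"
  assumes [measurable]: "f \<in> borel_measurable borel"
  shows "(\<integral>\<^sup>+x. \<integral>\<^sup>+y. f x * indicator {p. (fst p)\<^sup>2 + (snd p)\<^sup>2 \<le> 1} (x, y) \<partial>lborel \<partial>lborel) =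
    ennreal pi * (\<integral>\<^sup>+x. f (cos (2 * x)) * ennreal (semicircle_weight x) \<partial>angles)"
proof -
  have "(\<integral>\<^sup>+x. \<integral>\<^sup>+y. f x * indicator {p. (fst p)\<^sup>2 + (snd p)\<^sup>2 \<le> 1} (x, y) \<partial>lborel \<partial>lborel) =
     (\<integral>\<^sup>+x. (f x * ennreal (2 * sqrt (1 - x\<^sup>2))) * indicator {- 1..1} x \<partial>lborel)"
  proof (rule nn_integral_cong)
    fix x :: real
    show "(\<integral>\<^sup>+y. f x * indicator {p. (fst p)\<^sup>2 + (snd p)\<^sup>2 \<le> 1} (x, y) \<partial>lborel) = f x * ennreal (2 * sqrt (1 - x\<^sup>2)) * indicator {- 1..1} x"
    proof (cases "x \<in> {-1..1}")
      case True
      then have x1: "x\<^sup>2 \<le> 1" by (simp add: abs_square_le_1 abs_le_iff)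
      have eq: "x\<^sup>2 + y\<^sup>2 \<le> 1 \<longleftrightarrow> y \<in> {- sqrt (1 - x\<^sup>2)..sqrt (1 - x\<^sup>2)}" for y
      proof -
        have "x\<^sup>2 + y\<^sup>2 \<le> 1 \<longleftrightarrow> \<bar>y\<bar> \<le> sqrt (1 - x\<^sup>2)"
          using x1 real_le_rsqrt[of "\<bar>y\<bar>" "1 - x\<^sup>2"] real_sqrt_le_iff[of "y\<^sup>2" "1 - x\<^sup>2"] by auto
        then show ?thesis by auto
      qed
      have "(\<integral>\<^sup>+y. f x * indicator {p. (fst p)\<^sup>2 + (snd p)\<^sup>2 \<le> 1} (x, y) \<partial>lborel) = (\<integral>\<^sup>+y. f x * indicator {- sqrt (1 - x\<^sup>2)..sqrt (1 - x\<^sup>2)} y \<partial>lborel)"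
        by (intro nn_integral_cong) (use eq in \<open>auto simp: indicator_def\<close>)
      also have "\<dots> = f x * ennreal (2 * sqrt (1 - x\<^sup>2))"
        using x1 by (subst nn_integral_cmult_indicator) auto
      finally show ?thesis using True by simp
    next
      case False
      then have "x\<^sup>2 > 1" using abs_square_le_1[of x] by (auto simp: abs_le_iff not_le)
      then have "\<not> x\<^sup>2 + y\<^sup>2 \<le> 1" for y using zero_le_power2[of y] by linarith
      then show ?thesis using False by simp
    qed
  qed
  also have "\<dots> = (\<integral>\<^sup>+x. (f (- cos (2 * x)) * ennreal (2 * sqrt (1 - (- cos (2 * x))\<^sup>2))) * ennreal (2 * sin (2 * x)) * indicator {0..pi/2} x \<partial>lborel)"
  proof -
    have "(\<integral>\<^sup>+x. (f x * ennreal (2 * sqrt (1 - x\<^sup>2))) * indicator {- cos (2 * 0)..- cos (2 * (pi / 2))} x \<partial>lborel) =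
      (\<integral>\<^sup>+x. (f (- cos (2 * x)) * ennreal (2 * sqrt (1 - (- cos (2 * x))\<^sup>2))) * ennreal (2 * sin (2 * x)) * indicator {0..pi/2} x \<partial>lborel)"
    proof (rule nn_integral_substitution_aux)
      show "((\<lambda>x. - cos (2 * x)) has_real_derivative 2 * sin (2 * x)) (at x)" for x
        by (auto intro!: derivative_eq_intros)
      show "continuous_on {0..pi / 2} (\<lambda>x. 2 * sin (2 * x))" by (intro continuous_intros)
      show "0 \<le> 2 * sin (2 * x)" if "x \<in> {0..pi / 2}" for x using that by (auto intro!: sin_ge_zero)
    qed auto
    then show ?thesis by simp
  qed
  also have "\<dots> = (\<integral>\<^sup>+x. ennreal (2 * pi) * (f (- cos (2 * x)) * ennreal (semicircle_weight x) * indicator {0..pi/2} x) \<partial>lborel)"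
  proof (rule nn_integral_cong)
    fix x :: real
    show "(f (- cos (2 * x)) * ennreal (2 * sqrt (1 - (- cos (2 * x))\<^sup>2))) * ennreal (2 * sin (2 * x)) * indicator {0..pi/2} x =
      ennreal (2 * pi) * (f (- cos (2 * x)) * ennreal (semicircle_weight x) * indicator {0..pi/2} x)"
    proof (cases "x \<in> {0..pi/2}")
      case True
      then have s: "sin (2 * x) \<ge> 0" by (auto intro!: sin_ge_zero)
      have "1 - (- cos (2 * x))\<^sup>2 = (sin (2 * x))\<^sup>2" by (simp add: sin_squared_eq)
      then have "ennreal (2 * sqrt (1 - (- cos (2 * x))\<^sup>2)) * ennreal (2 * sin (2 * x)) = ennreal (2 * sin (2 * x) * (2 * sin (2 * x)))"
        using s by (simp only: real_sqrt_abs abs_of_nonneg) (rule ennreal_mult[symmetric]; simp)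
      also have "2 * sin (2 * x) * (2 * sin (2 * x)) = 2 * pi * semicircle_weight x" by (simp add: semicircle_weight_def power2_eq_square)
      also have "ennreal (2 * pi * semicircle_weight x) = ennreal (2 * pi) * ennreal (semicircle_weight x)" by (rule ennreal_mult) (auto simp: semicircle_weight_nonneg)
      finally show ?thesis using True by (simp add: mult_ac)
    qed simp
  qed
  also have "\<dots> = ennreal (2 * pi) * (\<integral>\<^sup>+x. f (- cos (2 * x)) * ennreal (semicircle_weight x) * indicator {0..pi/2} x \<partial>lborel)"
    by (rule nn_integral_cmult) measurable
  also have "\<dots> = ennreal pi * (\<integral>\<^sup>+x. f (- cos (2 * x)) * ennreal (semicircle_weight x) \<partial>angles)"
  proof -
    define G where "G x = f (- cos (2 * x)) * ennreal (semicircle_weight x)" for x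
    have [measurable]: "G \<in> borel_measurable borel" unfolding G_def[abs_def] by measurable
    have G: "G (pi - x) = G x" for x
    proof -
      have "2 * (pi - x) = 2 * pi - 2 * x" by simp
      then have "cos (2 * (pi - x)) = cos (2 * x)" "sin (2 * (pi - x)) = - sin (2 * x)" by (simp_all only: cos_2pi_minus sin_2pi_minus)
      then show ?thesis by (simp add: semicircle_weight_def G_def)
    qed
    have "(\<integral>\<^sup>+x. G x * indicator {pi/2..pi} x \<partial>lborel) = (\<integral>\<^sup>+x. G x * indicator {0..pi/2} x \<partial>lborel)"
      by (subst nn_integral_real_affine[where c="-1" and t=pi])
         (auto intro!: nn_integral_cong simp: indicator_def G)
    moreover have "(\<integral>\<^sup>+x. G x \<partial>angles) = (\<integral>\<^sup>+x. G x * indicator {0..pi/2} x + G x * indicator {pi/2..pi} x \<partial>lborel)"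
    proof -
      have "AE x in lborel. x \<noteq> pi / 2" by (rule AE_lborel_singleton)
      then have "AE x in lborel. G x * indicator {0..pi} x = G x * indicator {0..pi/2} x + G x * indicator {pi/2..pi} x"
        by eventually_elim (auto simp: indicator_def)
      then show ?thesis by (subst nn_integral_angles) (auto intro: nn_integral_cong_AE)
    qed
    ultimately have "(\<integral>\<^sup>+x. G x \<partial>angles) = 2 * (\<integral>\<^sup>+x. G x * indicator {0..pi/2} x \<partial>lborel)"
      by (subst (asm) nn_integral_add) (auto simp: mult_2)
    moreover have "ennreal (2 * pi) = ennreal pi * 2" by (simp add: ennreal_mult mult.commute)
    ultimately show ?thesis unfolding G_def by (simp add: mult.assoc)
  qed
  also have "(\<integral>\<^sup>+x. f (- cos (2 * x)) * ennreal (semicircle_weight x) \<partial>angles) = (\<integral>\<^sup>+x. f (cos (2 * x)) * ennreal (semicircle_weight x) \<partial>angles)"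
  proof -
    let ?G = "\<lambda>x. f (cos (2 * x)) * ennreal (semicircle_weight x)"
    have "?G (pi / 2 - x) = f (- cos (2 * x)) * ennreal (semicircle_weight x)" for x
    proof -
      have "2 * (pi / 2 - x) = pi - 2 * x" by simp
      then have "cos (2 * (pi / 2 - x)) = - cos (2 * x)" "sin (2 * (pi / 2 - x)) = sin (2 * x)" by (simp_all only: cos_pi_minus sin_pi_minus)
      then show ?thesis by (simp add: semicircle_weight_def)
    qed
    moreover have "(\<integral>\<^sup>+x. ?G (pi / 2 - x) \<partial>angles) = (\<integral>\<^sup>+x. ?G x \<partial>angles)"
    proof (rule nn_integral_angles_periodic_reflect)
      show "?G (x + pi) = ?G x" for x
      proof -
        have "cos (2 * (x + pi)) = cos (2 * x)" by (simp add: distrib_left)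
        then show ?thesis by (simp add: semicircle_weight_periodic)
      qed
    qed measurable
    ultimately show ?thesis by simp
  qed
  finally show ?thesis .
qed

lemma mem_ellipse:
  "z \<in> ellipse a b \<phi> \<longleftrightarrow> (Re (z * cis (- \<phi>)))\<^sup>2 / a\<^sup>2 + (Im (z * cis (- \<phi>)))\<^sup>2 / b\<^sup>2 \<le> 1"
proof -
  have e: "exp (\<i> * complex_of_real \<phi>) = cis \<phi>" by (simp add: cis_conv_exp)
  have c: "cis \<phi> * (z * cis (- \<phi>)) = z" "cis \<phi> * w * cis (- \<phi>) = w" for z w
    by (simp_all add: mult.assoc mult.left_commute[of "cis \<phi>"] cis_mult del: cis.simps)
  show ?thesis
  proof
    assume "z \<in> ellipse a b \<phi>"
    then obtain w where "z = cis \<phi> * w" "(Re w)\<^sup>2 / a\<^sup>2 + (Im w)\<^sup>2 / b\<^sup>2 \<le> 1" by (auto simp: ellipse_def e)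
    then show "(Re (z * cis (- \<phi>)))\<^sup>2 / a\<^sup>2 + (Im (z * cis (- \<phi>)))\<^sup>2 / b\<^sup>2 \<le> 1" by (simp only: c(2))
  next
    assume *: "(Re (z * cis (- \<phi>)))\<^sup>2 / a\<^sup>2 + (Im (z * cis (- \<phi>)))\<^sup>2 / b\<^sup>2 \<le> 1"
    show "z \<in> ellipse a b \<phi>"
      unfolding ellipse_def e using * c(1)[of z] by (intro image_eqI[of _ _ "z * cis (- \<phi>)"]) simp_all
  qed
qed

text \<open>
  Half of the width of \<open>ellipse a b \<phi>\<close> perpendicular to the direction \<open>t\<close>.
\<close>

definition width :: "real \<Rightarrow> real \<Rightarrow> real \<Rightarrow> real \<Rightarrow> real" where
  "width a b \<phi> t = sqrt ((a * sin (\<phi> - t))\<^sup>2 + (b * cos (\<phi> - t))\<^sup>2)"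

lemma ellipse_measurable [measurable]: "ellipse a b \<phi> \<in> sets borel"
proof -
  have "ellipse a b \<phi> = {z \<in> space borel. (Re (z * cis (- \<phi>)))\<^sup>2 / a\<^sup>2 + (Im (z * cis (- \<phi>)))\<^sup>2 / b\<^sup>2 \<le> 1}"
    using mem_ellipse by auto
  then show ?thesis by simp
qed

lemma width_pos: assumes "0 < a" "0 < b" shows "0 < width a b \<phi> t"
proof -
  have "sin (\<phi> - t) \<noteq> 0 \<or> cos (\<phi> - t) \<noteq> 0" by (metis sin_cos_squared_add add_0 power_zero_numeral zero_neq_one)
  then have "0 < (a * sin (\<phi> - t))\<^sup>2 + (b * cos (\<phi> - t))\<^sup>2"
    using assms by (auto simp: sum_power2_gt_zero_iff)
  then show ?thesis by (simp add: width_def)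
qed

text \<open>
  Among the linear parametrisations of the ellipse by the unit disc, which differ by rotations of the
  disc, there is one in which \<open>Im (z * cis (- t))\<close> becomes the first coordinate times the half-width.
\<close>

lemma ellipse_nn_integral_projection:
  fixes f :: "real \<Rightarrow> ennreal"
  assumes [measurable]: "f \<in> borel_measurable borel" and a: "0 < a" and b: "0 < b"
  shows "(\<integral>\<^sup>+z. f (Im (z * cis (- t))) * indicator (ellipse a b \<phi>) z \<partial>lborel) =
    ennreal (a * b * pi) * (\<integral>\<^sup>+x. f (width a b \<phi> t * cos (2 * x)) * ennreal (semicircle_weight x) \<partial>angles)"
proof -
  define R where "R = width a b \<phi> t"
  have R: "R > 0" unfolding R_def using a b by (rule width_pos)
  have R2: "R\<^sup>2 = (a * sin (\<phi> - t))\<^sup>2 + (b * cos (\<phi> - t))\<^sup>2"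
    unfolding R_def width_def by simp
  \<comment> \<open>The cosine and the sine of the angle of that rotation.\<close>
  define p where "p = a * sin (\<phi> - t) / R"
  define q where "q = b * cos (\<phi> - t) / R"
  have pR: "a * sin (\<phi> - t) = R * p" and qR: "b * cos (\<phi> - t) = R * q" using R by (simp_all add: p_def q_def)
  have pq: "p\<^sup>2 + q\<^sup>2 = 1"
  proof -
    have "R\<^sup>2 * (p\<^sup>2 + q\<^sup>2) = R\<^sup>2 * 1" using R2 unfolding pR qR by (simp add: power_mult_distrib distrib_left)
    then show ?thesis using R by simp
  qed
  define A where "A = a * p * cos \<phi> - b * q * sin \<phi>"
  define B where "B = - (a * q * cos \<phi>) - b * p * sin \<phi>"
  define C where "C = a * p * sin \<phi> + b * q * cos \<phi>"
  define D where "D = - (a * q * sin \<phi>) + b * p * cos \<phi>"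
  have det: "A * D - B * C = a * b"
  proof -
    have "(a * p * c - b * q * s) * (- (a * q * s) + b * p * c) - (- (a * q * c) - b * p * s) * (a * p * s + b * q * c)
      = a * b * (p\<^sup>2 + q\<^sup>2) * (s\<^sup>2 + c\<^sup>2)" for s c
      by (simp add: algebra_simps power2_eq_square)
    from this[of "cos \<phi>" "sin \<phi>"] show ?thesis unfolding A_def B_def C_def D_def by (simp add: pq)
  qed
  have T: "Complex (A * x + B * y) (C * x + D * y) = Complex (a * (p * x - q * y)) (b * (q * x + p * y)) * cis \<phi>" for x y
    unfolding A_def B_def C_def D_def by (simp add: complex_eq_iff algebra_simps)
  have T1: "Complex (A * x + B * y) (C * x + D * y) * cis (- \<phi>) = Complex (a * (p * x - q * y)) (b * (q * x + p * y))" for x y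
    unfolding T by (simp add: mult.assoc cis_mult del: cis.simps)
  have memT: "Complex (A * x + B * y) (C * x + D * y) \<in> ellipse a b \<phi> \<longleftrightarrow> x\<^sup>2 + y\<^sup>2 \<le> 1" for x y
  proof -
    have "(p * x - q * y)\<^sup>2 + (q * x + p * y)\<^sup>2 = (p\<^sup>2 + q\<^sup>2) * (x\<^sup>2 + y\<^sup>2)" by (simp add: algebra_simps power2_eq_square)
    then show ?thesis unfolding mem_ellipse T1 using a b by (simp add: power_mult_distrib pq)
  qed
  have ImT: "Im (Complex (A * x + B * y) (C * x + D * y) * cis (- t)) = R * x" for x y
  proof -
    have "Complex (A * x + B * y) (C * x + D * y) * cis (- t) = Complex (a * (p * x - q * y)) (b * (q * x + p * y)) * cis (\<phi> - t)"
      unfolding T by (simp add: mult.assoc cis_mult del: cis.simps)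
    then have "Im (Complex (A * x + B * y) (C * x + D * y) * cis (- t)) = (a * sin (\<phi> - t)) * (p * x - q * y) + (b * cos (\<phi> - t)) * (q * x + p * y)"
      by (simp add: algebra_simps)
    also have "\<dots> = R * x * (p\<^sup>2 + q\<^sup>2)" unfolding pR qR by (simp add: algebra_simps power2_eq_square)
    finally show ?thesis by (simp add: pq)
  qed
  have "(\<integral>\<^sup>+z. f (Im (z * cis (- t))) * indicator (ellipse a b \<phi>) z \<partial>lborel) =
     (\<integral>\<^sup>+x. \<integral>\<^sup>+y. f (Im (Complex x y * cis (- t))) * indicator (ellipse a b \<phi>) (Complex x y) \<partial>lborel \<partial>lborel)"
    by (rule nn_integral_lborel_complex) measurable
  also have "\<dots> = ennreal \<bar>A * D - B * C\<bar> * (\<integral>\<^sup>+x. \<integral>\<^sup>+y. f (Im (Complex (A * x + B * y) (C * x + D * y) * cis (- t))) * indicator (ellipse a b \<phi>) (Complex (A * x + B * y) (C * x + D * y)) \<partial>lborel \<partial>lborel)"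
    by (rule nn_integral_linear) (use a b in \<open>auto simp: det\<close>)
  also have "\<dots> = ennreal (a * b) * (\<integral>\<^sup>+x. \<integral>\<^sup>+y. f (R * x) * indicator {p. (fst p)\<^sup>2 + (snd p)\<^sup>2 \<le> 1} (x, y) \<partial>lborel \<partial>lborel)"
    unfolding ImT det using a b by (simp add: indicator_def memT cong: if_cong)
  also have "(\<integral>\<^sup>+x. \<integral>\<^sup>+y. f (R * x) * indicator {p. (fst p)\<^sup>2 + (snd p)\<^sup>2 \<le> 1} (x, y) \<partial>lborel \<partial>lborel) =
     ennreal pi * (\<integral>\<^sup>+x. f (R * cos (2 * x)) * ennreal (semicircle_weight x) \<partial>angles)"
    by (rule nn_integral_disc[of "\<lambda>x. f (R * x)"]) measurable
  finally show ?thesis using a b by (simp add: R_def ennreal_mult mult.assoc)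
qed

lemma emeasure_ellipse:
  assumes "0 < a" "0 < b" shows "emeasure lborel (ellipse a b \<phi>) = ennreal (a * b * pi)"
proof -
  have "(\<integral>\<^sup>+x. ennreal (semicircle_weight x) \<partial>angles) = 1"
    using nn_integral_eq_integral[OF integrable_semicircle_weight] by (simp add: semicircle_weight_nonneg integral_semicircle_weight)
  then show ?thesis
    using ellipse_nn_integral_projection[of "\<lambda>_. 1" a b 0 \<phi>] assms by simp
qed

abbreviation "unif a b \<phi> \<equiv> uniform_measure lborel (ellipse a b \<phi>)"

lemma prob_space_unif: assumes "0 < a" "0 < b" shows "prob_space (unif a b \<phi>)"
proof (rule prob_space_uniform_measure)
  have "a * b * pi > 0" using assms by simp
  then show "emeasure lborel (ellipse a b \<phi>) \<noteq> 0" "emeasure lborel (ellipse a b \<phi>) \<noteq> \<infinity>"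
    unfolding emeasure_ellipse[OF assms] by (simp_all add: ennreal_eq_0_iff not_le del: zero_less_mult_iff)
qed

theorem ellipse_projection:
  fixes f :: "real \<Rightarrow> ennreal"
  assumes [measurable]: "f \<in> borel_measurable borel" and a: "0 < a" and b: "0 < b"
  shows "(\<integral>\<^sup>+z. f (Im (z * cis (- t))) \<partial>unif a b \<phi>) = (\<integral>\<^sup>+x. f (width a b \<phi> t * cos (2 * x)) * ennreal (semicircle_weight x) \<partial>angles)"
proof -
  have "(\<integral>\<^sup>+z. f (Im (z * cis (- t))) \<partial>unif a b \<phi>) = (\<integral>\<^sup>+z. f (Im (z * cis (- t))) * indicator (ellipse a b \<phi>) z \<partial>lborel) / emeasure lborel (ellipse a b \<phi>)"
    by (rule nn_integral_uniform_measure) measurable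
  also have "\<dots> = ennreal (a * b * pi) * (\<integral>\<^sup>+x. f (width a b \<phi> t * cos (2 * x)) * ennreal (semicircle_weight x) \<partial>angles) / ennreal (a * b * pi)"
    by (simp only: ellipse_nn_integral_projection[OF assms] emeasure_ellipse[OF a b])
  also have "\<dots> = (\<integral>\<^sup>+x. f (width a b \<phi> t * cos (2 * x)) * ennreal (semicircle_weight x) \<partial>angles)"
  proof (subst mult.commute, rule ennreal_mult_divide_eq)
    have "a * b * pi > 0" using a b by simp
    then show "ennreal (a * b * pi) \<noteq> 0" by (simp add: ennreal_eq_0_iff not_le del: zero_less_mult_iff)
  qed simp
  finally show ?thesis .
qed

lemma ellipse_width:
  assumes a: "0 < a" and b: "0 < b" and z: "z \<in> ellipse a b \<phi>" shows "\<bar>Im (z * cis (- t))\<bar> \<le> width a b \<phi> t"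
proof -
  define X where "X = Re (z * cis (- \<phi>)) / a"
  define Y where "Y = Im (z * cis (- \<phi>)) / b"
  have XY: "X\<^sup>2 + Y\<^sup>2 \<le> 1" using z unfolding mem_ellipse X_def Y_def by (simp add: power_divide)
  have "z * cis (- t) = (z * cis (- \<phi>)) * cis (\<phi> - t)" by (simp add: mult.assoc cis_mult del: cis.simps)
  then have "Im (z * cis (- t)) = Re (z * cis (- \<phi>)) * sin (\<phi> - t) + Im (z * cis (- \<phi>)) * cos (\<phi> - t)"
    by (simp only: times_complex.sel cis.sel) 
  also have "\<dots> = X * (a * sin (\<phi> - t)) + Y * (b * cos (\<phi> - t))" using a b by (simp add: X_def Y_def)
  finally have eq: "Im (z * cis (- t)) = X * (a * sin (\<phi> - t)) + Y * (b * cos (\<phi> - t))" .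
  let ?u = "a * sin (\<phi> - t)" and ?v = "b * cos (\<phi> - t)"
  have "(X * ?u + Y * ?v)\<^sup>2 \<le> (X * ?u + Y * ?v)\<^sup>2 + (X * ?v - Y * ?u)\<^sup>2" by simp
  also have "\<dots> = (X\<^sup>2 + Y\<^sup>2) * (?u\<^sup>2 + ?v\<^sup>2)" by (simp add: algebra_simps power2_eq_square)
  also have "\<dots> \<le> 1 * (?u\<^sup>2 + ?v\<^sup>2)" by (rule mult_right_mono[OF XY]) simp
  finally have "(Im (z * cis (- t)))\<^sup>2 \<le> ?u\<^sup>2 + ?v\<^sup>2" unfolding eq by simp
  then have "\<bar>Im (z * cis (- t))\<bar>\<^sup>2 \<le> ?u\<^sup>2 + ?v\<^sup>2" by (simp only: power2_abs)
  then show ?thesis unfolding width_def by (rule real_le_rsqrt)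
qed

lemma ellipse_bounded:
  assumes "0 < a" "a \<le> r" "0 < b" "b \<le> r" and z: "z \<in> ellipse a b \<phi>" shows "norm z \<le> r"
proof -
  let ?u = "z * cis (- \<phi>)"
  have "(Re ?u)\<^sup>2 / r\<^sup>2 + (Im ?u)\<^sup>2 / r\<^sup>2 \<le> (Re ?u)\<^sup>2 / a\<^sup>2 + (Im ?u)\<^sup>2 / b\<^sup>2"
    using assms by (intro add_mono divide_left_mono power_mono) auto
  also have "\<dots> \<le> 1" using z unfolding mem_ellipse .
  finally have "((Re ?u)\<^sup>2 + (Im ?u)\<^sup>2) / r\<^sup>2 \<le> 1" by (simp only: add_divide_distrib)
  then have "(norm ?u)\<^sup>2 \<le> r\<^sup>2" unfolding cmod_power2 using assms(1,2) by (simp only: divide_le_eq zero_less_power split: if_splits) auto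
  then have "norm ?u \<le> r" by (rule power2_le_imp_le) (use assms in linarith)
  moreover have "norm ?u = norm z" unfolding norm_mult by simp
  ultimately show ?thesis by linarith
qed

lemma width_le: assumes "0 < a" "a \<le> r" "0 < b" "b \<le> r" shows "width a b \<phi> t \<le> r"
proof -
  have "(a * sin (\<phi> - t))\<^sup>2 + (b * cos (\<phi> - t))\<^sup>2 \<le> r\<^sup>2 * (sin (\<phi> - t))\<^sup>2 + r\<^sup>2 * (cos (\<phi> - t))\<^sup>2"
    unfolding power_mult_distrib using assms by (intro add_mono mult_right_mono power_mono) auto
  also have "\<dots> = r\<^sup>2" unfolding distrib_left[symmetric] by simp
  finally show ?thesis unfolding width_def using assms(1,2) by (simp add: real_le_lsqrt)
qed

section \<open>The potential of the ellipse\<close>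

lemma cis_measurable [measurable]: "cis \<in> borel_measurable borel"
proof -
  have "isCont cis t" for t using has_vector_derivative_cis by (rule has_vector_derivative_continuous)
  then have "continuous_on UNIV cis" by (simp add: continuous_at_imp_continuous_on)
  then show ?thesis by (rule borel_measurable_continuous_onI)
qed

lemma semicircle_pot_measurable [measurable]: "semicircle_pot \<in> borel_measurable borel"
  unfolding semicircle_pot_def[abs_def] by measurable

lemma width_measurable [measurable]: "width a b \<phi> \<in> borel_measurable borel"
  unfolding width_def[abs_def] by measurable

lemma width_ge: assumes "0 \<le> r" "r \<le> a" "r \<le> b" shows "r \<le> width a b \<phi> t"
proof -
  have "r\<^sup>2 = r\<^sup>2 * (sin (\<phi> - t))\<^sup>2 + r\<^sup>2 * (cos (\<phi> - t))\<^sup>2" unfolding distrib_left[symmetric] by simp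
  also have "\<dots> \<le> (a * sin (\<phi> - t))\<^sup>2 + (b * cos (\<phi> - t))\<^sup>2"
    unfolding power_mult_distrib using assms by (intro add_mono mult_right_mono power_mono) auto
  finally show ?thesis unfolding width_def by (rule real_le_rsqrt)
qed

lemma abs_Im_cis_le: "\<bar>Im (z * cis t)\<bar> \<le> norm z"
  using abs_Im_le_cmod[of "z * cis t"] by (simp add: norm_mult)

lemma AE_cos_double_neq: "AE x in angles. y \<noteq> cos (2 * x)"
proof (cases "\<bar>y\<bar> \<le> 1")
  case True
  define a where "a = arccos y / 2"
  have y: "y = cos (2 * a)" unfolding a_def using True by (simp add: cos_arccos abs_le_iff)
  show ?thesis
    using AE_sin_add_diff_nonzero[of a]
  proof eventually_elim
    case (elim x)
    then have "cos (2 * a) - cos (2 * x) \<noteq> 0" unfolding cos_double_diff by simp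
    then show ?case using y by simp
  qed
next
  case False
  then show ?thesis using abs_cos_le_one by (intro AE_I2) metis
qed

lemma AE_unif_mem: "AE w in unif a b \<phi>. w \<in> ellipse a b \<phi>"
  by (rule AE_uniform_measureI) auto

lemma AE_unif_neq: "AE w in unif a b \<phi>. w \<noteq> z"
  by (rule AE_uniform_measureI) (use AE_lborel_singleton[of z] in auto)

text \<open>
  An interaction that is an average of one-dimensional logarithmic potentials with a positive
  density over the directions.
\<close>

locale projected_kernel =
  fixes \<kappa> :: "complex \<Rightarrow> real" and g :: "real \<Rightarrow> real" and c0 :: real
  assumes \<kappa>_measurable [measurable]: "\<kappa> \<in> borel_measurable borel"
    and g_measurable [measurable]: "g \<in> borel_measurable borel"
    and g_pos: "\<And>t. 0 < g t" and g_le: "\<And>t. g t \<le> 1" and integral_g: "(\<integral>t. g t \<partial>angles) = 1"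
    and integrable_log: "\<And>z. z \<noteq> 0 \<Longrightarrow> integrable angles (\<lambda>t. g t * ln \<bar>Im (z * cis (- t))\<bar>)"
    and integral_log: "\<And>z. z \<noteq> 0 \<Longrightarrow> (\<integral>t. g t * ln \<bar>Im (z * cis (- t))\<bar> \<partial>angles) = ln (norm z) - \<kappa> z + c0"
begin

definition pair_potential :: "complex \<Rightarrow> real" where "pair_potential z = - ln (norm z) + \<kappa> z"

lemma pair_potential_measurable [measurable]: "pair_potential \<in> borel_measurable borel"
  unfolding pair_potential_def[abs_def] by measurable

lemma integrable_g_mult:
  assumes [measurable]: "f \<in> borel_measurable borel" and "\<And>t. \<bar>f t\<bar> \<le> K"
  shows "integrable angles (\<lambda>t. g t * f t)"
proof (rule integrable_mult_bounded)
  show "integrable angles g"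
    by (rule angles.integrable_const_bound[where B=1]) (use g_pos g_le in \<open>auto simp: abs_of_pos\<close>)
qed (use assms in auto)

lemma integrable_g: "integrable angles g"
  using integrable_g_mult[of "\<lambda>_. 1" 1] by simp

text \<open>
  The constant \<open>ln K\<close> makes the integrand nonnegative, so that Tonelli's theorem applies to it in
  \<open>ellipse_potential\<close>.
\<close>

lemma nn_integral_log_kernel:
  assumes z: "z \<noteq> 0" and K: "norm z \<le> K" "1 \<le> K"
  shows "(\<integral>\<^sup>+t. ennreal (g t * (ln K - ln \<bar>Im (z * cis (- t))\<bar>)) \<partial>angles) = ennreal (ln K + pair_potential z - c0)"
    "0 \<le> ln K + pair_potential z - c0"
proof -
  have i: "integrable angles (\<lambda>t. g t * (ln K - ln \<bar>Im (z * cis (- t))\<bar>))"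
    unfolding right_diff_distrib using integrable_log[OF z] integrable_g by simp
  have n: "0 \<le> g t * (ln K - ln \<bar>Im (z * cis (- t))\<bar>)" for t
  proof (rule mult_nonneg_nonneg)
    show "0 \<le> ln K - ln \<bar>Im (z * cis (- t))\<bar>"
    proof (cases "Im (z * cis (- t)) = 0")
      case False
      have "\<bar>Im (z * cis (- t))\<bar> \<le> K" using abs_Im_cis_le[of z "- t"] K by linarith
      then have "ln \<bar>Im (z * cis (- t))\<bar> \<le> ln K" using False by (intro ln_mono) auto
      then show ?thesis by simp
    qed (use K in simp)
  qed (use g_pos[of t] in simp)
  have "(\<integral>t. g t * (ln K - ln \<bar>Im (z * cis (- t))\<bar>) \<partial>angles) = ln K - (ln (norm z) - \<kappa> z + c0)"
    unfolding right_diff_distrib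
    by (subst Bochner_Integration.integral_diff) (use integrable_log[OF z] integrable_g integral_log[OF z] integral_g in auto)
  then have e: "(\<integral>t. g t * (ln K - ln \<bar>Im (z * cis (- t))\<bar>) \<partial>angles) = ln K + pair_potential z - c0" by (simp add: pair_potential_def)
  show "(\<integral>\<^sup>+t. ennreal (g t * (ln K - ln \<bar>Im (z * cis (- t))\<bar>)) \<partial>angles) = ennreal (ln K + pair_potential z - c0)"
    using nn_integral_eq_integral[OF i] n e by simp
  show "0 \<le> ln K + pair_potential z - c0" unfolding e[symmetric] using n by (intro Bochner_Integration.integral_nonneg) auto
qed

lemma projected_semicircle:
  assumes R: "0 < R" "\<bar>x\<bar> + R \<le> K" "1 \<le> K"
  shows "(\<integral>\<^sup>+s. ennreal (g t * (ln K - ln \<bar>x - R * cos (2 * s)\<bar>)) * ennreal (semicircle_weight s) \<partial>angles) = ennreal (g t * (ln K - ln R + semicircle_pot (x / R)))"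
    "0 \<le> g t * (ln K - ln R + semicircle_pot (x / R))"
proof -
  let ?y = "x / R"
  let ?F = "\<lambda>s. g t * (ln K - ln \<bar>x - R * cos (2 * s)\<bar>) * semicircle_weight s"
  let ?G = "\<lambda>s. g t * ((ln K - ln R) * semicircle_weight s + - ln \<bar>?y - cos (2 * s)\<bar> * semicircle_weight s)"
  have n: "0 \<le> g t * (ln K - ln \<bar>x - R * cos (2 * s)\<bar>)" for s
  proof (rule mult_nonneg_nonneg)
    show "0 \<le> ln K - ln \<bar>x - R * cos (2 * s)\<bar>"
    proof (cases "x - R * cos (2 * s) = 0")
      case False
      have "\<bar>R * cos (2 * s)\<bar> \<le> R * 1" unfolding abs_mult using R(1) by (intro mult_mono) auto
      then have "\<bar>x - R * cos (2 * s)\<bar> \<le> K" using R(2) by linarith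
      then have "ln \<bar>x - R * cos (2 * s)\<bar> \<le> ln K" using False by (intro ln_mono) auto
      then show ?thesis by simp
    qed (use R in simp)
  qed (use g_pos[of t] in simp)
  have iG: "integrable angles ?G"
    using semicircle_potential(1)[of ?y] integrable_semicircle_weight by (intro integrable_mult_right Bochner_Integration.integrable_add) auto
  have ae: "AE s in angles. ?F s = ?G s"
    using AE_cos_double_neq[of ?y]
  proof eventually_elim
    case (elim s)
    have "x - R * cos (2 * s) = R * (?y - cos (2 * s))" using R(1) by (simp add: field_simps)
    moreover have "ln \<bar>R * (?y - cos (2 * s))\<bar> = ln R + ln \<bar>?y - cos (2 * s)\<bar>"
      using R(1) elim unfolding abs_mult by (subst ln_mult_pos) auto
    ultimately have e: "ln \<bar>x - R * cos (2 * s)\<bar> = ln R + ln \<bar>?y - cos (2 * s)\<bar>" by (simp only:)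
    show ?case unfolding e by (simp add: algebra_simps)
  qed
  have iF: "integrable angles ?F" by (subst integrable_cong_AE[OF _ _ ae]) (use iG in auto)
  have "(\<integral>s. ?F s \<partial>angles) = (\<integral>s. ?G s \<partial>angles)" by (rule integral_cong_AE[OF _ _ ae]) auto
  also have "\<dots> = g t * ((\<integral>s. (ln K - ln R) * semicircle_weight s \<partial>angles) + semicircle_pot ?y)"
    unfolding semicircle_pot_def using semicircle_potential(1)[of ?y] integrable_semicircle_weight
    by (subst integral_mult_right_zero, subst Bochner_Integration.integral_add) auto
  also have "(\<integral>s. (ln K - ln R) * semicircle_weight s \<partial>angles) = ln K - ln R" by (simp add: integral_semicircle_weight)
  finally have e: "(\<integral>s. ?F s \<partial>angles) = g t * (ln K - ln R + semicircle_pot ?y)" .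
  have nF: "0 \<le> ?F s" for s using n[of s] semicircle_weight_nonneg[of s] by simp
  have "(\<integral>\<^sup>+s. ennreal (g t * (ln K - ln \<bar>x - R * cos (2 * s)\<bar>)) * ennreal (semicircle_weight s) \<partial>angles) = (\<integral>\<^sup>+s. ennreal (?F s) \<partial>angles)"
    using n semicircle_weight_nonneg by (intro nn_integral_cong) (simp add: ennreal_mult[symmetric])
  also have "\<dots> = ennreal (\<integral>s. ?F s \<partial>angles)" by (rule nn_integral_eq_integral[OF iF]) (use nF in auto)
  finally show "(\<integral>\<^sup>+s. ennreal (g t * (ln K - ln \<bar>x - R * cos (2 * s)\<bar>)) * ennreal (semicircle_weight s) \<partial>angles) = ennreal (g t * (ln K - ln R + semicircle_pot (x / R)))"
    unfolding e .
  show "0 \<le> g t * (ln K - ln R + semicircle_pot (x / R))" unfolding e[symmetric] using nF by (intro Bochner_Integration.integral_nonneg) auto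
qed

lemma integrable_projected_potential:
  assumes a: "0 < a" "a \<le> 2" and b: "0 < b" "b \<le> 2"
  shows "integrable angles (\<lambda>t. g t * (semicircle_pot (Im (z * cis (- t)) / width a b \<phi> t) - ln (width a b \<phi> t)))" (is ?A)
    "integrable angles (\<lambda>t. g t * ln (width a b \<phi> t))" (is ?K)
    "integrable angles (\<lambda>t. g t * ((Im (z * cis (- t)))\<^sup>2 / (width a b \<phi> t)\<^sup>2))" (is ?C)
proof -
  define r where "r = min a b"
  have r: "0 < r" "r \<le> a" "r \<le> b" using a b by (auto simp: r_def)
  have w: "r \<le> width a b \<phi> t" "width a b \<phi> t \<le> 2" for t
    using width_ge[of r a b] width_le[of a 2 b] r a b by auto
  have lw: "\<bar>ln (width a b \<phi> t)\<bar> \<le> \<bar>ln r\<bar> + ln 2" for t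
  proof -
    have "ln r \<le> ln (width a b \<phi> t)" "ln (width a b \<phi> t) \<le> ln 2"
      using w[of t] r by (auto intro!: ln_mono)
    moreover have "0 \<le> ln (2::real)" by simp
    ultimately show ?thesis by linarith
  qed
  have q: "\<bar>(Im (z * cis (- t)))\<^sup>2 / (width a b \<phi> t)\<^sup>2\<bar> \<le> (norm z)\<^sup>2 / r\<^sup>2" for t
  proof -
    have "\<bar>Im (z * cis (- t))\<bar>\<^sup>2 \<le> (norm z)\<^sup>2" by (rule power_mono[OF abs_Im_cis_le]) simp
    moreover have "r\<^sup>2 \<le> (width a b \<phi> t)\<^sup>2" using w[of t] r by (intro power_mono) auto
    ultimately have "(Im (z * cis (- t)))\<^sup>2 / (width a b \<phi> t)\<^sup>2 \<le> (norm z)\<^sup>2 / r\<^sup>2"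
      using r(1) unfolding power2_abs by (intro frac_le) auto
    then show ?thesis by simp
  qed
  have s: "\<bar>semicircle_pot (Im (z * cis (- t)) / width a b \<phi> t)\<bar> \<le> \<bar>semicircle_const\<bar> + (norm z)\<^sup>2 / r\<^sup>2" for t
    using semicircle_potential(3,4)[of "Im (z * cis (- t)) / width a b \<phi> t"] q[of t] unfolding power_divide by linarith
  show ?C by (rule integrable_g_mult[OF _ q]) measurable
  show ?K by (rule integrable_g_mult[OF _ lw]) measurable
  show ?A
  proof (rule integrable_g_mult)
    show "\<bar>semicircle_pot (Im (z * cis (- t)) / width a b \<phi> t) - ln (width a b \<phi> t)\<bar> \<le> \<bar>semicircle_const\<bar> + (norm z)\<^sup>2 / r\<^sup>2 + (\<bar>ln r\<bar> + ln 2)" for t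
      using s[of t] lw[of t] by linarith
  qed measurable
qed

text \<open>
  Tonelli exchanges the average over directions and the integral over the ellipse; for a fixed
  direction the inner integral is the potential of a semicircle law with radius \<open>width a b \<phi> t\<close>.
\<close>

theorem ellipse_potential:
  assumes a: "0 < a" "a \<le> 2" and b: "0 < b" "b \<le> 2"
  shows "integrable (unif a b \<phi>) (\<lambda>w. pair_potential (z - w))"
    "(\<integral>w. pair_potential (z - w) \<partial>unif a b \<phi>) = c0 + (\<integral>t. g t * (semicircle_pot (Im (z * cis (- t)) / width a b \<phi> t) - ln (width a b \<phi> t)) \<partial>angles)"
proof -
  interpret m: prob_space "unif a b \<phi>" by (rule prob_space_unif[OF a(1) b(1)])
  interpret P: pair_sigma_finite "unif a b \<phi>" angles by unfold_locales
  define K where "K = norm z + 2"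
  have K1: "1 \<le> K" unfolding K_def using norm_ge_zero[of z] by linarith
  define x where "x t = Im (z * cis (- t))" for t
  define R where "R t = width a b \<phi> t" for t
  have R: "0 < R t" "R t \<le> 2" for t using width_pos[OF a(1) b(1)] width_le[OF a b] by (auto simp: R_def)
  have xR: "\<bar>x t\<bar> + R t \<le> K" for t using abs_Im_cis_le[of z "- t"] R[of t] by (simp add: x_def K_def)
  let ?J = "\<integral>t. g t * (semicircle_pot (x t / R t) - ln (R t)) \<partial>angles"
  have split: "(\<integral>t. ln K * g t + g t * (semicircle_pot (x t / R t) - ln (R t)) \<partial>angles) = ln K + ?J"
  proof -
    have i1: "integrable angles (\<lambda>t. ln K * g t)" by (intro integrable_mult_right integrable_g)
    have i2: "integrable angles (\<lambda>t. g t * (semicircle_pot (x t / R t) - ln (R t)))"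
      unfolding x_def R_def by (rule integrable_projected_potential(1)[OF a b])
    show ?thesis unfolding Bochner_Integration.integral_add[OF i1 i2] by (simp add: integral_g)
  qed
  have AE: "AE w in unif a b \<phi>. z - w \<noteq> 0 \<and> norm (z - w) \<le> K"
    using AE_unif_mem[of a b \<phi>] AE_unif_neq[of z a b \<phi>]
  proof eventually_elim
    case (elim w)
    have "norm w \<le> 2" using ellipse_bounded[OF a b elim(1)] .
    then show ?case using elim(2) norm_triangle_ineq4[of z w] by (simp add: K_def)
  qed
  have AEn: "AE w in unif a b \<phi>. 0 \<le> ln K + pair_potential (z - w) - c0"
    using AE by eventually_elim (use nn_integral_log_kernel(2) K1 in blast)
  have "(\<integral>\<^sup>+w. ennreal (ln K + pair_potential (z - w) - c0) \<partial>unif a b \<phi>) =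
    (\<integral>\<^sup>+w. \<integral>\<^sup>+t. ennreal (g t * (ln K - ln \<bar>Im ((z - w) * cis (- t))\<bar>)) \<partial>angles \<partial>unif a b \<phi>)"
  proof (rule nn_integral_cong_AE)
    show "AE w in unif a b \<phi>. ennreal (ln K + pair_potential (z - w) - c0) =
        (\<integral>\<^sup>+t. ennreal (g t * (ln K - ln \<bar>Im ((z - w) * cis (- t))\<bar>)) \<partial>angles)"
      using AE by eventually_elim (rule nn_integral_log_kernel(1)[symmetric, OF _ _ K1], auto)
  qed
  also have "\<dots> = (\<integral>\<^sup>+t. \<integral>\<^sup>+w. ennreal (g t * (ln K - ln \<bar>Im ((z - w) * cis (- t))\<bar>)) \<partial>unif a b \<phi> \<partial>angles)"
    by (rule P.Fubini'[symmetric]) measurable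
  also have "\<dots> = (\<integral>\<^sup>+t. ennreal (g t * (ln K - ln (R t) + semicircle_pot (x t / R t))) \<partial>angles)"
  proof (rule nn_integral_cong)
    fix t
    have "Im ((z - w) * cis (- t)) = x t - Im (w * cis (- t))" for w by (simp add: x_def left_diff_distrib)
    then have "(\<integral>\<^sup>+w. ennreal (g t * (ln K - ln \<bar>Im ((z - w) * cis (- t))\<bar>)) \<partial>unif a b \<phi>) =
      (\<integral>\<^sup>+w. (\<lambda>s. ennreal (g t * (ln K - ln \<bar>x t - s\<bar>))) (Im (w * cis (- t))) \<partial>unif a b \<phi>)" by (simp only:)
    also have "\<dots> = (\<integral>\<^sup>+s. ennreal (g t * (ln K - ln \<bar>x t - R t * cos (2 * s)\<bar>)) * ennreal (semicircle_weight s) \<partial>angles)"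
      unfolding R_def by (rule ellipse_projection) (use a b in auto)
    also have "\<dots> = ennreal (g t * (ln K - ln (R t) + semicircle_pot (x t / R t)))"
      by (rule projected_semicircle(1)[OF R(1) xR K1])
    finally show "(\<integral>\<^sup>+w. ennreal (g t * (ln K - ln \<bar>Im ((z - w) * cis (- t))\<bar>)) \<partial>unif a b \<phi>) = ennreal (g t * (ln K - ln (R t) + semicircle_pot (x t / R t)))" .
  qed
  also have "\<dots> = ennreal (\<integral>t. g t * (ln K - ln (R t) + semicircle_pot (x t / R t)) \<partial>angles)"
  proof (rule nn_integral_eq_integral)
    have "integrable angles (\<lambda>t. ln K * g t + g t * (semicircle_pot (x t / R t) - ln (R t)))"
      unfolding x_def R_def by (intro Bochner_Integration.integrable_add integrable_mult_right integrable_g integrable_projected_potential(1) a b)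
    then show "integrable angles (\<lambda>t. g t * (ln K - ln (R t) + semicircle_pot (x t / R t)))" by (simp add: algebra_simps)
  qed (use projected_semicircle(2)[OF R(1) xR K1] in auto)
  also have "(\<integral>t. g t * (ln K - ln (R t) + semicircle_pot (x t / R t)) \<partial>angles) = (\<integral>t. ln K * g t + g t * (semicircle_pot (x t / R t) - ln (R t)) \<partial>angles)"
    by (intro Bochner_Integration.integral_cong refl) (simp add: algebra_simps)
  also have "\<dots> = ln K + ?J"
    by (rule split)
  finally have nn: "(\<integral>\<^sup>+w. ennreal (ln K + pair_potential (z - w) - c0) \<partial>unif a b \<phi>) = ennreal (ln K + ?J)" .
  have J: "0 \<le> ln K + ?J"
  proof -
    have "0 \<le> (\<integral>t. g t * (ln K - ln (R t) + semicircle_pot (x t / R t)) \<partial>angles)"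
      using projected_semicircle(2)[OF R(1) xR K1] by (intro Bochner_Integration.integral_nonneg) auto
    also have "\<dots> = (\<integral>t. ln K * g t + g t * (semicircle_pot (x t / R t) - ln (R t)) \<partial>angles)"
      by (intro Bochner_Integration.integral_cong refl) (simp add: algebra_simps)
    also have "\<dots> = ln K + ?J"
      by (rule split)
    finally show ?thesis .
  qed
  have i: "integrable (unif a b \<phi>) (\<lambda>w. ln K + pair_potential (z - w) - c0)"
    by (rule integrableI_nn_integral_finite[OF _ AEn nn]) measurable
  have "(\<integral>w. ln K + pair_potential (z - w) - c0 \<partial>unif a b \<phi>) = ln K + ?J"
    using nn_integral_eq_integral[OF i AEn] nn J integral_nonneg_AE[OF AEn] by simp
  moreover have "integrable (unif a b \<phi>) (\<lambda>w. (ln K + pair_potential (z - w) - c0) + (c0 - ln K))"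
    using i by (intro Bochner_Integration.integrable_add) auto
  ultimately show i': "integrable (unif a b \<phi>) (\<lambda>w. pair_potential (z - w))" by simp
  have "(\<integral>w. ln K + pair_potential (z - w) - c0 \<partial>unif a b \<phi>) = ln K + (\<integral>w. pair_potential (z - w) \<partial>unif a b \<phi>) - c0"
    using i' m.prob_space by simp
  then show "(\<integral>w. pair_potential (z - w) \<partial>unif a b \<phi>) = c0 + (\<integral>t. g t * (semicircle_pot (Im (z * cis (- t)) / width a b \<phi> t) - ln (width a b \<phi> t)) \<partial>angles)"
    using \<open>(\<integral>w. ln K + pair_potential (z - w) - c0 \<partial>unif a b \<phi>) = ln K + ?J\<close> by (simp add: x_def R_def)
qed

text \<open>
  The assumption turns the average of \<open>semicircle_const - y\<^sup>2\<close>, a lower bound for the potential of each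
  projection, into a constant minus \<open>\<bar>z\<bar>\<^sup>2 / 2\<close>. A point of the ellipse projects into the support of every
  semicircle law, and there the lower bound is attained.
\<close>

theorem ellipse_euler_lagrange:
  assumes a: "0 < a" "a \<le> 2" and b: "0 < b" "b \<le> 2"
    and eq: "\<And>z. (\<integral>t. g t * ((Im (z * cis (- t)))\<^sup>2 / (width a b \<phi> t)\<^sup>2) \<partial>angles) = (norm z)\<^sup>2 / 2"
  obtains C where "\<And>z. C \<le> (\<integral>w. pair_potential (z - w) \<partial>unif a b \<phi>) + (norm z)\<^sup>2 / 2"
    "\<And>z. z \<in> ellipse a b \<phi> \<Longrightarrow> (\<integral>w. pair_potential (z - w) \<partial>unif a b \<phi>) + (norm z)\<^sup>2 / 2 = C"
proof
  let ?C = "c0 + (semicircle_const - (\<integral>t. g t * ln (width a b \<phi> t) \<partial>angles))"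
  fix z
  let ?q = "\<lambda>t. (Im (z * cis (- t)))\<^sup>2 / (width a b \<phi> t)\<^sup>2"
  have i1: "integrable angles (\<lambda>t. semicircle_const * g t)" by (intro integrable_mult_right integrable_g)
  note i2 = Bochner_Integration.integrable_diff[OF i1 integrable_projected_potential(3)[OF a b, of z \<phi>]]
  note i = Bochner_Integration.integrable_diff[OF i2 integrable_projected_potential(2)[OF a b, of \<phi>]]
  have int: "(\<integral>t. semicircle_const * g t - g t * ?q t - g t * ln (width a b \<phi> t) \<partial>angles) = semicircle_const - (norm z)\<^sup>2 / 2 - (\<integral>t. g t * ln (width a b \<phi> t) \<partial>angles)"
    unfolding Bochner_Integration.integral_diff[OF i2 integrable_projected_potential(2)[OF a b]]
      Bochner_Integration.integral_diff[OF i1 integrable_projected_potential(3)[OF a b]] eq by (simp add: integral_g)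
  moreover have "(\<integral>t. semicircle_const * g t - g t * ?q t - g t * ln (width a b \<phi> t) \<partial>angles) \<le>
      (\<integral>t. g t * (semicircle_pot (Im (z * cis (- t)) / width a b \<phi> t) - ln (width a b \<phi> t)) \<partial>angles)"
  proof (rule integral_mono[OF i integrable_projected_potential(1)[OF a b]])
    fix t
    have "g t * (semicircle_const - ?q t) \<le> g t * semicircle_pot (Im (z * cis (- t)) / width a b \<phi> t)"
      using semicircle_potential(3)[of "Im (z * cis (- t)) / width a b \<phi> t"] g_pos[of t]
      unfolding power_divide by (intro mult_left_mono) auto
    then show "semicircle_const * g t - g t * ?q t - g t * ln (width a b \<phi> t) \<le> g t * (semicircle_pot (Im (z * cis (- t)) / width a b \<phi> t) - ln (width a b \<phi> t))"
      by (simp add: algebra_simps)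
  qed
  ultimately show "?C \<le> (\<integral>w. pair_potential (z - w) \<partial>unif a b \<phi>) + (norm z)\<^sup>2 / 2"
    unfolding ellipse_potential(2)[OF a b] by simp
  assume z: "z \<in> ellipse a b \<phi>"
  have "(\<integral>t. semicircle_const * g t - g t * ?q t - g t * ln (width a b \<phi> t) \<partial>angles) =
      (\<integral>t. g t * (semicircle_pot (Im (z * cis (- t)) / width a b \<phi> t) - ln (width a b \<phi> t)) \<partial>angles)"
  proof (intro Bochner_Integration.integral_cong refl)
    fix t
    have "\<bar>Im (z * cis (- t)) / width a b \<phi> t\<bar> \<le> 1"
      using ellipse_width[OF a(1) b(1) z, of t] width_pos[OF a(1) b(1), of \<phi> t] unfolding abs_divide by (subst divide_le_eq_1_pos) auto
    from semicircle_potential(2)[OF this] have e: "semicircle_pot (Im (z * cis (- t)) / width a b \<phi> t) = semicircle_const - ?q t"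
      unfolding power_divide .
    show "semicircle_const * g t - g t * ?q t - g t * ln (width a b \<phi> t) = g t * (semicircle_pot (Im (z * cis (- t)) / width a b \<phi> t) - ln (width a b \<phi> t))"
      unfolding e by (simp add: algebra_simps)
  qed
  with int
  show "(\<integral>w. pair_potential (z - w) \<partial>unif a b \<phi>) + (norm z)\<^sup>2 / 2 = ?C"
    unfolding ellipse_potential(2)[OF a b] by simp
qed

end

section \<open>The interaction as an average over strips\<close>

text \<open>
  The integral of \<open>(r - \<bar>d\<bar>) / r\<^sup>2\<close> over the \<open>r\<close> between \<open>\<bar>d\<bar>\<close> and \<open>R\<close>. As \<open>r - \<bar>d\<bar>\<close>
  is the length of the set of intervals of length \<open>r\<close> that contain two points at distance \<open>d\<close>, this kernel is
  positive definite.
\<close>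

definition truncated_log :: "real \<Rightarrow> real \<Rightarrow> real" where
  "truncated_log R d = (if \<bar>d\<bar> \<le> R then ln R - ln \<bar>d\<bar> + \<bar>d\<bar> / R - 1 else 0)"

lemma truncated_log_measurable [measurable]: "truncated_log R \<in> borel_measurable borel"
  unfolding truncated_log_def[abs_def] by measurable

lemma nn_integral_truncated_log:
  assumes R: "0 < R" and d: "d \<noteq> 0"
  shows "(\<integral>\<^sup>+r. ennreal (1 / r\<^sup>2) * indicator {0<..R} r * ennreal (r - \<bar>d\<bar>) \<partial>lborel) = ennreal (truncated_log R d)"
proof (cases "\<bar>d\<bar> \<le> R")
  case True
  let ?\<delta> = "\<bar>d\<bar>"
  have "(\<integral>\<^sup>+r. ennreal (1 / r\<^sup>2) * indicator {0<..R} r * ennreal (r - ?\<delta>) \<partial>lborel) =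
     (\<integral>\<^sup>+r. ennreal (1 / r - ?\<delta> / r\<^sup>2) * indicator {?\<delta>..R} r \<partial>lborel)"
  proof (rule nn_integral_cong)
    fix r :: real
    show "ennreal (1 / r\<^sup>2) * indicator {0<..R} r * ennreal (r - ?\<delta>) = ennreal (1 / r - ?\<delta> / r\<^sup>2) * indicator {?\<delta>..R} r"
    proof (cases "r \<in> {?\<delta>..R}")
      case True
      then have r: "r > 0" using d by auto
      have "1 / r\<^sup>2 * (r - ?\<delta>) = 1 / r - ?\<delta> / r\<^sup>2" using r by (simp add: field_simps power2_eq_square)
      then show ?thesis using True r by (simp add: ennreal_mult[symmetric])
    next
      case False
      then show ?thesis by (cases "r \<le> R") (auto simp: indicator_def ennreal_neg)
    qed
  qed
  also have "\<dots> = ennreal ((ln R + ?\<delta> / R) - (ln ?\<delta> + ?\<delta> / ?\<delta>))"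
  proof (rule nn_integral_FTC_Icc)
    fix x assume "x \<in> {?\<delta>..R}"
    then have x: "?\<delta> \<le> x" "x \<le> R" by auto
    then have x0: "x > 0" using d by auto
    show "((\<lambda>r. ln r + ?\<delta> / r) has_real_derivative 1 / x - ?\<delta> / x\<^sup>2) (at x)"
      using x0 by (auto intro!: derivative_eq_intros simp: power2_eq_square divide_inverse)
    show "0 \<le> 1 / x - ?\<delta> / x\<^sup>2" using x x0 by (simp add: field_simps power2_eq_square)
  qed (use True in auto)
  finally show ?thesis using True d by (simp add: truncated_log_def algebra_simps)
next
  case False
  have "(\<integral>\<^sup>+r. ennreal (1 / r\<^sup>2) * indicator {0<..R} r * ennreal (r - \<bar>d\<bar>) \<partial>lborel) = (\<integral>\<^sup>+(r::real). 0 \<partial>lborel)"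
    using False by (intro nn_integral_cong) (auto simp: indicator_def ennreal_neg)
  then show ?thesis using False by (simp add: truncated_log_def)
qed

lemma truncated_log_nonneg: assumes "0 < R" "d \<noteq> 0" shows "0 \<le> truncated_log R d"
proof (cases "\<bar>d\<bar> \<le> R")
  case True
  have "ln (\<bar>d\<bar> / R) \<le> \<bar>d\<bar> / R - 1" using assms by (intro ln_le_minus_one) auto
  moreover have "ln (\<bar>d\<bar> / R) = ln \<bar>d\<bar> - ln R" using assms by (intro ln_divide_pos) auto
  ultimately show ?thesis using True by (simp add: truncated_log_def)
qed (simp add: truncated_log_def)

text \<open>
  The error is exactly \<open>- \<bar>d\<bar> / R\<close> for \<open>\<bar>d\<bar> \<le> R\<close>, and beyond \<open>R\<close> it is controlled by \<open>ln x \<le> x - 1\<close>.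
\<close>

lemma truncated_log_error: assumes R: "0 < R" and d: "d \<noteq> 0" shows "\<bar>- ln \<bar>d\<bar> - (truncated_log R d - ln R + 1)\<bar> \<le> \<bar>d\<bar> / R"
proof (cases "\<bar>d\<bar> \<le> R")
  case True then show ?thesis using R by (simp add: truncated_log_def)
next
  case False
  have "ln (\<bar>d\<bar> / R) \<le> \<bar>d\<bar> / R - 1" using assms by (intro ln_le_minus_one) auto
  moreover have "ln (\<bar>d\<bar> / R) = ln \<bar>d\<bar> - ln R" using assms by (intro ln_divide_pos) auto
  moreover have "ln R \<le> ln \<bar>d\<bar>" using False R by (intro ln_mono) auto
  ultimately show ?thesis using False by (simp add: truncated_log_def)
qed

lemma nn_integral_overlap:
  "(\<integral>\<^sup>+u. indicator {u<..u+r} x * indicator {u<..u+r} y \<partial>lborel) = ennreal (r - \<bar>x - y\<bar>)" for x y r :: real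
proof -
  have "(\<integral>\<^sup>+u. indicator {u<..u+r} x * indicator {u<..u+r} y \<partial>lborel) = (\<integral>\<^sup>+u. indicator {max x y - r..<min x y} u \<partial>lborel)"
    by (intro nn_integral_cong) (auto simp: indicator_def)
  also have "\<dots> = emeasure lborel {max x y - r..<min x y}" by simp
  also have "\<dots> = ennreal (r - \<bar>x - y\<bar>)"
    by (cases "max x y - r \<le> min x y") (auto simp: ennreal_neg max_def min_def abs_if split: if_splits intro!: arg_cong[of _ _ ennreal])
  finally show ?thesis .
qed

text \<open>
  A strip is given by its direction, its width and the position of its lower edge.
\<close>

abbreviation "strips \<equiv> angles \<Otimes>\<^sub>M (lborel \<Otimes>\<^sub>M lborel :: (real \<times> real) measure)"

definition strip :: "real \<times> real \<times> real \<Rightarrow> complex set" where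
  "strip = (\<lambda>(t, r, u). {z. u < Im (z * cis (- t)) \<and> Im (z * cis (- t)) \<le> u + r})"

lemma strip_measurable [measurable]: "strip \<omega> \<in> sets borel"
proof -
  obtain t r u where \<omega>: "\<omega> = (t, r, u)" by (cases \<omega>)
  have "{z \<in> space borel. u < Im (z * cis (- t)) \<and> Im (z * cis (- t)) \<le> u + r} \<in> sets borel" by measurable
  then show ?thesis by (simp add: \<omega> strip_def)
qed

lemma strip_indicator_measurable [measurable]:
  "(\<lambda>(\<omega>, z). indicator (strip \<omega>) z :: ennreal) \<in> borel_measurable (strips \<Otimes>\<^sub>M borel)"
proof -
  have "(\<lambda>(\<omega>, z). indicator (strip \<omega>) z :: ennreal) =
    (\<lambda>(\<omega>, z). if snd (snd \<omega>) < Im (z * cis (- fst \<omega>)) \<and> Im (z * cis (- fst \<omega>)) \<le> snd (snd \<omega>) + fst (snd \<omega>) then 1 else 0)"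
    by (auto simp: strip_def indicator_def fun_eq_iff)
  also have "\<dots> \<in> borel_measurable (strips \<Otimes>\<^sub>M borel)" by measurable
  finally show ?thesis .
qed

context projected_kernel
begin

definition weight :: "real \<Rightarrow> real \<times> real \<times> real \<Rightarrow> ennreal" where
  "weight R = (\<lambda>(t, r, u). ennreal (g t) * (ennreal (1 / r\<^sup>2) * indicator {0<..R} r))"

lemma weight_measurable [measurable]: "weight R \<in> borel_measurable strips"
  unfolding weight_def by measurable

definition strip_kernel :: "real \<Rightarrow> complex \<Rightarrow> complex \<Rightarrow> ennreal" where
  "strip_kernel R z w = (\<integral>\<^sup>+\<omega>. weight R \<omega> * (indicator (strip \<omega>) z * indicator (strip \<omega>) w) \<partial>strips)"

lemma strip_kernel_measurable [measurable]: "(\<lambda>(z, w). strip_kernel R z w) \<in> borel_measurable (borel \<Otimes>\<^sub>M borel)"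
proof -
  interpret L: sigma_finite_measure strips
    by (intro sigma_finite_pair_measure) (unfold_locales)
  have "(\<lambda>(p, \<omega>). weight R \<omega> * ((\<lambda>(\<omega>, z). indicator (strip \<omega>) z) (\<omega>, fst p) * (\<lambda>(\<omega>, z). indicator (strip \<omega>) z) (\<omega>, snd p)))
     \<in> borel_measurable ((borel \<Otimes>\<^sub>M borel) \<Otimes>\<^sub>M strips)" by measurable
  then have "(\<lambda>p. \<integral>\<^sup>+\<omega>. weight R \<omega> * (indicator (strip \<omega>) (fst p) * indicator (strip \<omega>) (snd p)) \<partial>strips) \<in> borel_measurable (borel \<Otimes>\<^sub>M borel)"
    by (intro L.borel_measurable_nn_integral) simp
  then show ?thesis unfolding strip_kernel_def by (simp add: case_prod_unfold)
qed

text \<open>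
  For a fixed direction the integral over the strips containing both points is \<open>truncated_log\<close> of the
  projected distance. Averaging \<open>truncated_log_error\<close> over the directions shows that \<open>strip_kernel\<close>
  differs from the interaction by a constant, up to an error that vanishes as \<open>R\<close> grows.
\<close>

lemma strip_kernel_eq: assumes R: "0 < R" and zw: "z \<noteq> w"
  shows "strip_kernel R z w = ennreal (\<integral>t. g t * truncated_log R (Im ((z - w) * cis (- t))) \<partial>angles)"
    "0 \<le> (\<integral>t. g t * truncated_log R (Im ((z - w) * cis (- t))) \<partial>angles)"
    "\<bar>pair_potential (z - w) - (c0 - ln R + 1) - (\<integral>t. g t * truncated_log R (Im ((z - w) * cis (- t))) \<partial>angles)\<bar> \<le> norm (z - w) / R"
proof -
  let ?d = "\<lambda>t. Im ((z - w) * cis (- t))"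
  obtain \<theta> where th: "z - w = of_real (norm (z - w)) * cis \<theta>"
    using zw by (metis cis_Arg complex_scaleR right_minus_eq sgn_eq scaleR_conv_of_real mult.commute nonzero_divide_eq_eq of_real_eq_0_iff norm_eq_zero)
  have nz: "AE t in angles. ?d t \<noteq> 0"
    using AE_sin_shift_nonzero[of \<theta>]
  proof eventually_elim
    case (elim t)
    have "?d t = norm (z - w) * sin (\<theta> - t)" by (subst th) (rule Im_polar)
    then show ?case using elim zw by simp
  qed
  have dm[measurable]: "?d \<in> borel_measurable borel" by measurable
  let ?e = "\<lambda>t. - ln \<bar>?d t\<bar> - (truncated_log R (?d t) - ln R + 1)"
  have eb: "AE t in angles. \<bar>?e t\<bar> \<le> norm (z - w) / R"
    using nz
  proof eventually_elim
    case (elim t)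
    have "\<bar>?d t\<bar> / R \<le> norm (z - w) / R" using R abs_Im_cis_le[of "z - w" "- t"] by (intro divide_right_mono) auto
    then show ?case using truncated_log_error[OF R elim] by linarith
  qed
  have ge: "AE t in angles. \<bar>g t * ?e t\<bar> \<le> g t * (norm (z - w) / R)"
    using eb
  proof eventually_elim
    case (elim t)
    have "\<bar>g t * ?e t\<bar> = g t * \<bar>?e t\<bar>" using g_pos[of t] by (simp only: abs_mult abs_of_pos)
    also have "\<dots> \<le> g t * (norm (z - w) / R)" using elim g_pos[of t] by (intro mult_left_mono) auto
    finally show ?case .
  qed
  have ige: "integrable angles (\<lambda>t. g t * ?e t)"
  proof (rule Bochner_Integration.integrable_bound)
    show "integrable angles (\<lambda>t. g t * (norm (z - w) / R))" by (intro integrable_mult_left integrable_g)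
    show "AE t in angles. norm (g t * ?e t) \<le> norm (g t * (norm (z - w) / R))"
      using ge by eventually_elim (unfold real_norm_def, erule order_trans, rule abs_ge_self)
  qed measurable
  have zw0: "z - w \<noteq> 0" using zw by simp
  have ik: "integrable angles (\<lambda>t. g t * truncated_log R (?d t))"
  proof -
    have "integrable angles (\<lambda>t. (ln R - 1) * g t - g t * ln \<bar>?d t\<bar> - g t * ?e t)"
      by (intro Bochner_Integration.integrable_diff integrable_mult_right integrable_g integrable_log zw0 ige)
    moreover have "(ln R - 1) * g t - g t * ln \<bar>?d t\<bar> - g t * ?e t = g t * truncated_log R (?d t)" for t
      by (simp add: algebra_simps del: times_complex.sel)
    ultimately show ?thesis by (simp only:)
  qed
  have nk: "AE t in angles. 0 \<le> g t * truncated_log R (?d t)"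
    using nz by eventually_elim (use truncated_log_nonneg[OF R] g_pos in \<open>auto intro!: mult_nonneg_nonneg less_imp_le[OF g_pos]\<close>)
  have "strip_kernel R z w = (\<integral>\<^sup>+t. \<integral>\<^sup>+p. weight R (t, p) * (indicator (strip (t, p)) z * indicator (strip (t, p)) w) \<partial>(lborel \<Otimes>\<^sub>M lborel) \<partial>angles)"
  proof -
    have "sigma_finite_measure (lborel \<Otimes>\<^sub>M lborel :: (real \<times> real) measure)"
      by (rule sigma_finite_pair_measure) unfold_locales
    then show ?thesis unfolding strip_kernel_def by (intro sigma_finite_measure.nn_integral_fst[symmetric]) measurable
  qed
  also have "\<dots> = (\<integral>\<^sup>+t. ennreal (g t) * ennreal (truncated_log R (?d t)) \<partial>angles)"
  proof (rule nn_integral_cong_AE)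
    show "AE t in angles. (\<integral>\<^sup>+p. weight R (t, p) * (indicator (strip (t, p)) z * indicator (strip (t, p)) w) \<partial>(lborel \<Otimes>\<^sub>M lborel)) = ennreal (g t) * ennreal (truncated_log R (?d t))"
      using nz
    proof eventually_elim
      case (elim t)
      let ?x = "Im (z * cis (- t))" and ?y = "Im (w * cis (- t))"
      have d: "?d t = ?x - ?y" by (simp add: left_diff_distrib)
      have "(\<integral>\<^sup>+p. weight R (t, p) * (indicator (strip (t, p)) z * indicator (strip (t, p)) w) \<partial>(lborel \<Otimes>\<^sub>M lborel)) =
        (\<integral>\<^sup>+r. \<integral>\<^sup>+u. weight R (t, r, u) * (indicator (strip (t, r, u)) z * indicator (strip (t, r, u)) w) \<partial>lborel \<partial>lborel)"
        by (rule lborel.nn_integral_fst[symmetric]) measurable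
      also have "\<dots> = (\<integral>\<^sup>+r. ennreal (g t) * (ennreal (1 / r\<^sup>2) * indicator {0<..R} r * ennreal (r - \<bar>?d t\<bar>)) \<partial>lborel)"
      proof (rule nn_integral_cong)
        fix r
        have "(\<integral>\<^sup>+u. weight R (t, r, u) * (indicator (strip (t, r, u)) z * indicator (strip (t, r, u)) w) \<partial>lborel) =
          (\<integral>\<^sup>+u. (ennreal (g t) * (ennreal (1 / r\<^sup>2) * indicator {0<..R} r)) * (indicator {u<..u+r} ?x * indicator {u<..u+r} ?y) \<partial>lborel)"
          by (intro nn_integral_cong) (simp add: weight_def strip_def indicator_def)
        also have "\<dots> = (ennreal (g t) * (ennreal (1 / r\<^sup>2) * indicator {0<..R} r)) * (\<integral>\<^sup>+u. (indicator {u<..u+r} ?x * indicator {u<..u+r} ?y) \<partial>lborel)"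
          by (rule nn_integral_cmult) (measurable, auto simp: indicator_def)
        also have "\<dots> = ennreal (g t) * (ennreal (1 / r\<^sup>2) * indicator {0<..R} r * ennreal (r - \<bar>?d t\<bar>))"
          unfolding nn_integral_overlap d by (simp add: mult.assoc)
        finally show "(\<integral>\<^sup>+u. weight R (t, r, u) * (indicator (strip (t, r, u)) z * indicator (strip (t, r, u)) w) \<partial>lborel) = \<dots>" .
      qed
      also have "\<dots> = ennreal (g t) * (\<integral>\<^sup>+r. ennreal (1 / r\<^sup>2) * indicator {0<..R} r * ennreal (r - \<bar>?d t\<bar>) \<partial>lborel)"
        by (rule nn_integral_cmult) measurable
      also have "\<dots> = ennreal (g t) * ennreal (truncated_log R (?d t))" by (simp only: nn_integral_truncated_log[OF R elim])
      finally show ?case .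
    qed
  qed
  also have "\<dots> = (\<integral>\<^sup>+t. ennreal (g t * truncated_log R (?d t)) \<partial>angles)"
    using g_pos by (intro nn_integral_cong) (simp add: ennreal_mult' less_imp_le)
  also have "\<dots> = ennreal (\<integral>t. g t * truncated_log R (?d t) \<partial>angles)"
    by (rule nn_integral_eq_integral[OF ik nk])
  finally show "strip_kernel R z w = ennreal (\<integral>t. g t * truncated_log R (?d t) \<partial>angles)" .
  show "0 \<le> (\<integral>t. g t * truncated_log R (?d t) \<partial>angles)" by (rule integral_nonneg_AE[OF nk])
  have "(\<integral>t. g t * ?e t \<partial>angles) = (\<integral>t. (ln R - 1) * g t - g t * ln \<bar>?d t\<bar> - g t * truncated_log R (?d t) \<partial>angles)"
    by (intro Bochner_Integration.integral_cong refl) (simp add: algebra_simps del: times_complex.sel)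
  also have "\<dots> = (ln R - 1) - (ln (norm (z - w)) - \<kappa> (z - w) + c0) - (\<integral>t. g t * truncated_log R (?d t) \<partial>angles)"
  proof -
    note i1 = integrable_mult_right[OF integrable_g, of "ln R - 1"]
    note i2 = Bochner_Integration.integrable_diff[OF i1 integrable_log[OF zw0]]
    show ?thesis
      unfolding Bochner_Integration.integral_diff[OF i2 ik] Bochner_Integration.integral_diff[OF i1 integrable_log[OF zw0]] integral_log[OF zw0]
      by (simp add: integral_g)
  qed
  finally have "pair_potential (z - w) - (c0 - ln R + 1) - (\<integral>t. g t * truncated_log R (?d t) \<partial>angles) = (\<integral>t. g t * ?e t \<partial>angles)"
    by (simp add: pair_potential_def)
  also have "\<bar>\<dots>\<bar> \<le> (\<integral>t. g t * (norm (z - w) / R) \<partial>angles)"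
    using integral_abs_bound[of angles "\<lambda>t. g t * ?e t"]
    by (rule order_trans) (rule integral_mono_AE[OF _ _ ge], use ige in simp, intro integrable_mult_left integrable_g)
  also have "\<dots> = norm (z - w) / R" by (simp add: integral_g)
  finally show "\<bar>pair_potential (z - w) - (c0 - ln R + 1) - (\<integral>t. g t * truncated_log R (?d t) \<partial>angles)\<bar> \<le> norm (z - w) / R" .
qed

abbreviation strip_energy :: "real \<Rightarrow> complex measure \<Rightarrow> complex measure \<Rightarrow> ennreal" where
  "strip_energy R \<alpha> \<beta> \<equiv> (\<integral>\<^sup>+p. strip_kernel R (fst p) (snd p) \<partial>(\<alpha> \<Otimes>\<^sub>M \<beta>))"

lemma nn_integral_strip_kernel:
  assumes a: "finite_measure \<alpha>" "sets \<alpha> = sets borel" and b: "finite_measure \<beta>" "sets \<beta> = sets borel"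
  shows "strip_energy R \<alpha> \<beta> =
     (\<integral>\<^sup>+\<omega>. weight R \<omega> * (emeasure \<alpha> (strip \<omega>) * emeasure \<beta> (strip \<omega>)) \<partial>strips)"
proof -
  interpret A: finite_measure \<alpha> by fact
  interpret B: finite_measure \<beta> by fact
  interpret O: sigma_finite_measure strips by (intro sigma_finite_pair_measure) unfold_locales
  interpret AB: pair_sigma_finite \<alpha> \<beta> by unfold_locales
  interpret BO: pair_sigma_finite \<beta> strips by unfold_locales
  interpret AO: pair_sigma_finite \<alpha> strips by unfold_locales
  note [measurable_cong] = a(2) b(2)
  have ma: "(\<lambda>(\<omega>, z). indicator (strip \<omega>) z :: ennreal) \<in> borel_measurable (strips \<Otimes>\<^sub>M \<alpha>)"
    using strip_indicator_measurable by measurable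
  have mb: "(\<lambda>(\<omega>, z). indicator (strip \<omega>) z :: ennreal) \<in> borel_measurable (strips \<Otimes>\<^sub>M \<beta>)"
    using strip_indicator_measurable by measurable
  define s :: "real \<times> real \<times> real \<Rightarrow> complex \<Rightarrow> ennreal" where "s \<omega> z = indicator (strip \<omega>) z" for \<omega> z
  have [measurable]: "(\<lambda>p. s (fst p) (snd p)) \<in> borel_measurable (strips \<Otimes>\<^sub>M borel)"
    using strip_indicator_measurable by (simp add: s_def case_prod_unfold)
  have [measurable]: "(\<lambda>\<omega>. s \<omega> z) \<in> borel_measurable strips" for z
  proof -
    have "(\<lambda>\<omega>. (\<lambda>p. s (fst p) (snd p)) (\<omega>, z)) \<in> borel_measurable strips" by measurable
    then show ?thesis by simp
  qed
  have sw: "(\<lambda>p. s (snd p) (fst p)) \<in> borel_measurable (borel \<Otimes>\<^sub>M strips)"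
  proof -
    have "(\<lambda>p. (\<lambda>p. s (fst p) (snd p)) (snd p, fst p)) \<in> borel_measurable (borel \<Otimes>\<^sub>M strips)" by measurable
    then show ?thesis by simp
  qed
  have int: "(\<integral>\<^sup>+z. s \<omega> z \<partial>\<alpha>) = emeasure \<alpha> (strip \<omega>)" "(\<integral>\<^sup>+z. s \<omega> z \<partial>\<beta>) = emeasure \<beta> (strip \<omega>)" for \<omega>
    unfolding s_def by (subst nn_integral_indicator; simp add: a b)+
  have sz[measurable]: "s \<omega> \<in> borel_measurable borel" for \<omega> unfolding s_def[abs_def] by measurable
  have eb: "(\<lambda>\<omega>. emeasure \<beta> (strip \<omega>)) \<in> borel_measurable strips"
    unfolding int[symmetric] by measurable
  note [measurable] = sw eb
  have "strip_energy R \<alpha> \<beta> = (\<integral>\<^sup>+z. \<integral>\<^sup>+w. strip_kernel R z w \<partial>\<beta> \<partial>\<alpha>)"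
    using strip_kernel_measurable[of R] by (subst B.nn_integral_fst[symmetric]) (simp_all add: case_prod_unfold)
  also have "\<dots> = (\<integral>\<^sup>+z. \<integral>\<^sup>+w. \<integral>\<^sup>+\<omega>. weight R \<omega> * (s \<omega> z * s \<omega> w) \<partial>strips \<partial>\<beta> \<partial>\<alpha>)"
    unfolding strip_kernel_def s_def ..
  also have "\<dots> = (\<integral>\<^sup>+z. \<integral>\<^sup>+\<omega>. \<integral>\<^sup>+w. weight R \<omega> * (s \<omega> z * s \<omega> w) \<partial>\<beta> \<partial>strips \<partial>\<alpha>)"
    by (intro nn_integral_cong BO.Fubini'[symmetric]) measurable
  also have "\<dots> = (\<integral>\<^sup>+z. \<integral>\<^sup>+\<omega>. weight R \<omega> * emeasure \<beta> (strip \<omega>) * s \<omega> z \<partial>strips \<partial>\<alpha>)"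
  proof (intro nn_integral_cong)
    fix z \<omega>
    have "(\<integral>\<^sup>+w. weight R \<omega> * (s \<omega> z * s \<omega> w) \<partial>\<beta>) = (\<integral>\<^sup>+w. (weight R \<omega> * s \<omega> z) * s \<omega> w \<partial>\<beta>)" by (simp add: mult.assoc)
    also have "\<dots> = (weight R \<omega> * s \<omega> z) * (\<integral>\<^sup>+w. s \<omega> w \<partial>\<beta>)" by (rule nn_integral_cmult) measurable
    finally show "(\<integral>\<^sup>+w. weight R \<omega> * (s \<omega> z * s \<omega> w) \<partial>\<beta>) = weight R \<omega> * emeasure \<beta> (strip \<omega>) * s \<omega> z" by (simp add: int mult_ac)
  qed
  also have "\<dots> = (\<integral>\<^sup>+\<omega>. \<integral>\<^sup>+z. weight R \<omega> * emeasure \<beta> (strip \<omega>) * s \<omega> z \<partial>\<alpha> \<partial>strips)"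
    by (rule AO.Fubini'[symmetric]) measurable
  also have "\<dots> = (\<integral>\<^sup>+\<omega>. weight R \<omega> * (emeasure \<alpha> (strip \<omega>) * emeasure \<beta> (strip \<omega>)) \<partial>strips)"
  proof (rule nn_integral_cong)
    fix \<omega>
    have "(\<integral>\<^sup>+z. weight R \<omega> * emeasure \<beta> (strip \<omega>) * s \<omega> z \<partial>\<alpha>) = weight R \<omega> * emeasure \<beta> (strip \<omega>) * (\<integral>\<^sup>+z. s \<omega> z \<partial>\<alpha>)"
      by (rule nn_integral_cmult) measurable
    then show "(\<integral>\<^sup>+z. weight R \<omega> * emeasure \<beta> (strip \<omega>) * s \<omega> z \<partial>\<alpha>) = weight R \<omega> * (emeasure \<alpha> (strip \<omega>) * emeasure \<beta> (strip \<omega>))"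
      by (simp add: int mult_ac)
  qed
  finally show ?thesis .
qed

section \<open>Positive definiteness\<close>

definition mutual_energy :: "complex measure \<Rightarrow> complex measure \<Rightarrow> real" where
  "mutual_energy \<alpha> \<beta> = (\<integral>p. pair_potential (fst p - snd p) \<partial>(\<alpha> \<Otimes>\<^sub>M \<beta>))"

definition admissible :: "complex measure \<Rightarrow> complex measure \<Rightarrow> bool" where
  "admissible \<alpha> \<beta> \<longleftrightarrow> prob_space \<alpha> \<and> prob_space \<beta> \<and> sets \<alpha> = sets borel \<and> sets \<beta> = sets borel \<and>
     (AE p in \<alpha> \<Otimes>\<^sub>M \<beta>. fst p \<noteq> snd p) \<and> integrable (\<alpha> \<Otimes>\<^sub>M \<beta>) (\<lambda>p. norm (fst p - snd p))"

lemma admissible_measurable: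
  assumes "admissible \<alpha> \<beta>"
  shows "f \<in> borel_measurable (borel \<Otimes>\<^sub>M borel) \<Longrightarrow> f \<in> borel_measurable (\<alpha> \<Otimes>\<^sub>M \<beta>)"
proof -
  have "sets \<alpha> = sets borel" "sets \<beta> = sets borel" using assms by (auto simp: admissible_def)
  note [measurable_cong] = this
  show "f \<in> borel_measurable (borel \<Otimes>\<^sub>M borel) \<Longrightarrow> f \<in> borel_measurable (\<alpha> \<Otimes>\<^sub>M \<beta>)" by measurable
qed

lemma strip_kernel_measurable' [measurable]: "(\<lambda>p. strip_kernel R (fst p) (snd p)) \<in> borel_measurable (borel \<Otimes>\<^sub>M borel)"
  using strip_kernel_measurable[of R] by (simp add: case_prod_unfold)

lemma nn_integral_strip_kernel_finite:
  assumes adm: "admissible \<alpha> \<beta>" and R: "0 < R" and W: "integrable (\<alpha> \<Otimes>\<^sub>M \<beta>) (\<lambda>p. pair_potential (fst p - snd p))"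
  shows "strip_energy R \<alpha> \<beta> < \<infinity>"
proof -
  interpret A: prob_space \<alpha> using adm by (simp add: admissible_def)
  interpret B: prob_space \<beta> using adm by (simp add: admissible_def)
  interpret AB: pair_prob_space \<alpha> \<beta> by unfold_locales
  let ?f = "\<lambda>p. \<bar>pair_potential (fst p - snd p)\<bar> + \<bar>c0 - ln R + 1\<bar> + norm (fst p - snd p) / R"
  have i: "integrable (\<alpha> \<Otimes>\<^sub>M \<beta>) ?f" using adm W by (simp add: admissible_def)
  have "strip_energy R \<alpha> \<beta> \<le> (\<integral>\<^sup>+p. ennreal (?f p) \<partial>(\<alpha> \<Otimes>\<^sub>M \<beta>))"
  proof (rule nn_integral_mono_AE)
    have "AE p in \<alpha> \<Otimes>\<^sub>M \<beta>. fst p \<noteq> snd p" using adm by (simp add: admissible_def)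
    then show "AE p in \<alpha> \<Otimes>\<^sub>M \<beta>. strip_kernel R (fst p) (snd p) \<le> ennreal (?f p)"
    proof eventually_elim
      case (elim p)
      show ?case unfolding strip_kernel_eq(1)[OF R elim] using strip_kernel_eq(3)[OF R elim] by (intro ennreal_leI) linarith
    qed
  qed
  also have "\<dots> < \<infinity>" using integrableD(2)[OF i] by (simp add: less_top[symmetric])
  finally show ?thesis .
qed

lemma interaction_strip_kernel:
  assumes adm: "admissible \<alpha> \<beta>" and R: "0 < R"
    and fin: "strip_energy R \<alpha> \<beta> < \<infinity>"
  shows "integrable (\<alpha> \<Otimes>\<^sub>M \<beta>) (\<lambda>p. pair_potential (fst p - snd p))"
    "\<bar>mutual_energy \<alpha> \<beta> - (c0 - ln R + 1) - enn2real (strip_energy R \<alpha> \<beta>)\<bar>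
      \<le> (\<integral>p. norm (fst p - snd p) \<partial>(\<alpha> \<Otimes>\<^sub>M \<beta>)) / R"
proof -
  interpret A: prob_space \<alpha> using adm by (simp add: admissible_def)
  interpret B: prob_space \<beta> using adm by (simp add: admissible_def)
  interpret AB: pair_prob_space \<alpha> \<beta> by unfold_locales
  have off: "AE p in \<alpha> \<Otimes>\<^sub>M \<beta>. fst p \<noteq> snd p" and id: "integrable (\<alpha> \<Otimes>\<^sub>M \<beta>) (\<lambda>p. norm (fst p - snd p))"
    using adm by (simp_all add: admissible_def)
  define kr where "kr p = enn2real (strip_kernel R (fst p) (snd p))" for p
  have mk: "kr \<in> borel_measurable (\<alpha> \<Otimes>\<^sub>M \<beta>)"
    by (rule admissible_measurable[OF adm], unfold kr_def[abs_def], rule borel_measurable_enn2real[OF strip_kernel_measurable'])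
  have mW: "(\<lambda>p. pair_potential (fst p - snd p)) \<in> borel_measurable (\<alpha> \<Otimes>\<^sub>M \<beta>)"
    by (rule admissible_measurable[OF adm]) measurable
  have kr: "AE p in \<alpha> \<Otimes>\<^sub>M \<beta>. strip_kernel R (fst p) (snd p) = ennreal (kr p)"
    using off by eventually_elim (simp add: kr_def strip_kernel_eq(1,2)[OF R])
  have nk: "(\<integral>\<^sup>+p. ennreal (kr p) \<partial>(\<alpha> \<Otimes>\<^sub>M \<beta>)) = strip_energy R \<alpha> \<beta>"
    by (rule nn_integral_cong_AE) (use kr in \<open>eventually_elim, simp\<close>)
  have ik: "integrable (\<alpha> \<Otimes>\<^sub>M \<beta>) kr"
    by (rule integrableI_nonneg[OF mk]) (use fin nk in \<open>auto simp: kr_def\<close>)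
  have Ik: "(\<integral>p. kr p \<partial>(\<alpha> \<Otimes>\<^sub>M \<beta>)) = enn2real (strip_energy R \<alpha> \<beta>)"
    unfolding nk[symmetric] by (rule integral_eq_nn_integral[OF mk]) (simp add: kr_def)
  define e where "e p = pair_potential (fst p - snd p) - (c0 - ln R + 1) - kr p" for p
  have me: "e \<in> borel_measurable (\<alpha> \<Otimes>\<^sub>M \<beta>)" unfolding e_def[abs_def] using mk mW by measurable
  have eb: "AE p in \<alpha> \<Otimes>\<^sub>M \<beta>. \<bar>e p\<bar> \<le> norm (fst p - snd p) / R"
    using off
  proof eventually_elim
    case (elim p)
    show ?case unfolding e_def kr_def strip_kernel_eq(1)[OF R elim] enn2real_ennreal[OF strip_kernel_eq(2)[OF R elim]] by (rule strip_kernel_eq(3)[OF R elim])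
  qed
  have idR: "integrable (\<alpha> \<Otimes>\<^sub>M \<beta>) (\<lambda>p. norm (fst p - snd p) / R)" using id by simp
  have ie: "integrable (\<alpha> \<Otimes>\<^sub>M \<beta>) e"
  proof (rule Bochner_Integration.integrable_bound[OF idR me])
    show "AE p in \<alpha> \<Otimes>\<^sub>M \<beta>. norm (e p) \<le> norm (norm (fst p - snd p) / R)"
      using eb by eventually_elim (unfold real_norm_def, erule order_trans, rule abs_ge_self)
  qed
  have W: "pair_potential (fst p - snd p) = e p + (c0 - ln R + 1) + kr p" for p by (simp add: e_def)
  show "integrable (\<alpha> \<Otimes>\<^sub>M \<beta>) (\<lambda>p. pair_potential (fst p - snd p))" unfolding W using ie ik by simp
  have "mutual_energy \<alpha> \<beta> = (\<integral>p. e p \<partial>(\<alpha> \<Otimes>\<^sub>M \<beta>)) + (c0 - ln R + 1) + (\<integral>p. kr p \<partial>(\<alpha> \<Otimes>\<^sub>M \<beta>))"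
    unfolding mutual_energy_def W using ie ik by (simp add: AB.prob_space)
  then have "\<bar>mutual_energy \<alpha> \<beta> - (c0 - ln R + 1) - enn2real (strip_energy R \<alpha> \<beta>)\<bar> = \<bar>\<integral>p. e p \<partial>(\<alpha> \<Otimes>\<^sub>M \<beta>)\<bar>"
    by (simp add: Ik)
  also have "\<dots> \<le> (\<integral>p. norm (fst p - snd p) / R \<partial>(\<alpha> \<Otimes>\<^sub>M \<beta>))"
    using integral_abs_bound[of "\<alpha> \<Otimes>\<^sub>M \<beta>" e] by (rule order_trans) (rule integral_mono_AE[OF _ idR eb], use ie in simp)
  finally show "\<bar>mutual_energy \<alpha> \<beta> - (c0 - ln R + 1) - enn2real (strip_energy R \<alpha> \<beta>)\<bar>
      \<le> (\<integral>p. norm (fst p - snd p) \<partial>(\<alpha> \<Otimes>\<^sub>M \<beta>)) / R" by simp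
qed

definition discrepancy :: "real \<Rightarrow> complex measure \<Rightarrow> complex measure \<Rightarrow> ennreal" where
  "discrepancy R \<mu> \<nu> = (\<integral>\<^sup>+\<omega>. weight R \<omega> * ennreal ((measure \<mu> (strip \<omega>) - measure \<nu> (strip \<omega>))\<^sup>2) \<partial>strips)"

lemma strip_measure_measurable:
  assumes "prob_space \<mu>" "sets \<mu> = sets borel"
  shows "(\<lambda>\<omega>. emeasure \<mu> (strip \<omega>)) \<in> borel_measurable strips"
proof -
  interpret prob_space \<mu> by fact
  note [measurable_cong] = assms(2)
  have m: "(\<lambda>(\<omega>, z). indicator (strip \<omega>) z :: ennreal) \<in> borel_measurable (strips \<Otimes>\<^sub>M \<mu>)"
    using strip_indicator_measurable by measurable
  have "(\<lambda>\<omega>. \<integral>\<^sup>+z. indicator (strip \<omega>) z \<partial>\<mu>) \<in> borel_measurable strips"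
    using borel_measurable_nn_integral[of "\<lambda>\<omega> z. indicator (strip \<omega>) z" strips] m by simp
  then show ?thesis by (simp add: assms(2))
qed

text \<open>
  By \<open>nn_integral_strip_kernel\<close> the energies are integrals over strips of products of measures, and
  \<open>x * x + y * y = (x - y)\<^sup>2 + 2 * (x * y)\<close>. Written as a sum, the identity makes sense in \<open>ennreal\<close>,
  and it yields the finiteness of the mixed term from that of the other two.
\<close>

lemma discrepancy_strip_kernel:
  assumes \<mu>: "prob_space \<mu>" "sets \<mu> = sets borel" and \<nu>: "prob_space \<nu>" "sets \<nu> = sets borel"
  shows "strip_energy R \<mu> \<mu> + strip_energy R \<nu> \<nu> =
    discrepancy R \<mu> \<nu> + 2 * strip_energy R \<mu> \<nu>"
proof -
  interpret M: prob_space \<mu> by fact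
  interpret N: prob_space \<nu> by fact
  note [measurable] = strip_measure_measurable[OF \<mu>] strip_measure_measurable[OF \<nu>]
  have [measurable]: "(\<lambda>\<omega>. measure \<mu> (strip \<omega>)) \<in> borel_measurable strips" "(\<lambda>\<omega>. measure \<nu> (strip \<omega>)) \<in> borel_measurable strips"
    unfolding measure_def by measurable
  let ?a = "\<lambda>\<omega>. measure \<mu> (strip \<omega>)" and ?b = "\<lambda>\<omega>. measure \<nu> (strip \<omega>)"
  have K: "strip_energy R \<mu> \<mu> = (\<integral>\<^sup>+\<omega>. weight R \<omega> * ennreal (?a \<omega> * ?a \<omega>) \<partial>strips)"
    "strip_energy R \<nu> \<nu> = (\<integral>\<^sup>+\<omega>. weight R \<omega> * ennreal (?b \<omega> * ?b \<omega>) \<partial>strips)"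
    "strip_energy R \<mu> \<nu> = (\<integral>\<^sup>+\<omega>. weight R \<omega> * ennreal (?a \<omega> * ?b \<omega>) \<partial>strips)"
    by (subst nn_integral_strip_kernel; (intro M.finite_measure_axioms N.finite_measure_axioms \<mu> \<nu>)?;
        simp add: M.emeasure_eq_measure N.emeasure_eq_measure ennreal_mult)+
  have "(\<integral>\<^sup>+\<omega>. weight R \<omega> * ennreal (?a \<omega> * ?a \<omega>) \<partial>strips) + (\<integral>\<^sup>+\<omega>. weight R \<omega> * ennreal (?b \<omega> * ?b \<omega>) \<partial>strips) =
    (\<integral>\<^sup>+\<omega>. weight R \<omega> * ennreal (?a \<omega> * ?a \<omega>) + weight R \<omega> * ennreal (?b \<omega> * ?b \<omega>) \<partial>strips)"
    by (rule nn_integral_add[symmetric]) measurable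
  also have "\<dots> = (\<integral>\<^sup>+\<omega>. weight R \<omega> * ennreal ((?a \<omega> - ?b \<omega>)\<^sup>2) + 2 * (weight R \<omega> * ennreal (?a \<omega> * ?b \<omega>)) \<partial>strips)"
  proof (rule nn_integral_cong)
    fix \<omega>
    have "ennreal (?a \<omega> * ?a \<omega>) + ennreal (?b \<omega> * ?b \<omega>) = ennreal ((?a \<omega> - ?b \<omega>)\<^sup>2) + 2 * ennreal (?a \<omega> * ?b \<omega>)"
    proof -
      have "ennreal (?a \<omega> * ?a \<omega>) + ennreal (?b \<omega> * ?b \<omega>) = ennreal (?a \<omega> * ?a \<omega> + ?b \<omega> * ?b \<omega>)" by (rule ennreal_plus[symmetric]) auto
      also have "?a \<omega> * ?a \<omega> + ?b \<omega> * ?b \<omega> = (?a \<omega> - ?b \<omega>)\<^sup>2 + 2 * (?a \<omega> * ?b \<omega>)" by (simp add: power2_eq_square algebra_simps)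
      also have "ennreal \<dots> = ennreal ((?a \<omega> - ?b \<omega>)\<^sup>2) + ennreal (2 * (?a \<omega> * ?b \<omega>))" by (rule ennreal_plus) auto
      also have "ennreal (2 * (?a \<omega> * ?b \<omega>)) = 2 * ennreal (?a \<omega> * ?b \<omega>)" by (subst ennreal_mult) auto
      finally show ?thesis .
    qed
    then show "weight R \<omega> * ennreal (?a \<omega> * ?a \<omega>) + weight R \<omega> * ennreal (?b \<omega> * ?b \<omega>) = weight R \<omega> * ennreal ((?a \<omega> - ?b \<omega>)\<^sup>2) + 2 * (weight R \<omega> * ennreal (?a \<omega> * ?b \<omega>))"
      by (metis distrib_left mult.left_commute)
  qed
  also have "\<dots> = (\<integral>\<^sup>+\<omega>. weight R \<omega> * ennreal ((?a \<omega> - ?b \<omega>)\<^sup>2) \<partial>strips) + (\<integral>\<^sup>+\<omega>. 2 * (weight R \<omega> * ennreal (?a \<omega> * ?b \<omega>)) \<partial>strips)"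
    by (rule nn_integral_add) measurable
  also have "(\<integral>\<^sup>+\<omega>. 2 * (weight R \<omega> * ennreal (?a \<omega> * ?b \<omega>)) \<partial>strips) = 2 * (\<integral>\<^sup>+\<omega>. weight R \<omega> * ennreal (?a \<omega> * ?b \<omega>) \<partial>strips)"
    by (rule nn_integral_cmult) measurable
  finally show ?thesis unfolding K discrepancy_def .
qed

lemma discrepancy_mono:
  assumes "R \<le> R'" shows "discrepancy R \<mu> \<nu> \<le> discrepancy R' \<mu> \<nu>"
  unfolding discrepancy_def weight_def using assms
  by (intro nn_integral_mono) (auto simp: indicator_def split: prod.split intro!: mult_mono)

text \<open>
  For every truncation \<open>R\<close> the discrepancy is the energy of the difference for \<open>strip_kernel\<close>. The
  constants in which \<open>strip_kernel\<close> and the interaction differ cancel, the errors are at most a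
  multiple of \<open>1 / R\<close>, and the discrepancy increases with \<open>R\<close>.
\<close>

theorem interaction_positive_definite:
  assumes adm: "admissible \<mu> \<mu>" "admissible \<mu> \<nu>" "admissible \<nu> \<nu>"
    and W: "integrable (\<mu> \<Otimes>\<^sub>M \<mu>) (\<lambda>p. pair_potential (fst p - snd p))" "integrable (\<nu> \<Otimes>\<^sub>M \<nu>) (\<lambda>p. pair_potential (fst p - snd p))"
  shows "integrable (\<mu> \<Otimes>\<^sub>M \<nu>) (\<lambda>p. pair_potential (fst p - snd p))"
    "discrepancy 1 \<mu> \<nu> \<le> ennreal (mutual_energy \<mu> \<mu> - 2 * mutual_energy \<mu> \<nu> + mutual_energy \<nu> \<nu>)" "0 \<le> mutual_energy \<mu> \<mu> - 2 * mutual_energy \<mu> \<nu> + mutual_energy \<nu> \<nu>"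
proof -
  have \<mu>: "prob_space \<mu>" "sets \<mu> = sets borel" and \<nu>: "prob_space \<nu>" "sets \<nu> = sets borel"
    using adm by (auto simp: admissible_def)
  let ?N = "\<lambda>\<alpha> \<beta>. \<integral>p. norm (fst p - snd p) \<partial>(\<alpha> \<Otimes>\<^sub>M \<beta>)"
  have fin: "strip_energy R \<mu> \<mu> < \<infinity>" "strip_energy R \<nu> \<nu> < \<infinity>" "strip_energy R \<mu> \<nu> < \<infinity>" "discrepancy R \<mu> \<nu> < \<infinity>" if R: "0 < R" for R
  proof -
    show 1: "strip_energy R \<mu> \<mu> < \<infinity>" "strip_energy R \<nu> \<nu> < \<infinity>"
      using nn_integral_strip_kernel_finite[OF adm(1) R W(1)] nn_integral_strip_kernel_finite[OF adm(3) R W(2)] by auto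
    then have "discrepancy R \<mu> \<nu> + 2 * strip_energy R \<mu> \<nu> < \<infinity>"
      unfolding discrepancy_strip_kernel[OF \<mu> \<nu>, symmetric] by simp
    then show "strip_energy R \<mu> \<nu> < \<infinity>" "discrepancy R \<mu> \<nu> < \<infinity>"
      by (auto simp: ennreal_mult_less_top mult_2)
  qed
  show "integrable (\<mu> \<Otimes>\<^sub>M \<nu>) (\<lambda>p. pair_potential (fst p - snd p))"
    by (rule interaction_strip_kernel(1)[OF adm(2) zero_less_one fin(3)]) simp
  let ?D = "mutual_energy \<mu> \<mu> - 2 * mutual_energy \<mu> \<nu> + mutual_energy \<nu> \<nu>"
  define c where "c = ?N \<mu> \<mu> + 2 * ?N \<mu> \<nu> + ?N \<nu> \<nu>"
  have c0': "0 \<le> c" unfolding c_def by (intro add_nonneg_nonneg mult_nonneg_nonneg Bochner_Integration.integral_nonneg) auto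
  have bound: "enn2real (discrepancy 1 \<mu> \<nu>) \<le> ?D + c / R" if R: "1 \<le> R" for R
  proof -
    have R0: "0 < R" using R by simp
    have "enn2real (discrepancy 1 \<mu> \<nu>) \<le> enn2real (discrepancy R \<mu> \<nu>)"
      using discrepancy_mono[OF R] fin(4)[OF R0] by (intro enn2real_mono) auto
    moreover have "enn2real (strip_energy R \<mu> \<mu>) + enn2real (strip_energy R \<nu> \<nu>) = enn2real (discrepancy R \<mu> \<nu>) + 2 * enn2real (strip_energy R \<mu> \<nu>)"
    proof -
      have "enn2real (strip_energy R \<mu> \<mu> + strip_energy R \<nu> \<nu>) = enn2real (discrepancy R \<mu> \<nu> + 2 * strip_energy R \<mu> \<nu>)"
        unfolding discrepancy_strip_kernel[OF \<mu> \<nu>] ..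
      then show ?thesis
        using fin[OF R0] by (simp add: enn2real_plus enn2real_mult ennreal_mult_less_top)
    qed
    moreover have "\<bar>mutual_energy \<mu> \<mu> - (c0 - ln R + 1) - enn2real (strip_energy R \<mu> \<mu>)\<bar> \<le> ?N \<mu> \<mu> / R"
      by (rule interaction_strip_kernel(2)[OF adm(1) R0 fin(1)[OF R0]])
    moreover have "\<bar>mutual_energy \<mu> \<nu> - (c0 - ln R + 1) - enn2real (strip_energy R \<mu> \<nu>)\<bar> \<le> ?N \<mu> \<nu> / R"
      by (rule interaction_strip_kernel(2)[OF adm(2) R0 fin(3)[OF R0]])
    moreover have "\<bar>mutual_energy \<nu> \<nu> - (c0 - ln R + 1) - enn2real (strip_energy R \<nu> \<nu>)\<bar> \<le> ?N \<nu> \<nu> / R"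
      by (rule interaction_strip_kernel(2)[OF adm(3) R0 fin(2)[OF R0]])
    moreover have "c / R = ?N \<mu> \<mu> / R + 2 * (?N \<mu> \<nu> / R) + ?N \<nu> \<nu> / R" by (simp add: c_def add_divide_distrib)
    ultimately show ?thesis by linarith
  qed
  have "enn2real (discrepancy 1 \<mu> \<nu>) \<le> ?D"
  proof (rule field_le_epsilon)
    fix e :: real assume e: "0 < e"
    define R where "R = max 1 (c / e)"
    have "c / R \<le> e"
    proof -
      have "c / e \<le> R" "0 < R" by (auto simp: R_def)
      then show ?thesis using e by (simp add: field_simps)
    qed
    then show "enn2real (discrepancy 1 \<mu> \<nu>) \<le> ?D + e" using bound[of R] by (simp add: R_def)
  qed
  moreover have "discrepancy 1 \<mu> \<nu> = ennreal (enn2real (discrepancy 1 \<mu> \<nu>))" using fin(4)[of 1] by simp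
  ultimately show "discrepancy 1 \<mu> \<nu> \<le> ennreal ?D" "0 \<le> ?D"
    by (metis ennreal_leI, metis enn2real_nonneg order_trans)
qed

end

section \<open>Measures determined by their projections\<close>

text \<open>
  The difference of the distribution functions is right-continuous, so that it has the period \<open>r\<close>
  everywhere and not only almost everywhere; it vanishes at \<open>- \<infinity>\<close>.
\<close>

lemma real_distribution_eqI_intervals:
  assumes M: "real_distribution M" and N: "real_distribution N" and r: "0 < r"
    and ae: "AE u in lborel. measure M {u<..u+r} = measure N {u<..u+r}"
  shows "M = N"
proof -
  interpret M: real_distribution M by fact
  interpret N: real_distribution N by fact
  define D where "D x = cdf M x - cdf N x" for x
  define H where "H x = D (x + r) - D x" for x
  have Dc: "(D \<longlongrightarrow> D x) (at_right x)" for x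
    unfolding D_def using M.cdf_is_right_cont[of x] N.cdf_is_right_cont[of x]
    by (intro tendsto_diff) (auto simp: continuous_within)
  have Hc: "(H \<longlongrightarrow> H x) (at_right x)" for x
  proof -
    have "filtermap (\<lambda>y. y - - r) (at_right x) = at_right (x - - r)" by (rule filtermap_at_right_shift)
    moreover have "x - - r = x + r" by simp
    ultimately have "filterlim D (nhds (D (x + r))) (filtermap (\<lambda>y. y - - r) (at_right x))"
      using Dc[of "x + r"] by (simp only:)
    then have "((\<lambda>y. D (y + r)) \<longlongrightarrow> D (x + r)) (at_right x)"
      by (simp add: filterlim_filtermap)
    then show ?thesis unfolding H_def using Dc by (intro tendsto_diff)
  qed
  have H0: "AE x in lborel. H x = 0"
    using ae
  proof eventually_elim
    case (elim u)
    have "cdf M (u + r) - cdf M u = measure M {u<..u+r}" "cdf N (u + r) - cdf N u = measure N {u<..u+r}"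
      using r by (simp_all add: M.cdf_diff_eq N.cdf_diff_eq)
    then show ?case using elim by (simp add: H_def D_def)
  qed
  have Hz: "H x = 0" for x
  proof (rule ccontr)
    assume "H x \<noteq> 0"
    then have "eventually (\<lambda>y. H y \<noteq> 0) (at_right x)" by (rule tendsto_imp_eventually_ne[OF Hc])
    then obtain b where b: "x < b" "\<And>y. x < y \<Longrightarrow> y < b \<Longrightarrow> H y \<noteq> 0"
      unfolding eventually_at_right_field by blast
    have "AE y in lborel. y \<notin> {x<..<b}" using H0 by eventually_elim (use b in auto)
    then have "{x<..<b} \<in> null_sets lborel" by (simp add: AE_iff_null_sets)
    then show False using b(1) by (auto simp: null_sets_def)
  qed
  have Dn: "D x = D (x - real n * r)" for x n
  proof (induction n)
    case (Suc n)
    have "D (x - real n * r) = D (x - real (Suc n) * r)"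
      using Hz[of "x - real (Suc n) * r"] by (simp add: H_def algebra_simps)
    then show ?case using Suc by simp
  qed simp
  have "D x = 0" for x
  proof -
    have l: "filterlim (\<lambda>n. x - real n * r) at_bot sequentially" using r by real_asymp
    have "(\<lambda>n. D (x - real n * r)) \<longlonglongrightarrow> 0 - 0"
      unfolding D_def by (intro tendsto_diff filterlim_compose[OF M.cdf_lim_at_bot l] filterlim_compose[OF N.cdf_lim_at_bot l])
    then have "(\<lambda>n. D x) \<longlonglongrightarrow> 0" using Dn[of x] by simp
    then show ?thesis by (simp add: LIMSEQ_const_iff)
  qed
  then have "cdf M = cdf N" by (auto simp: D_def fun_eq_iff)
  then show ?thesis by (rule cdf_unique[OF M N])
qed

text \<open>
  Indicators of closed sets are limits of the continuous functions \<open>max 0 (1 - n * infdist x C)\<close>.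
\<close>

lemma borel_measure_eqI_continuous:
  fixes \<mu> \<nu> :: "'a :: {metric_space, second_countable_topology} measure"
  assumes \<mu>: "prob_space \<mu>" "sets \<mu> = sets borel" and \<nu>: "prob_space \<nu>" "sets \<nu> = sets borel"
    and eq: "\<And>f :: 'a \<Rightarrow> real. continuous_on UNIV f \<Longrightarrow> (\<And>x. 0 \<le> f x \<and> f x \<le> 1) \<Longrightarrow> (\<integral>x. f x \<partial>\<mu>) = (\<integral>x. f x \<partial>\<nu>)"
  shows "\<mu> = \<nu>"
proof (rule measure_eqI_generator_eq[where E="Collect closed" and \<Omega>=UNIV and A="\<lambda>_. UNIV"])
  interpret M: prob_space \<mu> by fact
  interpret N: prob_space \<nu> by fact
  show "Int_stable (Collect closed)" by (auto simp: Int_stable_def)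
  show "sets \<mu> = sigma_sets UNIV (Collect closed)" "sets \<nu> = sigma_sets UNIV (Collect closed)"
    using \<mu>(2) \<nu>(2) by (simp_all add: borel_eq_closed)
  show "emeasure \<mu> UNIV \<noteq> \<infinity>" by simp
  fix C :: "'a set" assume "C \<in> Collect closed"
  then have C: "closed C" by simp
  show "emeasure \<mu> C = emeasure \<nu> C"
  proof (cases "C = {}")
    case False
    define f where "f n x = max 0 (1 - real n * infdist x C)" for n x
    have cont: "continuous_on UNIV (f n)" for n unfolding f_def by (intro continuous_intros)
    have bnd: "0 \<le> f n x \<and> f n x \<le> 1" for n x by (auto simp: f_def infdist_nonneg)
    have lim: "(\<lambda>n. f n x) \<longlonglongrightarrow> indicator C x" for x
    proof (cases "x \<in> C")
      case True then show ?thesis by (simp add: f_def)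
    next
      case x: False
      then have d: "0 < infdist x C" using C False infdist_pos_not_in_closed by blast
      obtain m :: nat where m: "1 / infdist x C < real m" using reals_Archimedean2 by blast
      have "f n x = 0" if "m \<le> n" for n
      proof -
        have "1 < real m * infdist x C" using m d by (simp add: field_simps)
        also have "\<dots> \<le> real n * infdist x C" using that d by (intro mult_right_mono) auto
        finally show ?thesis by (simp add: f_def)
      qed
      then have "eventually (\<lambda>n. f n x = 0) sequentially" unfolding eventually_sequentially by blast
      then show ?thesis using x by (simp add: tendsto_eventually)
    qed
    have "(\<lambda>n. \<integral>x. f n x \<partial>M) \<longlonglongrightarrow> measure M C" if M: "prob_space M" "sets M = sets borel" for M
    proof -
      interpret prob_space M by fact
      have mf: "f n \<in> borel_measurable M" for n
        using borel_measurable_continuous_onI[OF cont] M(2) by (simp cong: measurable_cong_sets)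
      have "(\<lambda>n. \<integral>x. f n x \<partial>M) \<longlonglongrightarrow> (\<integral>x. indicator C x \<partial>M)"
      proof (rule integral_dominated_convergence[where w="\<lambda>_. 1"])
        show "AE x in M. norm (f n x) \<le> 1" for n using bnd by (intro AE_I2) auto
        show "AE x in M. (\<lambda>n. f n x) \<longlonglongrightarrow> indicator C x" using lim by auto
        show "(\<lambda>x. indicator C x :: real) \<in> borel_measurable M" using C M(2) by (intro borel_measurable_indicator) auto
      qed (use mf in auto)
      then show ?thesis using M(2) C sets_eq_imp_space_eq[OF M(2)] by simp
    qed
    from this[OF \<mu>] this[OF \<nu>] have "measure \<mu> C = measure \<nu> C"
      using eq[OF cont bnd] LIMSEQ_unique by simp
    then show ?thesis by (simp add: M.emeasure_eq_measure N.emeasure_eq_measure)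
  qed simp
qed auto

lemma borel_measure_eqI_moments:
  fixes \<mu> \<nu> :: "complex measure"
  assumes \<mu>: "prob_space \<mu>" "sets \<mu> = sets borel" "AE z in \<mu>. norm z \<le> \<rho>"
    and \<nu>: "prob_space \<nu>" "sets \<nu> = sets borel" "AE z in \<nu>. norm z \<le> \<rho>"
    and eq: "\<And>c n k. (\<integral>z. Re (c * z ^ n * cnj z ^ k) \<partial>\<mu>) = (\<integral>z. Re (c * z ^ n * cnj z ^ k) \<partial>\<nu>)"
  shows "\<mu> = \<nu>"
proof (rule borel_measure_eqI_continuous[OF \<mu>(1,2) \<nu>(1,2)])
  have int: "integrable M f" if M: "prob_space M" "sets M = sets borel" "AE z in M. norm z \<le> \<rho>" and f: "continuous_on UNIV f" for M and f :: "complex \<Rightarrow> real"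
  proof -
    interpret prob_space M by fact
    have "bounded (f ` cball 0 \<rho>)" by (intro compact_imp_bounded compact_continuous_image continuous_on_subset[OF f]) auto
    then obtain K where K: "\<forall>y\<in>f ` cball 0 \<rho>. norm y \<le> K" unfolding bounded_iff by blast
    show ?thesis
    proof (rule integrable_const_bound[where B=K])
      show "AE z in M. norm (f z) \<le> K" using M(3) by eventually_elim (use K in auto)
      show "f \<in> borel_measurable M" using borel_measurable_continuous_onI[OF f] M(2) by (simp cong: measurable_cong_sets)
    qed
  qed
  have zp: "(\<integral>z. p z \<partial>\<mu>) = (\<integral>z. p z \<partial>\<nu>)" if "zpoly p" for p
    using that
  proof (induction rule: zpoly.induct)
    case (base c n m) show ?case by (rule eq)
  next
    case (add f g)
    show ?case
      using add int[OF \<mu> continuous_zpoly[OF add(1)]] int[OF \<mu> continuous_zpoly[OF add(2)]]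
        int[OF \<nu> continuous_zpoly[OF add(1)]] int[OF \<nu> continuous_zpoly[OF add(2)]] by simp
  qed
  fix f :: "complex \<Rightarrow> real" assume f: "continuous_on UNIV f"
  have "\<bar>(\<integral>x. f x \<partial>\<mu>) - (\<integral>x. f x \<partial>\<nu>)\<bar> \<le> 0 + e" if "0 < e" for e
  proof -
    have "0 < e / 2" using that by simp
    then obtain p where p: "real_polynomial_function p" "\<And>x. x \<in> cball 0 \<rho> \<Longrightarrow> \<bar>f x - p x\<bar> < e / 2"
      using Stone_Weierstrass_real_polynomial_function[OF compact_cball continuous_on_subset[OF f]] by (metis subset_UNIV)
    have z: "zpoly p" using p(1) by (rule real_polynomial_function_zpoly)
    have *: "\<bar>(\<integral>x. f x \<partial>M) - (\<integral>x. p x \<partial>M)\<bar> \<le> e / 2" if M: "prob_space M" "sets M = sets borel" "AE z in M. norm z \<le> \<rho>" for M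
    proof -
      interpret prob_space M by fact
      have i: "integrable M f" "integrable M p" using int[OF M f] int[OF M continuous_zpoly[OF z]] by auto
      have "\<bar>(\<integral>x. f x \<partial>M) - (\<integral>x. p x \<partial>M)\<bar> = \<bar>\<integral>x. f x - p x \<partial>M\<bar>" using i by simp
      also have "\<dots> \<le> (\<integral>x. \<bar>f x - p x\<bar> \<partial>M)" using integral_abs_bound by blast
      also have "\<dots> \<le> (\<integral>x. e / 2 \<partial>M)"
      proof (rule integral_mono_AE)
        show "AE x in M. \<bar>f x - p x\<bar> \<le> e / 2" using M(3) by eventually_elim (use p(2) in \<open>auto intro: less_imp_le\<close>)
      qed (use i in auto)
      finally show ?thesis by (simp add: prob_space)
    qed
    show ?thesis using *[OF \<mu>] *[OF \<nu>] zp[OF z] by linarith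
  qed
  then have "\<bar>(\<integral>x. f x \<partial>\<mu>) - (\<integral>x. f x \<partial>\<nu>)\<bar> \<le> 0" by (rule field_le_epsilon)
  then show "(\<integral>x. f x \<partial>\<mu>) = (\<integral>x. f x \<partial>\<nu>)" by simp
qed

lemma integral_cis: "(\<integral>t. cis (2 * of_int j * t) \<partial>angles) = (if j = 0 then of_real pi else 0)" for j :: int
proof (cases "j = 0")
  case True
  then show ?thesis by (simp add: measure_angles_UNIV scaleR_conv_of_real)
next
  case False
  let ?b = "2 * real_of_int j"
  have b: "?b \<noteq> 0" using False by simp
  have i: "complex_integrable angles (\<lambda>t. cis (?b * t))"
    by (rule angles.integrable_const_bound[where B=1]) auto
  have s: "sin (?b * pi) = 0" "cos (?b * pi) = 1"
  proof -
    have "?b * pi = 2 * pi * of_int j" by simp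
    then show "sin (?b * pi) = 0" "cos (?b * pi) = 1" by (simp_all only: sin_int_2pin cos_int_2pin)
  qed
  have "Re (\<integral>t. cis (?b * t) \<partial>angles) = (\<integral>t. cos (?b * t) \<partial>angles)" using integral_Re[OF i] by simp
  also have "\<dots> = sin (?b * pi) / ?b - sin (?b * 0) / ?b"
    by (rule angles_FTC) (use b in \<open>auto intro!: continuous_intros derivative_eq_intros\<close>)
  finally have R: "Re (\<integral>t. cis (?b * t) \<partial>angles) = 0" using s by simp
  have "Im (\<integral>t. cis (?b * t) \<partial>angles) = (\<integral>t. sin (?b * t) \<partial>angles)" using integral_Im[OF i] by simp
  also have "\<dots> = - cos (?b * pi) / ?b - - cos (?b * 0) / ?b"
    by (rule angles_FTC) (use b in \<open>auto intro!: continuous_intros derivative_eq_intros\<close>)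
  finally have I: "Im (\<integral>t. cis (?b * t) \<partial>angles) = 0" using s by simp
  show ?thesis using R I False by (simp add: complex_eq_iff)
qed

text \<open>
  Expanding \<open>Im u = (u - cnj u) / (2 * \<i>)\<close> by the binomial theorem, the powers of \<open>Im (z * cis (- t))\<close> are
  trigonometric polynomials in \<open>t\<close> whose coefficients are the monomials in \<open>z\<close> and \<open>cnj z\<close>.
\<close>

lemma ridge_power_coefficient:
  "(\<integral>t. cis (of_int (int n - int k) * t) * of_real (Im (z * cis (- t)) ^ (n + k)) \<partial>angles) =
     of_real pi * of_nat ((n + k) choose n) * (- 1) ^ k / (2 * \<i>) ^ (n + k) * z ^ n * cnj z ^ k"
proof -
  let ?N = "n + k"
  let ?c = "\<lambda>j. of_nat (?N choose j) * (- 1) ^ (?N - j) / (2 * \<i>) ^ ?N * z ^ j * cnj z ^ (?N - j)"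
  have exp: "cis (of_int (int n - int k) * t) * of_real (Im (z * cis (- t)) ^ ?N) = (\<Sum>j\<le>?N. ?c j * cis (2 * of_int (int n - int j) * t))" for t
  proof -
    define e where "e = cis t"
    have Im: "of_real (Im w) = (w - cnj w) / (2 * \<i>)" for w by (simp add: complex_eq_iff)
    have "of_real (Im (z * cis (- t)) ^ ?N) = (z * cis (- t) + - (cnj z * cis t)) ^ ?N / (2 * \<i>) ^ ?N"
      by (simp only: of_real_power Im power_divide) (simp add: cis_cnj)
    also have "(z * cis (- t) + - (cnj z * cis t)) ^ ?N = (\<Sum>j\<le>?N. of_nat (?N choose j) * (z * cis (- t)) ^ j * (- (cnj z * cis t)) ^ (?N - j))"
      by (rule binomial_ring)
    finally have "cis (of_int (int n - int k) * t) * of_real (Im (z * cis (- t)) ^ ?N) =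
       (\<Sum>j\<le>?N. cis (of_int (int n - int k) * t) * (of_nat (?N choose j) * (z * cis (- t)) ^ j * (- (cnj z * cis t)) ^ (?N - j) / (2 * \<i>) ^ ?N))"
      by (simp only: sum_divide_distrib sum_distrib_left)
    also have "\<dots> = (\<Sum>j\<le>?N. ?c j * cis (2 * of_int (int n - int j) * t))"
    proof (rule sum.cong[OF refl])
      fix j assume j: "j \<in> {..?N}"
      have e: "of_int (int n - int k) * t + (real j * (- t) + real (?N - j) * t) = 2 * of_int (int n - int j) * t"
        using j by (simp add: of_nat_diff algebra_simps)
      have "cis (of_int (int n - int k) * t) * (cis (- t) ^ j * cis t ^ (?N - j)) = cis (2 * of_int (int n - int j) * t)"
        unfolding Complex.DeMoivre cis_mult e ..
      moreover have "(- (cnj z * cis t)) ^ (?N - j) = (- 1) ^ (?N - j) * (cnj z ^ (?N - j) * cis t ^ (?N - j))"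
        by (subst power_minus) (simp add: power_mult_distrib)
      ultimately show "cis (of_int (int n - int k) * t) * (of_nat (?N choose j) * (z * cis (- t)) ^ j * (- (cnj z * cis t)) ^ (?N - j) / (2 * \<i>) ^ ?N) =
         ?c j * cis (2 * of_int (int n - int j) * t)"
        by (simp add: power_mult_distrib mult_ac del: of_nat_add)
    qed
    finally show ?thesis .
  qed
  have i: "complex_integrable angles (\<lambda>t. cis (2 * of_int j * t))" for j :: int
    by (rule angles.integrable_const_bound[where B=1]) auto
  have "(\<integral>t. cis (of_int (int n - int k) * t) * of_real (Im (z * cis (- t)) ^ ?N) \<partial>angles) =
     (\<Sum>j\<le>?N. ?c j * (\<integral>t. cis (2 * of_int (int n - int j) * t) \<partial>angles))"
    unfolding exp by (subst Bochner_Integration.integral_sum) (auto intro!: integrable_mult_right i simp del: of_int_diff)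
  also have "\<dots> = (\<Sum>j\<le>?N. if j = n then ?c n * of_real pi else 0)"
    unfolding integral_cis by (intro sum.cong refl) auto
  also have "\<dots> = ?c n * of_real pi" by simp
  finally show ?thesis by (simp add: mult_ac)
qed

lemma AE_angles_ex: assumes "AE t in angles. P t" shows "\<exists>t. P t"
proof (rule ccontr)
  assume "\<not> (\<exists>t. P t)"
  then have "AE t in angles. t \<notin> UNIV" using assms by simp
  then have "UNIV \<in> null_sets angles" by (subst (asm) AE_iff_null_sets[symmetric]) simp_all
  then show False by (simp add: null_sets_def emeasure_angles_UNIV)
qed

lemma Im_cis_measurable [measurable]: "(\<lambda>z. Im (z * cis t)) \<in> borel_measurable borel"
  by measurable

text \<open>
  Two projections in different directions are coordinates on the plane: measures whose
  projections have bounded support are supported in a bounded set.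
\<close>

lemma norm_le_two_projections:
  "norm z * \<bar>sin (s - t)\<bar> \<le> \<bar>Im (z * cis (- s))\<bar> + \<bar>Im (z * cis (- t))\<bar>"
proof -
  let ?x = "Im (z * cis (- s))" and ?y = "Im (z * cis (- t))"
  have "z * of_real (sin (s - t)) = cis s * of_real ?y - cis t * of_real ?x"
    by (simp add: complex_eq_iff sin_diff algebra_simps)
  then have "norm z * \<bar>sin (s - t)\<bar> = norm (cis s * of_real ?y - cis t * of_real ?x)"
    by (metis norm_mult norm_of_real)
  also have "\<dots> \<le> norm (cis s * of_real ?y) + norm (cis t * of_real ?x)" by (rule norm_triangle_ineq4)
  also have "\<dots> = \<bar>?x\<bar> + \<bar>?y\<bar>" unfolding norm_mult norm_cis norm_of_real by simp
  finally show ?thesis .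
qed

text \<open>
  A moment is an integral over the directions of moments of the projections, and is therefore determined by
  almost all of them.
\<close>

lemma moment_from_projections:
  assumes M: "prob_space M" "sets M = sets borel" "AE z in M. norm z \<le> \<rho>" and \<rho>: "0 \<le> \<rho>"
  shows "(of_real pi * of_nat ((n + k) choose n) * (- 1) ^ k / (2 * \<i>) ^ (n + k)) * (\<integral>z. z ^ n * cnj z ^ k \<partial>M) =
    (\<integral>t. cis (of_int (int n - int k) * t) * of_real (\<integral>z. Im (z * cis (- t)) ^ (n + k) \<partial>M) \<partial>angles)"
proof -
  interpret M: prob_space M by fact
  interpret P: pair_sigma_finite M angles by unfold_locales
  note [measurable_cong] = M(2)
  let ?c = "of_real pi * of_nat ((n + k) choose n) * (- 1) ^ k / (2 * \<i>) ^ (n + k) :: complex"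
  let ?G = "\<lambda>z t. cis (of_int (int n - int k) * t) * of_real (Im (z * cis (- t)) ^ (n + k))"
  have bound: "norm (?G z t) \<le> \<rho> ^ (n + k)" if "norm z \<le> \<rho>" for z t
  proof -
    have "\<bar>Im (z * cis (- t))\<bar> \<le> \<rho>" using abs_Im_cis_le[of z "- t"] that by linarith
    then have "\<bar>Im (z * cis (- t))\<bar> ^ (n + k) \<le> \<rho> ^ (n + k)" by (intro power_mono) auto
    then show ?thesis by (simp only: norm_mult norm_cis norm_of_real power_abs mult_1_left)
  qed
  have int: "integrable (M \<Otimes>\<^sub>M angles) (\<lambda>(z, t). ?G z t)"
  proof (rule finite_measure.integrable_const_bound)
    show "finite_measure (M \<Otimes>\<^sub>M angles)" by (intro finite_measure_pair_measure M.finite_measure_axioms finite_measure_angles)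
    have "AE p in M \<Otimes>\<^sub>M angles. norm (fst p) \<le> \<rho>"
    proof (rule P.AE_pair_measure)
      show "{x \<in> space (M \<Otimes>\<^sub>M angles). norm (fst x) \<le> \<rho>} \<in> sets (M \<Otimes>\<^sub>M angles)" by measurable
      show "AE x in M. AE y in angles. norm (fst (x, y)) \<le> \<rho>" using M(3) by eventually_elim simp
    qed
    then show "AE p in M \<Otimes>\<^sub>M angles. norm (case p of (z, t) \<Rightarrow> ?G z t) \<le> \<rho> ^ (n + k)"
      by eventually_elim (use bound in \<open>auto simp only: case_prod_unfold\<close>)
  qed measurable
  have "?c * (\<integral>z. z ^ n * cnj z ^ k \<partial>M) = (\<integral>z. ?c * (z ^ n * cnj z ^ k) \<partial>M)" by (rule integral_mult_right_zero[symmetric])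
  also have "\<dots> = (\<integral>z. (\<integral>t. ?G z t \<partial>angles) \<partial>M)"
    unfolding ridge_power_coefficient by (simp only: mult.assoc)
  also have "\<dots> = (\<integral>t. (\<integral>z. ?G z t \<partial>M) \<partial>angles)"
    by (rule P.Fubini_integral[OF int, symmetric])
  also have "\<dots> = (\<integral>t. cis (of_int (int n - int k) * t) * of_real (\<integral>z. Im (z * cis (- t)) ^ (n + k) \<partial>M) \<partial>angles)"
    by (simp only: integral_mult_right_zero integral_complex_of_real)
  finally show ?thesis .
qed

theorem borel_measure_eqI_projections:
  assumes \<mu>: "prob_space \<mu>" "sets \<mu> = sets borel"
    and \<nu>: "prob_space \<nu>" "sets \<nu> = sets borel" "AE z in \<nu>. norm z \<le> r"
    and proj: "AE t in angles. distr \<mu> borel (\<lambda>z. Im (z * cis (- t))) = distr \<nu> borel (\<lambda>z. Im (z * cis (- t)))"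
  shows "\<mu> = \<nu>"
proof -
  note [measurable_cong] = \<mu>(2) \<nu>(2)
  let ?P = "\<lambda>t. distr \<mu> borel (\<lambda>z. Im (z * cis (- t))) = distr \<nu> borel (\<lambda>z. Im (z * cis (- t)))"
  have AEp: "AE z in \<mu>. \<bar>Im (z * cis (- t))\<bar> \<le> r" if P: "?P t" for t
  proof -
    have "AE z in \<nu>. \<bar>Im (z * cis (- t))\<bar> \<le> r"
      using \<nu>(3) by eventually_elim (use abs_Im_cis_le order_trans in blast)
    then have "AE x in distr \<nu> borel (\<lambda>z. Im (z * cis (- t))). \<bar>x\<bar> \<le> r"
      by (subst AE_distr_iff) auto
    then have "AE x in distr \<mu> borel (\<lambda>z. Im (z * cis (- t))). \<bar>x\<bar> \<le> r" unfolding P .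
    then show ?thesis by (subst (asm) AE_distr_iff) auto
  qed
  obtain s where s: "?P s" using AE_angles_ex[OF proj] by blast
  have "AE t in angles. ?P t \<and> sin (s - t) \<noteq> 0" using proj AE_sin_shift_nonzero[of s] by eventually_elim simp
  then obtain t where t: "?P t" "sin (s - t) \<noteq> 0" using AE_angles_ex by blast
  define \<rho> where "\<rho> = max (max 0 r) (2 * r / \<bar>sin (s - t)\<bar>)"
  have \<rho>: "0 \<le> \<rho>" "r \<le> \<rho>" "2 * r / \<bar>sin (s - t)\<bar> \<le> \<rho>" by (auto simp: \<rho>_def)
  have b\<mu>: "AE z in \<mu>. norm z \<le> \<rho>"
    using AEp[OF s] AEp[OF t(1)]
  proof eventually_elim
    case (elim z)
    then have "norm z * \<bar>sin (s - t)\<bar> \<le> 2 * r" using norm_le_two_projections[of z s t] by linarith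
    then have "norm z \<le> 2 * r / \<bar>sin (s - t)\<bar>" using t(2) by (simp add: pos_le_divide_eq)
    then show ?case using \<rho>(3) by linarith
  qed
  have b\<nu>: "AE z in \<nu>. norm z \<le> \<rho>" using \<nu>(3) by eventually_elim (use \<rho> in linarith)
  show ?thesis
  proof (rule borel_measure_eqI_moments[OF \<mu> b\<mu> \<nu>(1,2) b\<nu>])
    fix c :: complex and n k :: nat
    let ?c = "of_real pi * of_nat ((n + k) choose n) * (- 1) ^ k / (2 * \<i>) ^ (n + k) :: complex"
    have nz: "?c \<noteq> 0" by simp
    have m: "(\<lambda>t. cis (of_int (int n - int k) * t) * of_real (\<integral>z. Im (z * cis (- t)) ^ (n + k) \<partial>M)) \<in> borel_measurable angles"
      if M: "prob_space M" "sets M = sets borel" for M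
    proof -
      interpret prob_space M by fact
      note [measurable_cong] = M(2)
      show ?thesis by measurable
    qed
    have "(\<integral>t. cis (of_int (int n - int k) * t) * of_real (\<integral>z. Im (z * cis (- t)) ^ (n + k) \<partial>\<mu>) \<partial>angles) =
       (\<integral>t. cis (of_int (int n - int k) * t) * of_real (\<integral>z. Im (z * cis (- t)) ^ (n + k) \<partial>\<nu>) \<partial>angles)"
    proof (rule integral_cong_AE[OF m[OF \<mu>] m[OF \<nu>(1,2)]])
      show "AE t in angles. cis (of_int (int n - int k) * t) * of_real (\<integral>z. Im (z * cis (- t)) ^ (n + k) \<partial>\<mu>) =
         cis (of_int (int n - int k) * t) * of_real (\<integral>z. Im (z * cis (- t)) ^ (n + k) \<partial>\<nu>)"
        using proj
      proof eventually_elim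
        case (elim t)
        have "(\<integral>x. x ^ (n + k) \<partial>distr \<mu> borel (\<lambda>z. Im (z * cis (- t)))) = (\<integral>z. Im (z * cis (- t)) ^ (n + k) \<partial>\<mu>)"
          by (rule integral_distr) measurable
        moreover have "(\<integral>x. x ^ (n + k) \<partial>distr \<nu> borel (\<lambda>z. Im (z * cis (- t)))) = (\<integral>z. Im (z * cis (- t)) ^ (n + k) \<partial>\<nu>)"
          by (rule integral_distr) measurable
        ultimately show ?case using elim by (simp only:)
      qed
    qed
    then have "?c * (\<integral>z. z ^ n * cnj z ^ k \<partial>\<mu>) = ?c * (\<integral>z. z ^ n * cnj z ^ k \<partial>\<nu>)"
      by (simp only: moment_from_projections[OF \<mu> b\<mu> \<rho>(1)] moment_from_projections[OF \<nu>(1,2) b\<nu> \<rho>(1)])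
    then have eq: "(\<integral>z. z ^ n * cnj z ^ k \<partial>\<mu>) = (\<integral>z. z ^ n * cnj z ^ k \<partial>\<nu>)"
      using nz mult_left_cancel by blast
    have "(\<integral>z. Re (c * z ^ n * cnj z ^ k) \<partial>M) = Re (c * (\<integral>z. z ^ n * cnj z ^ k \<partial>M))"
      if M: "prob_space M" "sets M = sets borel" "AE z in M. norm z \<le> \<rho>" for M
    proof -
      interpret prob_space M by fact
      note [measurable_cong] = M(2)
      have i: "integrable M (\<lambda>z. z ^ n * cnj z ^ k)"
      proof (rule integrable_const_bound[where B="\<rho> ^ n * \<rho> ^ k"])
        show "AE z in M. norm (z ^ n * cnj z ^ k) \<le> \<rho> ^ n * \<rho> ^ k"
          using M(3) by eventually_elim (use \<rho>(1) in \<open>auto simp: norm_mult norm_power intro!: mult_mono power_mono\<close>)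
        show "(\<lambda>z. z ^ n * cnj z ^ k) \<in> borel_measurable M"
          using borel_measurable_continuous_onI[of "\<lambda>z. z ^ n * cnj z ^ k"] by (simp add: continuous_intros)
      qed
      have "(\<integral>z. Re (c * z ^ n * cnj z ^ k) \<partial>M) = (\<integral>z. Re (c * (z ^ n * cnj z ^ k)) \<partial>M)" by (simp only: mult.assoc)
      also have "\<dots> = Re (\<integral>z. c * (z ^ n * cnj z ^ k) \<partial>M)" by (rule integral_Re) (rule integrable_mult_right[OF i])
      finally show ?thesis by (simp only: integral_mult_right_zero)
    qed
    from this[OF \<mu> b\<mu>] this[OF \<nu>(1,2) b\<nu>]
    show "(\<integral>z. Re (c * z ^ n * cnj z ^ k) \<partial>\<mu>) = (\<integral>z. Re (c * z ^ n * cnj z ^ k) \<partial>\<nu>)"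
      by (simp only: eq)
  qed
qed

context projected_kernel
begin

text \<open>
  For almost every direction there is a width \<open>r\<close> for which almost all strips have the same measure; one
  such width already determines the projection.
\<close>

theorem discrepancy_zero:
  assumes \<mu>: "prob_space \<mu>" "sets \<mu> = sets borel"
    and \<nu>: "prob_space \<nu>" "sets \<nu> = sets borel" "AE z in \<nu>. norm z \<le> \<rho>"
    and zero: "discrepancy 1 \<mu> \<nu> = 0"
  shows "\<mu> = \<nu>"
proof (rule borel_measure_eqI_projections[OF \<mu> \<nu>])
  interpret M: prob_space \<mu> by fact
  interpret N: prob_space \<nu> by fact
  note [measurable_cong] = \<mu>(2) \<nu>(2)
  note [measurable] = strip_measure_measurable[OF \<mu>] strip_measure_measurable[OF \<nu>(1,2)]
  have [measurable]: "(\<lambda>\<omega>. measure \<mu> (strip \<omega>)) \<in> borel_measurable strips" "(\<lambda>\<omega>. measure \<nu> (strip \<omega>)) \<in> borel_measurable strips"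
    unfolding measure_def by measurable
  have "sigma_finite_measure (lborel \<Otimes>\<^sub>M lborel :: (real \<times> real) measure)"
    by (rule sigma_finite_pair_measure) unfold_locales
  then interpret S: pair_sigma_finite angles "lborel \<Otimes>\<^sub>M lborel :: (real \<times> real) measure"
    by (intro pair_sigma_finite.intro angles.sigma_finite_measure_axioms)
  let ?Q = "\<lambda>t r u. 0 < r \<and> r \<le> 1 \<longrightarrow> measure \<mu> (strip (t, r, u)) = measure \<nu> (strip (t, r, u))"
  have "AE \<omega> in strips. weight 1 \<omega> * ennreal ((measure \<mu> (strip \<omega>) - measure \<nu> (strip \<omega>))\<^sup>2) = 0"
    using zero unfolding discrepancy_def by (subst (asm) nn_integral_0_iff_AE) auto
  then have "AE \<omega> in strips. ?Q (fst \<omega>) (fst (snd \<omega>)) (snd (snd \<omega>))"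
  proof eventually_elim
    case (elim \<omega>)
    obtain t r u where \<omega>: "\<omega> = (t, r, u)" by (cases \<omega>)
    have "measure \<mu> (strip (t, r, u)) = measure \<nu> (strip (t, r, u))" if r: "0 < r" "r \<le> 1"
    proof -
      have "ennreal (g t) \<noteq> 0" "ennreal (1 / r\<^sup>2) \<noteq> 0" using g_pos[of t] r by (auto simp: ennreal_eq_0_iff not_le)
      then have "ennreal ((measure \<mu> (strip \<omega>) - measure \<nu> (strip \<omega>))\<^sup>2) = 0"
        using elim r unfolding \<omega> weight_def by (simp add: indicator_def)
      then have "(measure \<mu> (strip \<omega>) - measure \<nu> (strip \<omega>))\<^sup>2 \<le> 0" by (simp add: ennreal_eq_0_iff del: power2_less_eq_zero_iff)
      then show ?thesis unfolding \<omega> by simp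
    qed
    then show ?case by (simp add: \<omega>)
  qed
  then have "AE t in angles. AE p in lborel \<Otimes>\<^sub>M lborel. ?Q t (fst p) (snd p)"
    using S.AE_pair[of "\<lambda>\<omega>. ?Q (fst \<omega>) (fst (snd \<omega>)) (snd (snd \<omega>))"] by simp
  then show "AE t in angles. distr \<mu> borel (\<lambda>z. Im (z * cis (- t))) = distr \<nu> borel (\<lambda>z. Im (z * cis (- t)))"
  proof eventually_elim
    case (elim t)
    have ae: "AE r in lborel. AE u in lborel. ?Q t r u"
      using lborel_pair.AE_pair[OF elim] by simp
    have "\<exists>r. 0 < r \<and> r \<le> 1 \<and> (AE u in lborel. measure \<mu> (strip (t, r, u)) = measure \<nu> (strip (t, r, u)))"
    proof (rule ccontr)
      assume no: "\<not> ?thesis"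
      have "AE r in lborel. r \<notin> {0<..(1::real)}"
        using ae
      proof eventually_elim
        case (elim r)
        show ?case
        proof
          assume "r \<in> {0<..1}"
          then have "0 < r" "r \<le> 1" by auto
          then have "AE u in lborel. measure \<mu> (strip (t, r, u)) = measure \<nu> (strip (t, r, u))" using elim by simp
          then show False using no \<open>0 < r\<close> \<open>r \<le> 1\<close> by blast
        qed
      qed
      then have "{0<..(1::real)} \<in> null_sets lborel" by (simp add: AE_iff_null_sets)
      then show False by (simp add: null_sets_def)
    qed
    then obtain r where r: "0 < r" and ru: "AE u in lborel. measure \<mu> (strip (t, r, u)) = measure \<nu> (strip (t, r, u))" by blast
    have meas: "measure (distr M borel (\<lambda>z. Im (z * cis (- t)))) {u<..u+r} = measure M (strip (t, r, u))"
      if M: "sets M = sets borel" for M u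
    proof -
      note [measurable_cong] = M
      have sp: "space M = UNIV" using sets_eq_imp_space_eq[OF M] by simp
      have "(\<lambda>z. Im (z * cis (- t))) -` {u<..u+r} \<inter> space M = strip (t, r, u)"
        by (auto simp: strip_def sp simp del: times_complex.sel)
      then show ?thesis by (subst measure_distr) auto
    qed
    show ?case
    proof (rule real_distribution_eqI_intervals[OF _ _ r])
      show "real_distribution (distr \<mu> borel (\<lambda>z. Im (z * cis (- t))))"
        by (rule M.real_distribution_distr) measurable
      show "real_distribution (distr \<nu> borel (\<lambda>z. Im (z * cis (- t))))"
        by (rule N.real_distribution_distr) measurable
      show "AE u in lborel. measure (distr \<mu> borel (\<lambda>z. Im (z * cis (- t)))) {u<..u+r} = measure (distr \<nu> borel (\<lambda>z. Im (z * cis (- t)))) {u<..u+r}"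
        using ru by eventually_elim (simp only: meas[OF \<mu>(2)] meas[OF \<nu>(2)])
    qed
  qed
qed

end

section \<open>Comparison of energies\<close>

lemma integral_pair_fst:
  fixes f :: "'a \<Rightarrow> real"
  assumes "prob_space \<alpha>" "prob_space \<beta>" and [measurable]: "f \<in> borel_measurable \<alpha>"
  shows "integrable (\<alpha> \<Otimes>\<^sub>M \<beta>) (\<lambda>p. f (fst p)) \<longleftrightarrow> integrable \<alpha> f" "(\<integral>p. f (fst p) \<partial>(\<alpha> \<Otimes>\<^sub>M \<beta>)) = (\<integral>z. f z \<partial>\<alpha>)"
proof -
  interpret B: prob_space \<beta> by fact
  have "integrable (distr (\<alpha> \<Otimes>\<^sub>M \<beta>) \<alpha> fst) f \<longleftrightarrow> integrable (\<alpha> \<Otimes>\<^sub>M \<beta>) (\<lambda>p. f (fst p))" by (rule integrable_distr_eq) measurable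
  then show "integrable (\<alpha> \<Otimes>\<^sub>M \<beta>) (\<lambda>p. f (fst p)) \<longleftrightarrow> integrable \<alpha> f" by (simp add: B.distr_pair_fst)
  have "(\<integral>z. f z \<partial>distr (\<alpha> \<Otimes>\<^sub>M \<beta>) \<alpha> fst) = (\<integral>p. f (fst p) \<partial>(\<alpha> \<Otimes>\<^sub>M \<beta>))" by (rule integral_distr) measurable
  then show "(\<integral>p. f (fst p) \<partial>(\<alpha> \<Otimes>\<^sub>M \<beta>)) = (\<integral>z. f z \<partial>\<alpha>)" by (simp add: B.distr_pair_fst)
qed

lemma integral_pair_snd:
  fixes f :: "'a \<Rightarrow> real"
  assumes a: "prob_space \<alpha>" and b: "prob_space \<beta>" and [measurable]: "f \<in> borel_measurable \<beta>"
  shows "integrable (\<alpha> \<Otimes>\<^sub>M \<beta>) (\<lambda>p. f (snd p)) \<longleftrightarrow> integrable \<beta> f" "(\<integral>p. f (snd p) \<partial>(\<alpha> \<Otimes>\<^sub>M \<beta>)) = (\<integral>z. f z \<partial>\<beta>)"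
proof -
  interpret A: prob_space \<alpha> by fact
  interpret B: prob_space \<beta> by fact
  interpret P: pair_sigma_finite \<beta> \<alpha> by unfold_locales
  interpret Q: pair_sigma_finite \<alpha> \<beta> by unfold_locales
  show "integrable (\<alpha> \<Otimes>\<^sub>M \<beta>) (\<lambda>p. f (snd p)) \<longleftrightarrow> integrable \<beta> f"
    using P.integrable_product_swap_iff[of "\<lambda>p. f (fst p)"] integral_pair_fst(1)[OF b a, of f] by (simp add: case_prod_unfold)
  show "(\<integral>p. f (snd p) \<partial>(\<alpha> \<Otimes>\<^sub>M \<beta>)) = (\<integral>z. f z \<partial>\<beta>)"
    using P.integral_product_swap[of "\<lambda>p. f (fst p)"] integral_pair_fst(2)[OF b a, of f] by (simp add: case_prod_unfold)
qed

text \<open>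
  The balance condition is the Euler-Lagrange condition on the ellipse, expressed by its half-widths.
\<close>

locale confined_kernel = projected_kernel +
  fixes a b \<phi> :: real
  assumes a: "0 < a" "a \<le> 2" and b: "0 < b" "b \<le> 2"
    and \<kappa>_bound: "\<And>z. z \<noteq> 0 \<Longrightarrow> \<bar>\<kappa> z\<bar> \<le> 1"
    and balance: "\<And>z. (\<integral>t. g t * ((Im (z * cis (- t)))\<^sup>2 / (width a b \<phi> t)\<^sup>2) \<partial>angles) = (norm z)\<^sup>2 / 2"
begin

definition confinement :: "complex \<times> complex \<Rightarrow> real" where "confinement p = ((norm (fst p))\<^sup>2 + (norm (snd p))\<^sup>2) / 2"
definition energy_density :: "complex \<times> complex \<Rightarrow> real" where "energy_density p = pair_potential (fst p - snd p) + confinement p"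

lemma confinement_measurable [measurable]: "confinement \<in> borel_measurable (borel \<Otimes>\<^sub>M borel)"
  unfolding confinement_def[abs_def] by measurable

lemma energy_density_measurable [measurable]: "energy_density \<in> borel_measurable (borel \<Otimes>\<^sub>M borel)"
  unfolding energy_density_def[abs_def] by measurable

lemma confinement_nonneg: "0 \<le> confinement p" by (simp add: confinement_def)

lemma norm_diff_le_confinement: "norm (fst p - snd p) \<le> confinement p + 1"
proof -
  have "norm z \<le> (norm z)\<^sup>2 / 2 + 1 / 2" for z :: complex
    using sum_squares_ge_zero[of "norm z - 1" 0] by (simp add: power2_eq_square algebra_simps)
  from this[of "fst p"] this[of "snd p"] norm_triangle_ineq4[of "fst p" "snd p"]
  show ?thesis unfolding confinement_def by (simp add: add_divide_distrib)
qed

text \<open>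
  Half of the confinement absorbs the logarithm at large distances, and the other half remains to control
  the second moment.
\<close>

lemma energy_density_lower: assumes "fst p \<noteq> snd p" shows "confinement p / 2 - 3 \<le> energy_density p"
proof -
  let ?d = "norm (fst p - snd p)"
  have d: "0 < ?d" using assms by simp
  have "ln (?d / 2) \<le> ?d / 2 - 1" using d by (intro ln_le_minus_one) simp
  moreover have "ln (?d / 2) = ln ?d - ln 2" using d by (intro ln_divide_pos) auto
  moreover have "ln 2 \<le> (2::real) - 1" by (rule ln_le_minus_one) simp
  ultimately have l: "ln ?d \<le> ?d / 2" by linarith
  have "?d \<le> confinement p + 1" by (rule norm_diff_le_confinement)
  then have "ln ?d \<le> confinement p / 2 + 1 / 2" using l by linarith
  moreover have "\<bar>\<kappa> (fst p - snd p)\<bar> \<le> 1" using assms by (intro \<kappa>_bound) simp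
  ultimately show ?thesis by (simp add: energy_density_def pair_potential_def)
qed

abbreviation integrand :: "complex \<times> complex \<Rightarrow> ereal" where
  "integrand \<equiv> (\<lambda>(z, w). W \<kappa> (z - w) + ereal (((norm z)\<^sup>2 + (norm w)\<^sup>2) / 2))"

lemma integrand_eq: "integrand p = (if fst p = snd p then \<infinity> else ereal (energy_density p))"
  by (cases p) (simp add: W_def energy_density_def pair_potential_def confinement_def)

lemma e2ennreal_integrand: "e2ennreal (integrand p) = (if fst p = snd p then \<infinity> else ennreal (energy_density p))"
  "e2ennreal (- integrand p) = (if fst p = snd p then 0 else ennreal (- energy_density p))"
  unfolding integrand_eq by (simp_all add: e2ennreal_neg)

lemma energy_eq:
  assumes \<mu>: "prob_space \<mu>" "sets \<mu> = sets borel" and off: "AE p in \<mu> \<Otimes>\<^sub>M \<mu>. fst p \<noteq> snd p" and energy_density: "integrable (\<mu> \<Otimes>\<^sub>M \<mu>) energy_density"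
  shows "energy \<kappa> \<mu> = ereal (\<integral>p. energy_density p \<partial>(\<mu> \<Otimes>\<^sub>M \<mu>))"
proof -
  have 1: "(\<integral>\<^sup>+p. e2ennreal (integrand p) \<partial>(\<mu> \<Otimes>\<^sub>M \<mu>)) = (\<integral>\<^sup>+p. ennreal (energy_density p) \<partial>(\<mu> \<Otimes>\<^sub>M \<mu>))"
    by (rule nn_integral_cong_AE) (use off in \<open>eventually_elim, simp only: e2ennreal_integrand if_False\<close>)
  have 2: "(\<integral>\<^sup>+p. e2ennreal (- integrand p) \<partial>(\<mu> \<Otimes>\<^sub>M \<mu>)) = (\<integral>\<^sup>+p. ennreal (- energy_density p) \<partial>(\<mu> \<Otimes>\<^sub>M \<mu>))"
    by (rule nn_integral_cong_AE) (use off in \<open>eventually_elim, simp only: e2ennreal_integrand if_False\<close>)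
  obtain x where x: "(\<integral>\<^sup>+p. ennreal (energy_density p) \<partial>(\<mu> \<Otimes>\<^sub>M \<mu>)) = ennreal x" "0 \<le> x"
    using energy_density unfolding real_integrable_def by (cases "\<integral>\<^sup>+p. ennreal (energy_density p) \<partial>(\<mu> \<Otimes>\<^sub>M \<mu>)") auto
  obtain y where y: "(\<integral>\<^sup>+p. ennreal (- energy_density p) \<partial>(\<mu> \<Otimes>\<^sub>M \<mu>)) = ennreal y" "0 \<le> y"
    using energy_density unfolding real_integrable_def by (cases "\<integral>\<^sup>+p. ennreal (- energy_density p) \<partial>(\<mu> \<Otimes>\<^sub>M \<mu>)") auto
  show ?thesis
    unfolding energy_def ereal_integral_def 1 2 real_lebesgue_integral_def[OF energy_density] x y using x(2) y(2) by simp
qed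

text \<open>
  The integrand is infinite on the diagonal and bounded from below. A finite energy therefore
  makes the diagonal a null set and, by \<open>energy_density_lower\<close>, bounds the second moment, so that
  interaction and confinement are integrable separately.
\<close>

lemma energy_finite:
  assumes \<mu>: "prob_space \<mu>" "sets \<mu> = sets borel" and fin: "energy \<kappa> \<mu> < \<infinity>"
  shows "admissible \<mu> \<mu>" "integrable (\<mu> \<Otimes>\<^sub>M \<mu>) energy_density" "integrable (\<mu> \<Otimes>\<^sub>M \<mu>) confinement" "integrable (\<mu> \<Otimes>\<^sub>M \<mu>) (\<lambda>p. pair_potential (fst p - snd p))"
proof -
  interpret M: prob_space \<mu> by fact
  interpret MM: pair_prob_space \<mu> \<mu> by unfold_locales
  note [measurable_cong] = \<mu>(2)
  have neg: "(\<integral>\<^sup>+p. e2ennreal (- integrand p) \<partial>(\<mu> \<Otimes>\<^sub>M \<mu>)) \<le> (\<integral>\<^sup>+p. ennreal 3 \<partial>(\<mu> \<Otimes>\<^sub>M \<mu>))"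
  proof (rule nn_integral_mono)
    fix p
    show "e2ennreal (- integrand p) \<le> ennreal 3"
      unfolding e2ennreal_integrand using energy_density_lower[of p] confinement_nonneg[of p] by (auto intro!: ennreal_leI simp del: ennreal_numeral)
  qed
  also have "\<dots> = ennreal 3" using MM.emeasure_space_1 by simp
  finally have neg3: "(\<integral>\<^sup>+p. e2ennreal (- integrand p) \<partial>(\<mu> \<Otimes>\<^sub>M \<mu>)) \<le> ennreal 3" .
  have pos: "(\<integral>\<^sup>+p. e2ennreal (integrand p) \<partial>(\<mu> \<Otimes>\<^sub>M \<mu>)) \<noteq> \<infinity>"
  proof
    assume i: "(\<integral>\<^sup>+p. e2ennreal (integrand p) \<partial>(\<mu> \<Otimes>\<^sub>M \<mu>)) = \<infinity>"
    obtain y where y: "(\<integral>\<^sup>+p. e2ennreal (- integrand p) \<partial>(\<mu> \<Otimes>\<^sub>M \<mu>)) = ennreal y" "0 \<le> y"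
      using neg3 by (cases "\<integral>\<^sup>+p. e2ennreal (- integrand p) \<partial>(\<mu> \<Otimes>\<^sub>M \<mu>)") (auto simp: top_unique)
    have "energy \<kappa> \<mu> = \<infinity>" unfolding energy_def ereal_integral_def i y using y(2) by simp
    then show False using fin by simp
  qed
  have me: "(\<lambda>p. e2ennreal (integrand p)) \<in> borel_measurable (\<mu> \<Otimes>\<^sub>M \<mu>)" unfolding e2ennreal_integrand by measurable
  have off: "AE p in \<mu> \<Otimes>\<^sub>M \<mu>. fst p \<noteq> snd p"
    using nn_integral_PInf_AE[OF me pos] by eventually_elim (auto simp: e2ennreal_integrand)
  have meas: "energy_density \<in> borel_measurable (\<mu> \<Otimes>\<^sub>M \<mu>)" "confinement \<in> borel_measurable (\<mu> \<Otimes>\<^sub>M \<mu>)"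
     "(\<lambda>p. norm (fst p - snd p)) \<in> borel_measurable (\<mu> \<Otimes>\<^sub>M \<mu>)" by measurable
  have 1: "(\<integral>\<^sup>+p. e2ennreal (integrand p) \<partial>(\<mu> \<Otimes>\<^sub>M \<mu>)) = (\<integral>\<^sup>+p. ennreal (energy_density p) \<partial>(\<mu> \<Otimes>\<^sub>M \<mu>))"
    by (rule nn_integral_cong_AE) (use off in \<open>eventually_elim, simp only: e2ennreal_integrand if_False\<close>)
  have 2: "(\<integral>\<^sup>+p. e2ennreal (- integrand p) \<partial>(\<mu> \<Otimes>\<^sub>M \<mu>)) = (\<integral>\<^sup>+p. ennreal (- energy_density p) \<partial>(\<mu> \<Otimes>\<^sub>M \<mu>))"
    by (rule nn_integral_cong_AE) (use off in \<open>eventually_elim, simp only: e2ennreal_integrand if_False\<close>)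
  show energy_density: "integrable (\<mu> \<Otimes>\<^sub>M \<mu>) energy_density"
    unfolding real_integrable_def using meas(1) pos neg3 unfolding 1 2 by (auto simp: top_unique)
  have "integrable (\<mu> \<Otimes>\<^sub>M \<mu>) (\<lambda>p. 2 * (energy_density p + 3))" using energy_density by simp
  then show V: "integrable (\<mu> \<Otimes>\<^sub>M \<mu>) confinement"
  proof (rule Bochner_Integration.integrable_bound[OF _ meas(2)])
    show "AE p in \<mu> \<Otimes>\<^sub>M \<mu>. norm (confinement p) \<le> norm (2 * (energy_density p + 3))"
      using off
    proof eventually_elim
      case (elim p)
      have "confinement p \<le> 2 * (energy_density p + 3)" using energy_density_lower[OF elim] by simp
      then show ?case using confinement_nonneg[of p] by simp
    qed
  qed
  have "integrable (\<mu> \<Otimes>\<^sub>M \<mu>) (\<lambda>p. energy_density p - confinement p)" using energy_density V by simp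
  then show "integrable (\<mu> \<Otimes>\<^sub>M \<mu>) (\<lambda>p. pair_potential (fst p - snd p))" by (simp add: energy_density_def)
  have "integrable (\<mu> \<Otimes>\<^sub>M \<mu>) (\<lambda>p. confinement p + 1)" using V by simp
  then have "integrable (\<mu> \<Otimes>\<^sub>M \<mu>) (\<lambda>p. norm (fst p - snd p))"
  proof (rule Bochner_Integration.integrable_bound[OF _ meas(3)])
    show "AE p in \<mu> \<Otimes>\<^sub>M \<mu>. norm (norm (fst p - snd p)) \<le> norm (confinement p + 1)"
      using norm_diff_le_confinement confinement_nonneg by (intro AE_I2) (simp add: abs_of_nonneg)
  qed
  then show "admissible \<mu> \<mu>" using \<mu> off by (simp add: admissible_def)
qed

lemma integral_confinement:
  assumes \<alpha>: "prob_space \<alpha>" "sets \<alpha> = sets borel" and \<beta>: "prob_space \<beta>" "sets \<beta> = sets borel"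
    and i: "integrable \<alpha> (\<lambda>z. (norm z)\<^sup>2)" "integrable \<beta> (\<lambda>z. (norm z)\<^sup>2)"
  shows "integrable (\<alpha> \<Otimes>\<^sub>M \<beta>) confinement" "(\<integral>p. confinement p \<partial>(\<alpha> \<Otimes>\<^sub>M \<beta>)) = ((\<integral>z. (norm z)\<^sup>2 \<partial>\<alpha>) + (\<integral>z. (norm z)\<^sup>2 \<partial>\<beta>)) / 2"
proof -
  note [measurable_cong] = \<alpha>(2) \<beta>(2)
  have meas: "(\<lambda>z. (norm z)\<^sup>2) \<in> borel_measurable \<alpha>" "(\<lambda>z. (norm z)\<^sup>2) \<in> borel_measurable \<beta>" by measurable
  have f: "integrable (\<alpha> \<Otimes>\<^sub>M \<beta>) (\<lambda>p. (norm (fst p))\<^sup>2)" "(\<integral>p. (norm (fst p))\<^sup>2 \<partial>(\<alpha> \<Otimes>\<^sub>M \<beta>)) = (\<integral>z. (norm z)\<^sup>2 \<partial>\<alpha>)"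
    using integral_pair_fst[OF \<alpha>(1) \<beta>(1) meas(1)] i by auto
  have s: "integrable (\<alpha> \<Otimes>\<^sub>M \<beta>) (\<lambda>p. (norm (snd p))\<^sup>2)" "(\<integral>p. (norm (snd p))\<^sup>2 \<partial>(\<alpha> \<Otimes>\<^sub>M \<beta>)) = (\<integral>z. (norm z)\<^sup>2 \<partial>\<beta>)"
    using integral_pair_snd[OF \<alpha>(1) \<beta>(1) meas(2)] i by auto
  show "integrable (\<alpha> \<Otimes>\<^sub>M \<beta>) confinement" unfolding confinement_def[abs_def] using f(1) s(1) by simp
  show "(\<integral>p. confinement p \<partial>(\<alpha> \<Otimes>\<^sub>M \<beta>)) = ((\<integral>z. (norm z)\<^sup>2 \<partial>\<alpha>) + (\<integral>z. (norm z)\<^sup>2 \<partial>\<beta>)) / 2"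
    unfolding confinement_def[abs_def] using f s by simp
qed

lemma second_moment:
  assumes \<mu>: "prob_space \<mu>" "sets \<mu> = sets borel" and V: "integrable (\<mu> \<Otimes>\<^sub>M \<mu>) confinement"
  shows "integrable \<mu> (\<lambda>z. (norm z)\<^sup>2)"
proof -
  note [measurable_cong] = \<mu>(2)
  have "integrable (\<mu> \<Otimes>\<^sub>M \<mu>) (\<lambda>p. 2 * confinement p)" using V by simp
  then have "integrable (\<mu> \<Otimes>\<^sub>M \<mu>) (\<lambda>p. (norm (fst p))\<^sup>2)"
    by (rule Bochner_Integration.integrable_bound) (measurable, auto simp: confinement_def)
  moreover have "(\<lambda>z. (norm z)\<^sup>2) \<in> borel_measurable \<mu>" by measurable
  ultimately show ?thesis using integral_pair_fst(1)[OF \<mu>(1) \<mu>(1)] by blast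
qed

abbreviation ellipse_law :: "complex measure" where "ellipse_law \<equiv> unif a b \<phi>"

lemma ellipse_law_prob: "prob_space ellipse_law" and ellipse_law_sets: "sets ellipse_law = sets borel"
  using prob_space_unif[OF a(1) b(1)] by simp_all

lemma ellipse_law_bounded: "AE z in ellipse_law. norm z \<le> 2"
  using AE_unif_mem by eventually_elim (rule ellipse_bounded[OF a b])

lemma ellipse_law_second_moment: "integrable ellipse_law (\<lambda>z. (norm z)\<^sup>2)"
proof -
  interpret prob_space ellipse_law by (rule ellipse_law_prob)
  show ?thesis
  proof (rule integrable_const_bound[where B=4])
    show "AE z in ellipse_law. norm ((norm z)\<^sup>2) \<le> 4"
      using ellipse_law_bounded
    proof eventually_elim
      case (elim z)
      have "(norm z)\<^sup>2 \<le> 2\<^sup>2" by (rule power_mono[OF elim]) simp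
      then show ?case by simp
    qed
  qed simp
qed

lemma admissible_ellipse_law:
  assumes \<mu>: "prob_space \<mu>" "sets \<mu> = sets borel" and V: "integrable \<mu> (\<lambda>z. (norm z)\<^sup>2)"
  shows "admissible \<mu> ellipse_law"
proof -
  interpret M: prob_space \<mu> by fact
  interpret U: prob_space ellipse_law by (rule ellipse_law_prob)
  interpret P: pair_prob_space \<mu> ellipse_law by unfold_locales
  note [measurable_cong] = \<mu>(2)
  have off: "AE p in \<mu> \<Otimes>\<^sub>M ellipse_law. fst p \<noteq> snd p"
  proof (rule P.AE_pair_measure)
    show "{p \<in> space (\<mu> \<Otimes>\<^sub>M ellipse_law). fst p \<noteq> snd p} \<in> sets (\<mu> \<Otimes>\<^sub>M ellipse_law)" by measurable
    show "AE x in \<mu>. AE y in ellipse_law. fst (x, y) \<noteq> snd (x, y)"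
    proof (rule AE_I2)
      fix x
      show "AE y in ellipse_law. fst (x, y) \<noteq> snd (x, y)"
        using AE_unif_neq[of x a b \<phi>] by eventually_elim auto
    qed
  qed
  have "integrable (\<mu> \<Otimes>\<^sub>M ellipse_law) (\<lambda>p. confinement p + 1)"
    using integral_confinement(1)[OF \<mu> ellipse_law_prob ellipse_law_sets V ellipse_law_second_moment] by simp
  then have "integrable (\<mu> \<Otimes>\<^sub>M ellipse_law) (\<lambda>p. norm (fst p - snd p))"
    by (rule Bochner_Integration.integrable_bound)
       (measurable, use norm_diff_le_confinement confinement_nonneg in \<open>auto intro!: AE_I2 simp: abs_of_nonneg\<close>)
  then show ?thesis using \<mu> ellipse_law_prob ellipse_law_sets off by (simp add: admissible_def)
qed

definition pot :: "complex \<Rightarrow> real" where "pot z = (\<integral>w. pair_potential (z - w) \<partial>ellipse_law)"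

lemma pot_euler_lagrange:
  "\<exists>C. (\<forall>z. C \<le> pot z + (norm z)\<^sup>2 / 2) \<and> (\<forall>z\<in>ellipse a b \<phi>. pot z + (norm z)\<^sup>2 / 2 = C)"
  unfolding pot_def by (rule ellipse_euler_lagrange[OF a b balance]) blast

text \<open>
  Integrating first over one variable gives, up to constants, the potential plus \<open>\<bar>z\<bar>\<^sup>2 / 2\<close>, which is constant
  on the ellipse.
\<close>

lemma integrable_pair_potential_ellipse_law: "integrable (ellipse_law \<Otimes>\<^sub>M ellipse_law) (\<lambda>p. pair_potential (fst p - snd p))"
proof -
  interpret U: prob_space ellipse_law by (rule ellipse_law_prob)
  interpret P: pair_prob_space ellipse_law ellipse_law by unfold_locales
  obtain C where C: "\<And>z. z \<in> ellipse a b \<phi> \<Longrightarrow> pot z + (norm z)\<^sup>2 / 2 = C"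
    using pot_euler_lagrange by blast
  note adm = admissible_ellipse_law[OF ellipse_law_prob ellipse_law_sets ellipse_law_second_moment]
  have off: "AE p in ellipse_law \<Otimes>\<^sub>M ellipse_law. fst p \<noteq> snd p" using adm by (simp add: admissible_def)
  let ?s = "\<integral>w. (norm w)\<^sup>2 / 2 \<partial>ellipse_law"
  have iw: "integrable ellipse_law (\<lambda>w. energy_density (z, w) + 3)" "(\<integral>w. energy_density (z, w) + 3 \<partial>ellipse_law) = pot z + (norm z)\<^sup>2 / 2 + ?s + 3" for z
    unfolding energy_density_def confinement_def pot_def using ellipse_potential(1)[OF a b, of \<phi> z] ellipse_law_second_moment U.prob_space
    by (simp_all add: add_divide_distrib)
  have nn: "AE p in ellipse_law \<Otimes>\<^sub>M ellipse_law. 0 \<le> energy_density p + 3"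
    using off
  proof eventually_elim
    case (elim p)
    show ?case using energy_density_lower[OF elim] confinement_nonneg[of p] by linarith
  qed
  have "(\<integral>\<^sup>+p. ennreal (energy_density p + 3) \<partial>(ellipse_law \<Otimes>\<^sub>M ellipse_law)) = (\<integral>\<^sup>+z. \<integral>\<^sup>+w. ennreal (energy_density (z, w) + 3) \<partial>ellipse_law \<partial>ellipse_law)"
    by (rule U.nn_integral_fst[symmetric]) measurable
  also have "\<dots> = (\<integral>\<^sup>+z. ennreal (C + ?s + 3) \<partial>ellipse_law)"
  proof (rule nn_integral_cong_AE)
    show "AE z in ellipse_law. (\<integral>\<^sup>+w. ennreal (energy_density (z, w) + 3) \<partial>ellipse_law) = ennreal (C + ?s + 3)"
      using P.AE_pair[OF nn] AE_unif_mem[of a b \<phi>]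
    proof eventually_elim
      case (elim z)
      show ?case using nn_integral_eq_integral[OF iw(1) elim(1)] C[OF elim(2)] by (simp add: iw(2))
    qed
  qed
  also have "\<dots> < \<infinity>" using U.emeasure_space_1 by simp
  finally have "integrable (ellipse_law \<Otimes>\<^sub>M ellipse_law) (\<lambda>p. energy_density p + 3)"
    by (intro integrableI_nonneg nn) (measurable)
  moreover have "integrable (ellipse_law \<Otimes>\<^sub>M ellipse_law) confinement" by (rule integral_confinement(1)[OF ellipse_law_prob ellipse_law_sets ellipse_law_prob ellipse_law_sets ellipse_law_second_moment ellipse_law_second_moment])
  ultimately have "integrable (ellipse_law \<Otimes>\<^sub>M ellipse_law) (\<lambda>p. (energy_density p + 3) - confinement p - 3)" by (intro Bochner_Integration.integrable_diff) auto
  then show ?thesis by (simp add: energy_density_def)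
qed

text \<open>
  Write \<open>\<mu>\<close> as the ellipse law plus a difference. The quadratic term in the difference
  is at least the discrepancy; the linear term is twice the integral of the potential plus \<open>\<bar>z\<bar>\<^sup>2 / 2\<close> against
  the difference, which is nonnegative because this function is minimal on the ellipse.
\<close>

theorem minimal_energy:
  assumes \<mu>: "prob_space \<mu>" "sets \<mu> = sets borel" and fin: "energy \<kappa> \<mu> < \<infinity>"
  shows "energy \<kappa> ellipse_law + enn2ereal (discrepancy 1 \<mu> ellipse_law) \<le> energy \<kappa> \<mu>"
proof -
  interpret M: prob_space \<mu> by fact
  interpret U: prob_space ellipse_law by (rule ellipse_law_prob)
  interpret P: pair_prob_space \<mu> ellipse_law by unfold_locales
  interpret Q: pair_prob_space ellipse_law ellipse_law by unfold_locales
  note [measurable_cong] = \<mu>(2)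
  note E = energy_finite[OF \<mu> fin]
  have mom: "integrable \<mu> (\<lambda>z. (norm z)\<^sup>2)" by (rule second_moment[OF \<mu> E(3)])
  note adm = E(1) admissible_ellipse_law[OF \<mu> mom] admissible_ellipse_law[OF ellipse_law_prob ellipse_law_sets ellipse_law_second_moment]
  note PD = interaction_positive_definite[OF adm E(4) integrable_pair_potential_ellipse_law]
  obtain C where C: "\<And>z. C \<le> pot z + (norm z)\<^sup>2 / 2" "\<And>z. z \<in> ellipse a b \<phi> \<Longrightarrow> pot z + (norm z)\<^sup>2 / 2 = C"
    using pot_euler_lagrange by blast
  let ?s = "\<lambda>\<nu>. \<integral>z. (norm z)\<^sup>2 \<partial>\<nu>"
  have I\<mu>: "energy \<kappa> \<mu> = ereal (mutual_energy \<mu> \<mu> + ?s \<mu>)"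
  proof -
    have "AE p in \<mu> \<Otimes>\<^sub>M \<mu>. fst p \<noteq> snd p" using E(1) by (simp add: admissible_def)
    moreover have "(\<integral>p. energy_density p \<partial>(\<mu> \<Otimes>\<^sub>M \<mu>)) = mutual_energy \<mu> \<mu> + ?s \<mu>"
      unfolding energy_density_def mutual_energy_def using E(3,4) integral_confinement(2)[OF \<mu> \<mu> mom mom] by simp
    ultimately show ?thesis using energy_eq[OF \<mu> _ E(2)] by simp
  qed
  have I_ell: "energy \<kappa> ellipse_law = ereal (mutual_energy ellipse_law ellipse_law + ?s ellipse_law)"
  proof -
    have "AE p in ellipse_law \<Otimes>\<^sub>M ellipse_law. fst p \<noteq> snd p" using adm(3) by (simp add: admissible_def)
    moreover have V: "integrable (ellipse_law \<Otimes>\<^sub>M ellipse_law) confinement" "(\<integral>p. confinement p \<partial>(ellipse_law \<Otimes>\<^sub>M ellipse_law)) = ?s ellipse_law"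
      using integral_confinement[OF ellipse_law_prob ellipse_law_sets ellipse_law_prob ellipse_law_sets ellipse_law_second_moment ellipse_law_second_moment] by auto
    moreover have "integrable (ellipse_law \<Otimes>\<^sub>M ellipse_law) energy_density" unfolding energy_density_def[abs_def] using V(1) integrable_pair_potential_ellipse_law by simp
    moreover have "(\<integral>p. energy_density p \<partial>(ellipse_law \<Otimes>\<^sub>M ellipse_law)) = mutual_energy ellipse_law ellipse_law + ?s ellipse_law"
      unfolding energy_density_def mutual_energy_def using V integrable_pair_potential_ellipse_law by simp
    ultimately show ?thesis using energy_eq[OF ellipse_law_prob ellipse_law_sets] by simp
  qed
  have J1: "mutual_energy \<mu> ellipse_law = (\<integral>z. pot z \<partial>\<mu>)" "integrable \<mu> pot"
    unfolding mutual_energy_def pot_def using P.integral_fst'[OF PD(1)] P.integrable_fst'[OF PD(1)] by auto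
  have J2: "mutual_energy ellipse_law ellipse_law = (\<integral>z. pot z \<partial>ellipse_law)" "integrable ellipse_law pot"
    unfolding mutual_energy_def pot_def using Q.integral_fst'[OF integrable_pair_potential_ellipse_law] Q.integrable_fst'[OF integrable_pair_potential_ellipse_law] by auto
  have "C - ?s \<mu> / 2 = (\<integral>z. C - (norm z)\<^sup>2 / 2 \<partial>\<mu>)" using mom M.prob_space by simp
  also have "\<dots> \<le> mutual_energy \<mu> ellipse_law" unfolding J1(1)
    by (rule integral_mono) (use mom J1(2) C(1) in \<open>auto simp: algebra_simps\<close>)
  finally have L: "C - ?s \<mu> / 2 \<le> mutual_energy \<mu> ellipse_law" .
  have "mutual_energy ellipse_law ellipse_law = (\<integral>z. C - (norm z)\<^sup>2 / 2 \<partial>ellipse_law)" unfolding J2(1)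
  proof (rule integral_cong_AE)
    show "AE z in ellipse_law. pot z = C - (norm z)\<^sup>2 / 2"
      using AE_unif_mem[of a b \<phi>] by eventually_elim (use C(2) in \<open>auto simp: algebra_simps\<close>)
  qed (use J2(2) in auto)
  also have "\<dots> = C - ?s ellipse_law / 2" using ellipse_law_second_moment U.prob_space by simp
  finally have R: "mutual_energy ellipse_law ellipse_law = C - ?s ellipse_law / 2" .
  have "mutual_energy ellipse_law ellipse_law + ?s ellipse_law + (mutual_energy \<mu> \<mu> - 2 * mutual_energy \<mu> ellipse_law + mutual_energy ellipse_law ellipse_law) \<le> mutual_energy \<mu> \<mu> + ?s \<mu>" using L R by linarith
  then have le: "ereal (mutual_energy ellipse_law ellipse_law + ?s ellipse_law) + ereal (mutual_energy \<mu> \<mu> - 2 * mutual_energy \<mu> ellipse_law + mutual_energy ellipse_law ellipse_law) \<le> ereal (mutual_energy \<mu> \<mu> + ?s \<mu>)" by simp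
  have "enn2ereal (discrepancy 1 \<mu> ellipse_law) \<le> enn2ereal (ennreal (mutual_energy \<mu> \<mu> - 2 * mutual_energy \<mu> ellipse_law + mutual_energy ellipse_law ellipse_law))"
    using PD(2) by (simp only: less_eq_ennreal.rep_eq)
  also have "\<dots> = ereal (mutual_energy \<mu> \<mu> - 2 * mutual_energy \<mu> ellipse_law + mutual_energy ellipse_law ellipse_law)" by (rule enn2ereal_ennreal[OF PD(3)])
  finally have "ereal (mutual_energy ellipse_law ellipse_law + ?s ellipse_law) + enn2ereal (discrepancy 1 \<mu> ellipse_law) \<le> ereal (mutual_energy ellipse_law ellipse_law + ?s ellipse_law) + ereal (mutual_energy \<mu> \<mu> - 2 * mutual_energy \<mu> ellipse_law + mutual_energy ellipse_law ellipse_law)"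
    by (rule add_left_mono)
  also note le
  finally show ?thesis unfolding I\<mu> I_ell .
qed

theorem unique_minimiser_ellipse_law: "unique_minimiser (energy \<kappa>) borel_prob_measures ellipse_law"
proof -
  have mP: "ellipse_law \<in> borel_prob_measures" using ellipse_law_prob ellipse_law_sets by (simp add: borel_prob_measures_def)
  have le: "energy \<kappa> ellipse_law \<le> energy \<kappa> \<mu>" if "\<mu> \<in> borel_prob_measures" for \<mu>
  proof (cases "energy \<kappa> \<mu> < \<infinity>")
    case True
    have "energy \<kappa> ellipse_law + 0 \<le> energy \<kappa> ellipse_law + enn2ereal (discrepancy 1 \<mu> ellipse_law)" by (intro add_left_mono) simp
    also have "\<dots> \<le> energy \<kappa> \<mu>" using that True by (intro minimal_energy) (auto simp: borel_prob_measures_def)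
    finally show ?thesis by simp
  qed simp
  have fin: "\<bar>energy \<kappa> ellipse_law\<bar> \<noteq> \<infinity>"
  proof -
    have adm: "admissible ellipse_law ellipse_law" by (rule admissible_ellipse_law[OF ellipse_law_prob ellipse_law_sets ellipse_law_second_moment])
    have "integrable (ellipse_law \<Otimes>\<^sub>M ellipse_law) energy_density"
      unfolding energy_density_def[abs_def]
      using integral_confinement(1)[OF ellipse_law_prob ellipse_law_sets ellipse_law_prob ellipse_law_sets ellipse_law_second_moment ellipse_law_second_moment] integrable_pair_potential_ellipse_law by simp
    then have "energy \<kappa> ellipse_law = ereal (\<integral>p. energy_density p \<partial>(ellipse_law \<Otimes>\<^sub>M ellipse_law))"
      using adm by (intro energy_eq ellipse_law_prob ellipse_law_sets) (auto simp: admissible_def)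
    then show ?thesis by simp
  qed
  have uniq: "\<mu> = ellipse_law" if \<mu>: "\<mu> \<in> borel_prob_measures" and min: "energy \<kappa> \<mu> \<le> energy \<kappa> ellipse_law" for \<mu>
  proof -
    obtain x where x: "energy \<kappa> ellipse_law = ereal x" using fin by (cases "energy \<kappa> ellipse_law") auto
    have "energy \<kappa> \<mu> < \<infinity>" by (rule order_le_less_trans[OF min]) (simp add: x)
    moreover have p: "prob_space \<mu>" "sets \<mu> = sets borel" using \<mu> by (auto simp: borel_prob_measures_def)
    ultimately have "energy \<kappa> ellipse_law + enn2ereal (discrepancy 1 \<mu> ellipse_law) \<le> energy \<kappa> ellipse_law"
      using minimal_energy[OF p] min order_trans by blast
    then have "enn2ereal (discrepancy 1 \<mu> ellipse_law) \<le> 0"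
      unfolding x by (cases "enn2ereal (discrepancy 1 \<mu> ellipse_law)") auto
    then have "enn2ereal (discrepancy 1 \<mu> ellipse_law) = enn2ereal 0"
      using enn2ereal_nonneg[of "discrepancy 1 \<mu> ellipse_law"] by (simp add: zero_ennreal.rep_eq)
    then have "discrepancy 1 \<mu> ellipse_law = 0" by (simp only: enn2ereal_inject)
    then show ?thesis by (rule discrepancy_zero[OF p ellipse_law_prob ellipse_law_sets ellipse_law_bounded])
  qed
  show ?thesis unfolding unique_minimiser_def is_arg_min_def using mP le uniq by (auto simp: not_less)
qed

end

section \<open>Existence and uniqueness of the minimiser\<close>

lemma borel_measurable_continuous_off_0:
  fixes \<kappa> :: "complex \<Rightarrow> real"
  assumes "continuous_on (- {0}) \<kappa>"
  shows "\<kappa> \<in> borel_measurable borel"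
proof -
  have [measurable]: "(\<lambda>z. indicator (- {0}) z *\<^sub>R \<kappa> z) \<in> borel_measurable borel"
    by (rule borel_measurable_continuous_on_indicator[OF _ assms]) auto
  have "\<kappa> = (\<lambda>z. indicator (- {0}) z *\<^sub>R \<kappa> z + indicator {0} z *\<^sub>R \<kappa> 0)"
    by (auto simp: fun_eq_iff indicator_def)
  also have "\<dots> \<in> borel_measurable borel" by measurable
  finally show ?thesis .
qed

text \<open>
  The modulus of \<open>w\<close> fixes the shape of the ellipse and half its argument the direction of an axis: the
  squared semi-axes are \<open>1 - \<bar>w\<bar>\<close> and \<open>1 + \<bar>w\<bar>\<close>.
\<close>

lemma width_realises_parameter:
  assumes w: "norm w \<le> 1 / 2"
  defines "a \<equiv> sqrt (1 - norm w)" and "b \<equiv> sqrt (1 + norm w)" and "\<phi> \<equiv> Arg2pi w / 2"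
  shows "0 < a" "a \<le> 2" "0 < b" "b \<le> 2" "0 \<le> \<phi>" "\<phi> < 2 * pi"
    "(width a b \<phi> t)\<^sup>2 = 1 + Re (cnj w * cis (2 * t))"
proof -
  show "0 < a" "0 < b" using w norm_ge_zero[of w] unfolding a_def b_def by (auto intro: add_pos_nonneg)
  have "1 - norm w \<le> 2\<^sup>2" "1 + norm w \<le> 2\<^sup>2" using w norm_ge_zero[of w] unfolding power2_eq_square by linarith+
  then show "a \<le> 2" "b \<le> 2" unfolding a_def b_def by (simp_all add: real_le_lsqrt)
  show "0 \<le> \<phi>" "\<phi> < 2 * pi" using Arg2pi_ge_0[of w] Arg2pi_lt_2pi[of w] unfolding \<phi>_def by auto
  have ab: "a\<^sup>2 = 1 - norm w" "b\<^sup>2 = 1 + norm w" using w norm_ge_zero[of w] by (auto simp: a_def b_def)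
  have "w = of_real (norm w) * cis (2 * \<phi>)"
    using Arg2pi_eq[of w] by (simp add: \<phi>_def cis_conv_exp mult.commute)
  then have "cnj w * cis (2 * t) = of_real (norm w) * cis (2 * t - 2 * \<phi>)"
    by (metis (no_types, lifting) cis_cnj cis_mult complex_cnj_complex_of_real complex_cnj_mult mult.assoc uminus_add_conv_diff)
  then have "Re (cnj w * cis (2 * t)) = norm w * cos (2 * (\<phi> - t))"
    by (simp add: right_diff_distrib cos_diff mult.commute)
  moreover have "cos (2 * (\<phi> - t)) = (cos (\<phi> - t))\<^sup>2 - (sin (\<phi> - t))\<^sup>2" by (rule cos_double)
  moreover have "(sin (\<phi> - t))\<^sup>2 + (cos (\<phi> - t))\<^sup>2 = 1" by simp
  moreover have "(width a b \<phi> t)\<^sup>2 = (1 - norm w) * (sin (\<phi> - t))\<^sup>2 + (1 + norm w) * (cos (\<phi> - t))\<^sup>2"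
  proof -
    have "(width a b \<phi> t)\<^sup>2 = (a * sin (\<phi> - t))\<^sup>2 + (b * cos (\<phi> - t))\<^sup>2" by (simp add: width_def)
    then show ?thesis by (simp only: power_mult_distrib ab)
  qed
  ultimately show "(width a b \<phi> t)\<^sup>2 = 1 + Re (cnj w * cis (2 * t))" by (simp only:) (simp add: algebra_simps)
qed

theorem theorem1p1:
  "\<exists>\<epsilon>\<^sub>0>0. \<forall>\<kappa> :: complex \<Rightarrow> real.
     even_off_0 \<kappa> \<longrightarrow> homogeneous_0 \<kappa> \<longrightarrow> C3_on (- {0}) \<kappa> \<longrightarrow>
     (\<forall>z. norm z = 1 \<longrightarrow>
        \<bar>\<kappa> z\<bar> \<le> \<epsilon>\<^sub>0 \<and>
        norm (nabla \<kappa> z) \<le> \<epsilon>\<^sub>0 \<and>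
        norm (nabla (nabla \<kappa>) z) \<le> \<epsilon>\<^sub>0 \<and>
        norm (nabla (nabla (nabla \<kappa>)) z) \<le> \<epsilon>\<^sub>0) \<longrightarrow>
     (\<exists>a b \<phi>. 0 < a \<and> 0 < b \<and> 0 \<le> \<phi> \<and> \<phi> < 2 * pi \<and>
        unique_minimiser (energy \<kappa>) borel_prob_measures
          (uniform_measure lborel (ellipse a b \<phi>)))"
proof -
  obtain e where e: "e > 0" and density: "\<And>\<kappa> :: complex \<Rightarrow> real.
    even_off_0 \<kappa> \<Longrightarrow> homogeneous_0 \<kappa> \<Longrightarrow> C3_on (- {0}) \<kappa> \<Longrightarrow>
    (\<And>z. norm z = 1 \<Longrightarrow> norm (nabla \<kappa> z) \<le> e \<and> norm (nabla (nabla \<kappa>) z) \<le> e) \<Longrightarrow>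
    (\<exists>g c. g \<in> borel_measurable borel \<and> (\<forall>t. \<bar>pi * g t - 1\<bar> \<le> 1 / 16) \<and> (\<integral>t. g t \<partial>angles) = 1 \<and>
       (\<forall>z. z \<noteq> 0 \<longrightarrow> integrable angles (\<lambda>t. g t * ln \<bar>Im (z * cis (- t))\<bar>) \<and>
         (\<integral>t. g t * ln \<bar>Im (z * cis (- t))\<bar> \<partial>angles) = ln (norm z) - \<kappa> z + c))"
    using angular_density[of "1 / 16"] by auto
  show ?thesis
  \<comment> \<open>The bound \<open>e\<close> makes the density positive and nearly constant; the bound \<open>1\<close> on \<open>\<kappa>\<close> enters \<open>energy_density_lower\<close>.\<close>
  proof (rule exI[of _ "min e 1"], intro conjI allI impI)
    show "0 < min e 1" using e by simp
    fix \<kappa> :: "complex \<Rightarrow> real"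
    assume ev: "even_off_0 \<kappa>" and hom: "homogeneous_0 \<kappa>" and C3: "C3_on (- {0}) \<kappa>"
      and bd: "\<forall>z. norm z = 1 \<longrightarrow> \<bar>\<kappa> z\<bar> \<le> min e 1 \<and> norm (nabla \<kappa> z) \<le> min e 1 \<and>
        norm (nabla (nabla \<kappa>) z) \<le> min e 1 \<and> norm (nabla (nabla (nabla \<kappa>)) z) \<le> min e 1"
    obtain g c where g: "g \<in> borel_measurable borel" "\<And>t. \<bar>pi * g t - 1\<bar> \<le> 1 / 16" "(\<integral>t. g t \<partial>angles) = 1"
      "\<And>z. z \<noteq> 0 \<Longrightarrow> integrable angles (\<lambda>t. g t * ln \<bar>Im (z * cis (- t))\<bar>)"
      "\<And>z. z \<noteq> 0 \<Longrightarrow> (\<integral>t. g t * ln \<bar>Im (z * cis (- t))\<bar> \<partial>angles) = ln (norm z) - \<kappa> z + c"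
      using density[OF ev hom C3] bd by auto
    obtain w where w: "norm w \<le> 1 / 2"
      "\<And>z. (\<integral>t. g t * ((Im (z * cis (- t)))\<^sup>2 / (1 + Re (cnj w * cis (2 * t)))) \<partial>angles) = (norm z)\<^sup>2 / 2"
      using ellipse_parameter[OF g(1-3)] by blast
    define a where "a = sqrt (1 - norm w)"
    define b where "b = sqrt (1 + norm w)"
    define \<phi> where "\<phi> = Arg2pi w / 2"
    note p = width_realises_parameter[OF w(1), folded a_def b_def \<phi>_def]
    interpret confined_kernel \<kappa> g c a b \<phi>
    proof unfold_locales
      have "continuous_on (- {0}) \<kappa>"
        using C3 by (intro continuous_at_imp_continuous_on ballI differentiable_imp_continuous_within) (auto simp: C3_on_def)
      then show "\<kappa> \<in> borel_measurable borel" by (rule borel_measurable_continuous_off_0)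
      show "0 < g t" "g t \<le> 1" for t
      proof -
        have l: "15 / 16 \<le> pi * g t" "pi * g t \<le> 17 / 16" using g(2)[of t] unfolding abs_le_iff by linarith+
        then show "0 < g t" using zero_less_mult_pos[of pi "g t"] by simp
        have "g t \<le> 17 / 16 / pi" using l(2) by (simp add: le_divide_eq mult_ac)
        also have "\<dots> \<le> 1" using pi_gt3 by (simp add: divide_le_eq)
        finally show "g t \<le> 1" .
      qed
      show "\<bar>\<kappa> z\<bar> \<le> 1" if "z \<noteq> 0" for z
      proof -
        have "\<kappa> ((1 / norm z) *\<^sub>R z) = \<kappa> z" using hom that by (simp add: homogeneous_0_def)
        moreover have "norm ((1 / norm z) *\<^sub>R z) = 1" using that by simp
        ultimately show ?thesis using bd by (metis min.bounded_iff)
      qed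
      show "(\<integral>t. g t * ((Im (z * cis (- t)))\<^sup>2 / (width a b \<phi> t)\<^sup>2) \<partial>angles) = (norm z)\<^sup>2 / 2" for z
        unfolding p(7) by (rule w(2))
    qed (use g p in auto)
    show "\<exists>a b \<phi>. 0 < a \<and> 0 < b \<and> 0 \<le> \<phi> \<and> \<phi> < 2 * pi \<and>
        unique_minimiser (energy \<kappa>) borel_prob_measures (uniform_measure lborel (ellipse a b \<phi>))"
      using p unique_minimiser_ellipse_law by blast
  qed
qed

end
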